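(* The decision problem CMRC is $\exists\mathbb{R}$-hard; consequently CMRC is $\exists\mathbb{R}$-complete.
   Context: Polynomials are given as explicit sums of monomials with integer coefficients written in binary; rational numbers are given as fractions of integers. The complexity class $\exists\mathbb{R}$ consists of all decision problems that are polynomial-time many-one reducible to the existential theory of the reals, i.e. the set of true sentences $\exists x_1\dots\exists x_n\,\Phi(x_1,\dots,x_n)$ where $\Phi$ is a quantifier-free Boolean combination of polynomial equations and inequalities with integer coefficients. A problem is $\exists\mathbb{R}$-hard if the existential theory of the reals (equivalently, the problem FEAS: given $r\in\mathbb{Z}[y_1,\dots,y_m]$, does $r$ have a real zero?) polynomial-time many-one reduces to it, and $\exists\mathbb{R}$-complete if it is $\exists\mathbb{R}$-hard and in $\exists\mathbb{R}$. CMRC (Continuous Multi-Region Clustering): Instance: a polynomial $f\in\mathbb{Z}[x_1,\dots,x_d]$, rational numbers $\theta>0$ and $\delta>0$, and an integer $k\ge 1$. Question: do there exist $k$ points $p_1,\dots,p_k\in\mathbb{R}^d$ with $f(p_i)\ge\theta$ for all $i$ and $\|p_i-p_j\|\ge\delta$ (Euclidean norm) for all $i\ne j$? *)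

theory Defs
  imports "HOL-Analysis.L2_Norm" "HOL-Computational_Algebra.Polynomial"
begin

section \<open>Deterministic multi-tape Turing machines\<close>

text \<open>
  States are \<open>0, \<dots>, num_states\<close>; \<open>0\<close> is the start state and \<open>num_states\<close> is the halting state.
  Tape symbols are \<open>0, \<dots>, num_syms - 1\<close>; \<open>0\<close> is the blank, and \<open>1\<close>, \<open>2\<close> are the input bits.
  Only the finite part of the transition function described in \<open>wf_tm\<close> is ever consulted.
  Tapes are infinite in both directions.
\<close>

datatype move = MoveLeft | Stay | MoveRight

record tm =
  num_tapes :: nat
  num_syms :: nat
  num_states :: nat
  trans :: "nat \<Rightarrow> nat list \<Rightarrow> nat \<times> (nat \<times> move) list"

definition wf_tm :: "tm \<Rightarrow> bool" where
  "wf_tm M \<longleftrightarrow> num_tapes M \<ge> 1 \<and> num_syms M \<ge> 3 \<and>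
     (\<forall>q < num_states M. \<forall>rs. length rs = num_tapes M \<longrightarrow> set rs \<subseteq> {..<num_syms M} \<longrightarrow>
        (case trans M q rs of (q', acts) \<Rightarrow>
           q' \<le> num_states M \<and> length acts = num_tapes M \<and>
           fst ` set acts \<subseteq> {..<num_syms M}))"

type_synonym tape = "(int \<Rightarrow> nat) \<times> int"
type_synonym config = "nat \<times> tape list"

fun move_offset :: "move \<Rightarrow> int" where
  "move_offset MoveLeft = -1"
| "move_offset Stay = 0"
| "move_offset MoveRight = 1"

fun read_tape :: "tape \<Rightarrow> nat" where
  "read_tape (c, h) = c h"

fun act_tape :: "nat \<times> move \<Rightarrow> tape \<Rightarrow> tape" where
  "act_tape (s, m) (c, h) = (c(h := s), h + move_offset m)"

fun tm_step :: "tm \<Rightarrow> config \<Rightarrow> config" where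
  "tm_step M (q, ts) =
     (if q < num_states M
      then (case trans M q (map read_tape ts) of (q', acts) \<Rightarrow> (q', map2 act_tape acts ts))
      else (q, ts))"

definition bit_sym :: "bool \<Rightarrow> nat" where
  "bit_sym b = (if b then 2 else 1)"

definition blank_tape :: tape where
  "blank_tape = (\<lambda>_. 0, 0)"

definition input_tape :: "bool list \<Rightarrow> tape" where
  "input_tape w = (\<lambda>i. if 0 \<le> i \<and> i < int (length w) then bit_sym (w ! nat i) else 0, 0)"

definition start_config :: "tm \<Rightarrow> bool list \<Rightarrow> config" where
  "start_config M w = (0, input_tape w # replicate (num_tapes M - 1) blank_tape)"

text \<open>The output is read off the last tape, from cell \<open>0\<close> up to the first blank.\<close>

definition tape_holds :: "tape \<Rightarrow> bool list \<Rightarrow> bool" where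
  "tape_holds t v \<longleftrightarrow>
     (\<forall>i < length v. fst t (int i) = bit_sym (v ! i)) \<and> fst t (int (length v)) = 0"

definition computes_within :: "tm \<Rightarrow> bool list \<Rightarrow> bool list \<Rightarrow> nat \<Rightarrow> bool" where
  "computes_within M w v T \<longleftrightarrow>
     (\<exists>t \<le> T. case (tm_step M ^^ t) (start_config M w) of (q, ts) \<Rightarrow>
        q = num_states M \<and> tape_holds (last ts) v)"

section \<open>Decision problems and polynomial-time many-one reductions\<close>

record 'a problem =
  instances :: "'a set"
  yes :: "'a \<Rightarrow> bool"
  encode :: "'a \<Rightarrow> bool list"

text \<open>
  A reduction maps instances to instances; bit strings that encode no instance are not considered.
\<close>

definition poly_reducible :: "'a problem \<Rightarrow> 'b problem \<Rightarrow> bool" (infix "\<le>\<^sub>p" 50) where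
  "A \<le>\<^sub>p B \<longleftrightarrow>
     (\<exists>(f :: 'a \<Rightarrow> 'b) (M :: tm) (p :: nat poly). wf_tm M \<and>
        (\<forall>x \<in> instances A.
           f x \<in> instances B \<and> (yes A x \<longleftrightarrow> yes B (f x)) \<and>
           computes_within M (encode A x) (encode B (f x)) (poly p (length (encode A x)))))"

section \<open>Encodings by bit strings\<close>

text \<open>All encodings are self-delimiting, so they can be concatenated without separators.\<close>

definition enc_list :: "('a \<Rightarrow> bool list) \<Rightarrow> 'a list \<Rightarrow> bool list" where
  "enc_list e xs = concat (map (\<lambda>x. True # e x) xs) @ [False]"

definition enc_unary :: "nat \<Rightarrow> bool list" where
  "enc_unary n = replicate n True @ [False]"

text \<open>Binary digits, least significant digit first.\<close>

fun bits_of_nat :: "nat \<Rightarrow> bool list" where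
  "bits_of_nat n = (if n = 0 then [] else odd n # bits_of_nat (n div 2))"

declare bits_of_nat.simps [simp del]

definition enc_int :: "int \<Rightarrow> bool list" where
  "enc_int i = (i < 0) # enc_list (\<lambda>b. [b]) (bits_of_nat (nat \<bar>i\<bar>))"

section \<open>Polynomials as explicit sums of monomials\<close>

text \<open>
  \<open>(c, [e\<^sub>0, \<dots>, e\<^sub>n\<^sub>-\<^sub>1])\<close> stands for \<open>c x\<^sub>0^e\<^sub>0 \<cdots> x\<^sub>n\<^sub>-\<^sub>1^e\<^sub>n\<^sub>-\<^sub>1\<close>.
  A polynomial is given by a list of such terms, whose sum it is.
  Coefficients are written in binary, exponents in unary.
\<close>

type_synonym monomial = "int \<times> nat list"
type_synonym polynomial = "monomial list"

definition polynomial_in :: "nat \<Rightarrow> polynomial \<Rightarrow> bool" where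
  "polynomial_in n p \<longleftrightarrow> (\<forall>(c, es) \<in> set p. length es = n)"

fun eval_monomial :: "(nat \<Rightarrow> real) \<Rightarrow> monomial \<Rightarrow> real" where
  "eval_monomial x (c, es) = of_int c * (\<Prod>i < length es. x i ^ (es ! i))"

definition eval_polynomial :: "(nat \<Rightarrow> real) \<Rightarrow> polynomial \<Rightarrow> real" where
  "eval_polynomial x p = (\<Sum>m\<leftarrow>p. eval_monomial x m)"

fun enc_monomial :: "monomial \<Rightarrow> bool list" where
  "enc_monomial (c, es) = enc_int c @ enc_list enc_unary es"

definition enc_polynomial :: "polynomial \<Rightarrow> bool list" where
  "enc_polynomial p = enc_list enc_monomial p"

section \<open>The existential theory of the reals\<close>

text \<open>The atoms are \<open>p = 0\<close>, \<open>p > 0\<close> and \<open>p \<ge> 0\<close>.\<close>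

datatype qf_formula =
    EqZero polynomial
  | GtZero polynomial
  | GeZero polynomial
  | Neg qf_formula
  | Conj qf_formula qf_formula
  | Disj qf_formula qf_formula

fun formula_in :: "nat \<Rightarrow> qf_formula \<Rightarrow> bool" where
  "formula_in n (EqZero p) \<longleftrightarrow> polynomial_in n p"
| "formula_in n (GtZero p) \<longleftrightarrow> polynomial_in n p"
| "formula_in n (GeZero p) \<longleftrightarrow> polynomial_in n p"
| "formula_in n (Neg \<phi>) \<longleftrightarrow> formula_in n \<phi>"
| "formula_in n (Conj \<phi> \<psi>) \<longleftrightarrow> formula_in n \<phi> \<and> formula_in n \<psi>"
| "formula_in n (Disj \<phi> \<psi>) \<longleftrightarrow> formula_in n \<phi> \<and> formula_in n \<psi>"

fun holds :: "(nat \<Rightarrow> real) \<Rightarrow> qf_formula \<Rightarrow> bool" where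
  "holds x (EqZero p) \<longleftrightarrow> eval_polynomial x p = 0"
| "holds x (GtZero p) \<longleftrightarrow> eval_polynomial x p > 0"
| "holds x (GeZero p) \<longleftrightarrow> eval_polynomial x p \<ge> 0"
| "holds x (Neg \<phi>) \<longleftrightarrow> \<not> holds x \<phi>"
| "holds x (Conj \<phi> \<psi>) \<longleftrightarrow> holds x \<phi> \<and> holds x \<psi>"
| "holds x (Disj \<phi> \<psi>) \<longleftrightarrow> holds x \<phi> \<or> holds x \<psi>"

fun enc_formula :: "qf_formula \<Rightarrow> bool list" where
  "enc_formula (EqZero p) = [False, False, False] @ enc_polynomial p"
| "enc_formula (GtZero p) = [False, False, True] @ enc_polynomial p"
| "enc_formula (GeZero p) = [False, True, False] @ enc_polynomial p"
| "enc_formula (Neg \<phi>) = [False, True, True] @ enc_formula \<phi>"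
| "enc_formula (Conj \<phi> \<psi>) = [True, False, False] @ enc_formula \<phi> @ enc_formula \<psi>"
| "enc_formula (Disj \<phi> \<psi>) = [True, False, True] @ enc_formula \<phi> @ enc_formula \<psi>"

text \<open>
  An instance \<open>(n, \<Phi>)\<close> is the sentence \<open>\<exists>x\<^sub>0 \<dots> x\<^sub>n\<^sub>-\<^sub>1. \<Phi>\<close>.  For \<open>formula_in n \<Phi>\<close> the values of
  \<open>x :: nat \<Rightarrow> real\<close> outside \<open>{..<n}\<close> do not matter.
\<close>

definition ETR :: "(nat \<times> qf_formula) problem" where
  "ETR = \<lparr>
     instances = {(n, \<Phi>). formula_in n \<Phi>},
     yes = (\<lambda>(n, \<Phi>). \<exists>x :: nat \<Rightarrow> real. holds x \<Phi>),
     encode = (\<lambda>(n, \<Phi>). enc_unary n @ enc_formula \<Phi>) \<rparr>"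

definition in_ER :: "'a problem \<Rightarrow> bool" where
  "in_ER A \<longleftrightarrow> A \<le>\<^sub>p ETR"

definition ER_hard :: "'a problem \<Rightarrow> bool" where
  "ER_hard A \<longleftrightarrow> ETR \<le>\<^sub>p A"

definition ER_complete :: "'a problem \<Rightarrow> bool" where
  "ER_complete A \<longleftrightarrow> ER_hard A \<and> in_ER A"

section \<open>Continuous Multi-Region Clustering\<close>

type_synonym fraction = "int \<times> int"

fun fraction_value :: "fraction \<Rightarrow> real" where
  "fraction_value (a, b) = of_int a / of_int b"

fun enc_fraction :: "fraction \<Rightarrow> bool list" where
  "enc_fraction (a, b) = enc_int a @ enc_int b"

record cmrc_instance =
  dimension :: nat
  objective :: polynomial
  threshold :: fraction
  separation :: fraction
  num_points :: nat

definition cmrc_valid :: "cmrc_instance \<Rightarrow> bool" where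
  "cmrc_valid I \<longleftrightarrow>
     dimension I \<ge> 1 \<and> polynomial_in (dimension I) (objective I) \<and>
     snd (threshold I) \<noteq> 0 \<and> fraction_value (threshold I) > 0 \<and>
     snd (separation I) \<noteq> 0 \<and> fraction_value (separation I) > 0 \<and>
     num_points I \<ge> 1"

text \<open>
  A point of \<open>\<real>\<^sup>d\<close> is represented by the restriction of a function \<open>nat \<Rightarrow> real\<close> to \<open>{..<d}\<close>.
\<close>

definition cmrc_yes :: "cmrc_instance \<Rightarrow> bool" where
  "cmrc_yes I \<longleftrightarrow>
     (\<exists>P :: nat \<Rightarrow> nat \<Rightarrow> real.
        (\<forall>i < num_points I.
           eval_polynomial (P i) (objective I) \<ge> fraction_value (threshold I)) \<and>
        (\<forall>i < num_points I. \<forall>j < num_points I. i \<noteq> j \<longrightarrow>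
           L2_set (\<lambda>l. P i l - P j l) {..<dimension I} \<ge> fraction_value (separation I)))"

text \<open>
  The number of points is written in unary, as a solution consists of that many points.
\<close>

definition enc_cmrc :: "cmrc_instance \<Rightarrow> bool list" where
  "enc_cmrc I =
     enc_unary (dimension I) @ enc_polynomial (objective I) @
     enc_fraction (threshold I) @ enc_fraction (separation I) @ enc_unary (num_points I)"

definition CMRC :: "cmrc_instance problem" where
  "CMRC = \<lparr> instances = {I. cmrc_valid I}, yes = cmrc_yes, encode = enc_cmrc \<rparr>"

section \<open>The encodings are unambiguous\<close>

definition prefix_code :: "('a \<Rightarrow> bool list) \<Rightarrow> bool" where
  "prefix_code e \<longleftrightarrow> (\<forall>x y u v. e x @ u = e y @ v \<longrightarrow> x = y \<and> u = v)"

lemma prefix_codeD: "prefix_code e \<Longrightarrow> e x @ u = e y @ v \<longleftrightarrow> x = y \<and> u = v"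
  unfolding prefix_code_def by blast

lemma prefix_code_inj: "prefix_code e \<Longrightarrow> inj e"
  unfolding prefix_code_def inj_def by (metis append_Nil2)

lemma prefix_code_list:
  assumes "prefix_code e"
  shows "prefix_code (enc_list e)"
proof -
  have "enc_list e xs @ u = enc_list e ys @ v \<longrightarrow> xs = ys \<and> u = v" for xs ys u v
  proof (induction xs arbitrary: ys)
    case Nil
    show ?case by (cases ys) (auto simp: enc_list_def)
  next
    case (Cons x xs)
    show ?case
    proof (cases ys)
      case Nil
      then show ?thesis by (simp add: enc_list_def)
    next
      case (Cons y zs)
      with Cons.IH[of zs] show ?thesis
        by (auto simp: enc_list_def prefix_codeD[OF assms])
    qed
  qed
  then show ?thesis unfolding prefix_code_def by blast
qed

lemma prefix_code_unary: "prefix_code enc_unary"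
proof -
  have "enc_unary m @ u = enc_unary n @ v \<longrightarrow> m = n \<and> u = v" for m n u v
  proof (induction m arbitrary: n)
    case 0
    show ?case by (cases n) (auto simp: enc_unary_def)
  next
    case (Suc m)
    then show ?case by (cases n) (auto simp: enc_unary_def)
  qed
  then show ?thesis unfolding prefix_code_def by blast
qed

lemma inj_bits_of_nat: "inj bits_of_nat"
proof -
  have "bits_of_nat m = bits_of_nat n \<Longrightarrow> m = n" for m n
  proof (induction m arbitrary: n rule: less_induct)
    case (less m)
    have eq: "m = 0 \<longleftrightarrow> n = 0"
      using less.prems
      by (auto simp: bits_of_nat.simps[of m] bits_of_nat.simps[of n] split: if_splits)
    show ?case
    proof (cases "m = 0")
      case False
      with eq less.prems
      have "odd m = odd n" "bits_of_nat (m div 2) = bits_of_nat (n div 2)"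
        by (simp_all add: bits_of_nat.simps[of m] bits_of_nat.simps[of n])
      with less.IH[of "m div 2" "n div 2"] False have "m div 2 = n div 2" by simp
      with \<open>odd m = odd n\<close> show ?thesis by presburger
    qed (use eq in simp)
  qed
  then show ?thesis by (rule injI)
qed

lemma prefix_code_int: "prefix_code enc_int"
proof -
  have bits: "prefix_code (enc_list (\<lambda>b. [b]))"
    by (rule prefix_code_list) (simp add: prefix_code_def)
  have "i = j \<and> u = v" if "enc_int i @ u = enc_int j @ v" for i j u v
  proof -
    from that have "(i < 0) = (j < 0)" "bits_of_nat (nat \<bar>i\<bar>) = bits_of_nat (nat \<bar>j\<bar>)" "u = v"
      by (simp_all add: enc_int_def prefix_codeD[OF bits])
    moreover from this(2) have "nat \<bar>i\<bar> = nat \<bar>j\<bar>" by (rule injD[OF inj_bits_of_nat])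
    ultimately show ?thesis by linarith
  qed
  then show ?thesis unfolding prefix_code_def by blast
qed

lemma prefix_code_monomial: "prefix_code enc_monomial"
  unfolding prefix_code_def
  by (auto simp: prefix_codeD[OF prefix_code_int]
      prefix_codeD[OF prefix_code_list[OF prefix_code_unary]])

lemma prefix_code_polynomial: "prefix_code enc_polynomial"
  using prefix_code_list[OF prefix_code_monomial]
  by (simp add: prefix_code_def enc_polynomial_def)

lemma prefix_code_formula: "prefix_code enc_formula"
proof -
  have "enc_formula \<phi> @ u = enc_formula \<psi> @ v \<longleftrightarrow> \<phi> = \<psi> \<and> u = v" for \<phi> \<psi> u v
    by (induction \<phi> arbitrary: \<psi> u v; case_tac \<psi>;
        simp add: prefix_codeD[OF prefix_code_polynomial])
  then show ?thesis unfolding prefix_code_def by blast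
qed

lemma prefix_code_fraction: "prefix_code enc_fraction"
  unfolding prefix_code_def by (auto simp: prefix_codeD[OF prefix_code_int])

lemma inj_encode_ETR: "inj (encode ETR)"
  by (auto simp: ETR_def inj_def prefix_codeD[OF prefix_code_unary]
      dest: injD[OF prefix_code_inj[OF prefix_code_formula]])

lemma inj_encode_CMRC: "inj (encode CMRC)"
  by (auto simp: CMRC_def inj_def enc_cmrc_def
      prefix_codeD[OF prefix_code_unary] prefix_codeD[OF prefix_code_polynomial]
      prefix_codeD[OF prefix_code_fraction]
      dest: injD[OF prefix_code_inj[OF prefix_code_unary]])

end

theory Submission
  imports Defs
begin

text \<open>
  Both reductions translate an instance into gates, that is, polynomial equations \<open>q = 0\<close> in at most three
  variables each and with constant coefficients, which have a common solution iff the answer is yes.  The bits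
  of a coefficient and the units of an exponent each introduce a bounded number of fresh variables, so that the
  machines need no arithmetic on binary numbers; inequalities become equations by means of squares of slack
  variables, and the truth value of a subformula is a variable.

  The gates have a common solution iff \<open>- \<Sum>q\<^sup>2\<close> attains \<open>0\<close>.  So they turn into the clustering
  instance that asks for a single point with \<open>1 - \<Sum>q\<^sup>2 \<ge> 1\<close>, and into the sentence
  \<open>\<exists>x. - \<Sum>q\<^sup>2 \<ge> 0\<close>.

  The machines are programs that operate on stacks.  They write the terms of \<open>- \<Sum>q\<^sup>2\<close> while they
  read the input.  As a term lists the exponents of all variables, the number of
  variables is fixed in advance, to a bound that depends on the length of the input only.
\<close>

section \<open>Stack programs\<close>

text \<open>Hardness needs no gap or perturbation argument: \<open>1 - \<Sum>q\<^sup>2\<close> never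
  exceeds 1, equals 1 exactly at the common solutions, and a single point leaves no pair to
  separate. What shapes the development is that a reduction has to be a Turing machine with a
  polynomial time bound. Expanding a whole formula into one polynomial by products would blow up
  degree and number of terms, and binary coefficients would call for arithmetic. The square of a
  gate has boundedly many terms, fixed coefficients and degree at most four, so the output is a
  concatenation of blocks that depend on three variable indices and the number of variables only.
  Truth values are forced by the gates in both directions, which is why negation needs no normal
  form. The cubic number of variables comes from clustering: \<open>k\<close> points in dimension
  \<open>d\<close> have about \<open>k\<^sup>2 / 2\<close> pairs, each with \<open>2 * d + 2\<close>
  auxiliary variables, and both \<open>k\<close> and \<open>d\<close> are below the input length
  because they are written in unary. The same bound serves the other direction.\<close>

datatype prog =
    Skip
  | Push nat bool
  | Pop nat
  | Out bool
  | Seq prog prog  (infixr ";;" 60)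
  | Cond nat "bool option \<Rightarrow> bool" prog prog
  | Loop nat "bool option \<Rightarrow> bool" prog

type_synonym store = "(nat \<Rightarrow> bool list) \<times> bool list"

fun hd_opt :: "bool list \<Rightarrow> bool option" where
  "hd_opt [] = None"
| "hd_opt (b # _) = Some b"

text \<open>The times are the step counts of the compiled machine: a push moves first and writes
  next, every test takes one step, and \<open>Skip\<close> and sequencing are free. Popping an empty
  stack has no execution.\<close>

inductive exec :: "prog \<Rightarrow> store \<Rightarrow> nat \<Rightarrow> store \<Rightarrow> bool" where
  exec_Skip: "exec Skip s 0 s"
| exec_Push: "exec (Push r b) (\<sigma>, v) 2 (\<sigma>(r := b # \<sigma> r), v)"
| exec_Pop: "\<sigma> r = b # xs \<Longrightarrow> exec (Pop r) (\<sigma>, v) 1 (\<sigma>(r := xs), v)"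
| exec_Out: "exec (Out b) (\<sigma>, v) 1 (\<sigma>, v @ [b])"
| exec_Seq: "exec P s t s' \<Longrightarrow> exec Q s' u s'' \<Longrightarrow> exec (P ;; Q) s (t + u) s''"
| exec_Cond_True: "f (hd_opt (fst s r)) \<Longrightarrow> exec P s t s' \<Longrightarrow> exec (Cond r f P Q) s (Suc t) s'"
| exec_Cond_False: "\<not> f (hd_opt (fst s r)) \<Longrightarrow> exec Q s t s' \<Longrightarrow> exec (Cond r f P Q) s (Suc t) s'"
| exec_Loop_True: "f (hd_opt (fst s r)) \<Longrightarrow> exec P s t s' \<Longrightarrow> exec (Loop r f P) s' u s'' \<Longrightarrow>
    exec (Loop r f P) s (Suc (t + u)) s''"
| exec_Loop_False: "\<not> f (hd_opt (fst s r)) \<Longrightarrow> exec (Loop r f P) s 1 s"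

text \<open>The states of a compiled block are those below its size, and the size itself is its
  exit, so blocks are chained by shifting states. \<open>Skip\<close> is the block whose start is
  already its exit.\<close>

fun psize :: "prog \<Rightarrow> nat" where
  "psize Skip = 0"
| "psize (Push _ _) = 2"
| "psize (Pop _) = 1"
| "psize (Out _) = 1"
| "psize (P ;; Q) = psize P + psize Q"
| "psize (Cond _ _ P Q) = Suc (psize P + psize Q)"
| "psize (Loop _ _ P) = Suc (psize P)"

fun regs_bound :: "prog \<Rightarrow> nat" where
  "regs_bound Skip = 0"
| "regs_bound (Push r _) = Suc r"
| "regs_bound (Pop r) = Suc r"
| "regs_bound (Out _) = 0"
| "regs_bound (P ;; Q) = max (regs_bound P) (regs_bound Q)"
| "regs_bound (Cond r _ P Q) = max (Suc r) (max (regs_bound P) (regs_bound Q))"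
| "regs_bound (Loop r _ P) = max (Suc r) (regs_bound P)"

section \<open>Compilation of stack programs into transition tables\<close>

definition keep :: "nat list \<Rightarrow> (nat \<times> move) list" where
  "keep rs = map (\<lambda>a. (a, Stay)) rs"

text \<open>
  The top of a stack is the cell under the head.  Stack \<open>0\<close> is the input tape and grows to the left,
  so that the first input bit is its top; the other stacks grow to the right.
\<close>

definition push_move :: "nat \<Rightarrow> move" where
  "push_move r = (if r = 0 then MoveLeft else MoveRight)"

definition pop_move :: "nat \<Rightarrow> move" where
  "pop_move r = (if r = 0 then MoveRight else MoveLeft)"

definition sym_bit :: "nat \<Rightarrow> bool option" where
  "sym_bit a = (if a = 0 then None else Some (a = 2))"

text \<open>Tape \<open>k\<close> is the output. In a composite the states of a part are renamed and
  its exit is redirected. The first branch and the loop body are entered through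
  \<open>exit 0\<close> and \<open>back 0\<close>, because for a part of size zero the start is the
  exit.\<close>

fun ptrans :: "nat \<Rightarrow> prog \<Rightarrow> nat \<Rightarrow> nat list \<Rightarrow> nat \<times> (nat \<times> move) list" where
  "ptrans k Skip q rs = (0, keep rs)"
| "ptrans k (Push r b) q rs =
     (if q = 0 then (1, (keep rs)[r := (rs ! r, push_move r)])
      else (2, (keep rs)[r := (bit_sym b, Stay)]))"
| "ptrans k (Pop r) q rs = (1, (keep rs)[r := (rs ! r, pop_move r)])"
| "ptrans k (Out b) q rs = (1, (keep rs)[k := (bit_sym b, MoveRight)])"
| "ptrans k (P ;; Q) q rs =
     (if q < psize P then ptrans k P q rs
      else apfst (\<lambda>q'. psize P + q') (ptrans k Q (q - psize P) rs))"
| "ptrans k (Cond r f P Q) q rs =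
     (let exit = (\<lambda>q'. if q' = psize P then Suc (psize P + psize Q) else Suc q')
      in if q = 0 then (if f (sym_bit (rs ! r)) then exit 0 else Suc (psize P), keep rs)
         else if q \<le> psize P then apfst exit (ptrans k P (q - 1) rs)
         else apfst (\<lambda>q'. Suc (psize P + q')) (ptrans k Q (q - Suc (psize P)) rs))"
| "ptrans k (Loop r f P) q rs =
     (let back = (\<lambda>q'. if q' = psize P then 0 else Suc q')
      in if q = 0 then (if f (sym_bit (rs ! r)) then back 0 else Suc (psize P), keep rs)
         else apfst back (ptrans k P (q - 1) rs))"

text \<open>Table and number of states are separate arguments so that a run of a part can be carried
  over into the table of the whole. Every step starts below \<open>n\<close>, hence it only consults
  rows that the whole has copied from the part.\<close>

primrec steps :: "(nat \<Rightarrow> nat list \<Rightarrow> nat \<times> (nat \<times> move) list) \<Rightarrow> nat \<Rightarrow> nat \<Rightarrow> config \<Rightarrow> config \<Rightarrow> bool"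
where
  "steps \<delta> n 0 a b \<longleftrightarrow> a = b"
| "steps \<delta> n (Suc t) a b \<longleftrightarrow> fst a < n \<and>
     steps \<delta> n t (case \<delta> (fst a) (map read_tape (snd a)) of (q', acts) \<Rightarrow> (q', map2 act_tape acts (snd a))) b"

lemma steps_trans:
  "steps \<delta> n t a b \<Longrightarrow> steps \<delta> n u b c \<Longrightarrow> steps \<delta> n (t + u) a c"
  by (induction t arbitrary: a) auto

text \<open>Renaming states turns a run of a part into a run of the whole. The exit \<open>n\<close>
  of the part may be sent anywhere, even back to the start, which is what a loop does.\<close>

lemma steps_embed:
  assumes "\<And>q rs. q < n \<Longrightarrow> \<delta>' (\<phi> q) rs = apfst \<phi> (\<delta> q rs)"
    and "\<And>q. q < n \<Longrightarrow> \<phi> q < n'"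
  shows "steps \<delta> n t (q, ts) (q', ts') \<Longrightarrow> steps \<delta>' n' t (\<phi> q, ts) (\<phi> q', ts')"
proof (induction t arbitrary: q ts)
  case (Suc t)
  then show ?case
    using assms by (auto split: prod.splits)
qed auto

lemma steps_funpow:
  assumes "steps (trans M) (num_states M) t a b"
  shows "(tm_step M ^^ t) a = b"
  using assms
proof (induction t arbitrary: a)
  case (Suc t)
  have "tm_step M a = (case trans M (fst a) (map read_tape (snd a)) of (q', acts) \<Rightarrow> (q', map2 act_tape acts (snd a)))"
    using Suc.prems by (cases a) simp
  with Suc show ?case by (simp add: funpow_swap1 del: funpow.simps add: funpow_Suc_right)
qed auto

section \<open>Stores as tape contents, and correctness of the compilation\<close>

definition stack_dir :: "nat \<Rightarrow> int" where
  "stack_dir r = (if r = 0 then -1 else 1)"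

text \<open>Cells beyond the top are arbitrary, since a pop only moves the head. The blank below the
  bottom makes an empty stack recognisable.\<close>

fun holds_stack :: "int \<Rightarrow> tape \<Rightarrow> bool list \<Rightarrow> bool" where
  "holds_stack d (c, h) xs \<longleftrightarrow>
     (\<forall>i < length xs. c (h - d * int i) = bit_sym (xs ! i)) \<and> c (h - d * int (length xs)) = 0"

text \<open>Stronger than \<open>tape_holds\<close>: the head is just past the text and everything
  from there on is blank, so that appending a bit preserves the property.\<close>

fun holds_output :: "tape \<Rightarrow> bool list \<Rightarrow> bool" where
  "holds_output (c, h) v \<longleftrightarrow>
     h = int (length v) \<and> (\<forall>i < length v. c (int i) = bit_sym (v ! i)) \<and> (\<forall>i \<ge> h. c i = 0)"

definition represents :: "nat \<Rightarrow> store \<Rightarrow> tape list \<Rightarrow> bool" where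
  "represents k s ts \<longleftrightarrow> length ts = Suc k \<and>
     (\<forall>r < k. holds_stack (stack_dir r) (ts ! r) (fst s r)) \<and> holds_output (ts ! k) (snd s)"

lemma act_keep: "map2 act_tape (keep (map read_tape ts)) ts = ts"
proof (rule nth_equalityI)
  fix i assume "i < length (map2 act_tape (keep (map read_tape ts)) ts)"
  then show "map2 act_tape (keep (map read_tape ts)) ts ! i = ts ! i"
    by (cases "ts ! i") (auto simp: keep_def)
qed (simp add: keep_def)

lemma act_keep_update:
  assumes "r < length ts"
  shows "map2 act_tape ((keep (map read_tape ts))[r := a]) ts = ts[r := act_tape a (ts ! r)]"
proof (rule nth_equalityI)
  fix i assume "i < length (map2 act_tape ((keep (map read_tape ts))[r := a]) ts)"
  then show "map2 act_tape ((keep (map read_tape ts))[r := a]) ts ! i = ts[r := act_tape a (ts ! r)] ! i"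
    using assms by (cases "i = r"; cases "ts ! i") (auto simp: keep_def)
qed (simp add: keep_def)

lemma sym_bit_read:
  assumes "represents k s ts" "r < k"
  shows "sym_bit (read_tape (ts ! r)) = hd_opt (fst s r)"
proof (cases "fst s r")
  case Nil
  with assms show ?thesis
    by (cases "ts ! r") (auto simp: represents_def sym_bit_def dest!: spec[of _ r])
next
  case (Cons b xs)
  obtain c h where T: "ts ! r = (c, h)" by (cases "ts ! r")
  have "holds_stack (stack_dir r) (ts ! r) (fst s r)" using assms by (auto simp: represents_def)
  then have "c (h - stack_dir r * int 0) = bit_sym ((b # xs) ! 0)"
    unfolding T Cons holds_stack.simps by blast
  with Cons T show ?thesis by (auto simp: sym_bit_def bit_sym_def)
qed

lemma holds_stack_push:
  assumes "holds_stack (stack_dir r) T xs"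
  shows "holds_stack (stack_dir r) (act_tape (bit_sym b, Stay) (act_tape (read_tape T, push_move r) T)) (b # xs)"
proof (cases T)
  case (Pair c h)
  have [simp]: "h + move_offset (push_move r) = h + stack_dir r"
    by (simp add: push_move_def stack_dir_def)
  \<comment> \<open>The direction is 1 or -1, so different depths are different cells and the pushed
    bit overwrites none of the old entries.\<close>
  have d: "stack_dir r * i \<noteq> stack_dir r * j" if "i \<noteq> j" for i j
    using that by (simp add: stack_dir_def)
  have "c (h + stack_dir r - stack_dir r * int i) = bit_sym ((b # xs) ! i)"
    "h + stack_dir r - stack_dir r * int i \<noteq> h + stack_dir r" if "0 < i" "i < Suc (length xs)" for i
    using that assms Pair d[of "int i" 0] by (cases i; auto simp: algebra_simps)+
  moreover have "stack_dir r * int (length xs) \<noteq> - stack_dir r"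
    by (auto simp: stack_dir_def)
  ultimately show ?thesis
    using assms Pair by (auto simp: algebra_simps less_Suc_eq_0_disj) 
qed

lemma holds_stack_pop:
  assumes "holds_stack (stack_dir r) T (b # xs)"
  shows "holds_stack (stack_dir r) (act_tape (read_tape T, pop_move r) T) xs"
proof (cases T)
  case (Pair c h)
  have h: "h + move_offset (pop_move r) = h - stack_dir r"
    by (simp add: pop_move_def stack_dir_def)
  have "c (h - stack_dir r - stack_dir r * int i) = bit_sym (xs ! i)" if "i < length xs" for i
  proof -
    have "c (h - stack_dir r * int (Suc i)) = bit_sym ((b # xs) ! Suc i)"
      using assms that unfolding Pair holds_stack.simps by (metis Suc_less_eq length_Cons)
    then show ?thesis by (simp add: algebra_simps)
  qed
  moreover have "c (h - stack_dir r - stack_dir r * int (length xs)) = 0"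
    using assms Pair by (simp add: algebra_simps)
  ultimately show ?thesis unfolding Pair act_tape.simps holds_stack.simps h by simp
qed

lemma represents_update:
  assumes "represents k (\<sigma>, v) ts" "r < k" "holds_stack (stack_dir r) T xs"
  shows "represents k (\<sigma>(r := xs), v) (ts[r := T])"
  using assms by (auto simp: represents_def nth_list_update)

lemma represents_out:
  assumes "represents k (\<sigma>, v) ts"
  shows "represents k (\<sigma>, v @ [b]) (ts[k := act_tape (bit_sym b, MoveRight) (ts ! k)])"
  using assms by (cases "ts ! k") (auto simp: represents_def nth_append less_Suc_eq)

text \<open>Induction on the execution: the runs of the parts, given by the hypotheses, are carried
  into the composite table by \<open>steps_embed\<close> and joined by
  \<open>steps_trans\<close>.\<close>

theorem exec_steps:
  assumes "exec P s t s'" "regs_bound P \<le> k" "represents k s ts"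
  shows "\<exists>ts'. steps (ptrans k P) (psize P) t (0, ts) (psize P, ts') \<and> represents k s' ts'"
  using assms
proof (induction arbitrary: ts rule: exec.induct)
  case (exec_Skip s)
  then show ?case by auto
next
  case (exec_Push r b \<sigma> v)
  let ?T = "act_tape (read_tape (ts ! r), push_move r) (ts ! r)"
  let ?ts = "ts[r := ?T]"
  have r: "r < k" "r < length ts" using exec_Push by (auto simp: represents_def)
  have "holds_stack (stack_dir r) (ts ! r) (\<sigma> r)" using exec_Push r by (auto simp: represents_def)
  from represents_update[OF exec_Push.prems(2) r(1) holds_stack_push[OF this]]
  show ?case using r
    by (intro exI[of _ "?ts[r := act_tape (bit_sym b, Stay) ?T]"])
      (simp add: numeral_2_eq_2 act_keep_update[OF r(2)] act_keep_update[of r ?ts] del: act_tape.simps)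
next
  case (exec_Pop \<sigma> r b xs v)
  have r: "r < k" "r < length ts" using exec_Pop by (auto simp: represents_def)
  have "holds_stack (stack_dir r) (ts ! r) (b # xs)" using exec_Pop r by (metis fst_conv represents_def)
  from represents_update[OF exec_Pop.prems(2) r(1) holds_stack_pop[OF this]]
  show ?case using r by (simp add: act_keep_update[OF r(2)])
next
  case (exec_Out b \<sigma> v)
  have "k < length ts" using exec_Out by (simp add: represents_def)
  with represents_out[OF exec_Out(2)] show ?case
    by (simp add: act_keep_update)
next
  case (exec_Seq P s t s' Q u s'')
  from exec_Seq.IH(1)[OF _ exec_Seq.prems(2)] exec_Seq.prems(1)
  obtain ts1 where 1: "steps (ptrans k P) (psize P) t (0, ts) (psize P, ts1)" "represents k s' ts1"
    by auto
  from exec_Seq.IH(2)[OF _ 1(2)] exec_Seq.prems(1)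
  obtain ts2 where 2: "steps (ptrans k Q) (psize Q) u (0, ts1) (psize Q, ts2)" "represents k s'' ts2"
    by auto
  have "steps (ptrans k (P ;; Q)) (psize (P ;; Q)) t (id 0, ts) (id (psize P), ts1)"
    by (rule steps_embed[OF _ _ 1(1)]) (simp_all add: apfst_def map_prod.identity id_def[symmetric] map_prod.id)
  then have "steps (ptrans k (P ;; Q)) (psize (P ;; Q)) t (0, ts) (psize P, ts1)" by simp
  moreover have "steps (ptrans k (P ;; Q)) (psize (P ;; Q)) u (psize P + 0, ts1) (psize P + psize Q, ts2)"
    by (rule steps_embed[OF _ _ 2(1)]) auto
  ultimately have "steps (ptrans k (P ;; Q)) (psize (P ;; Q)) (t + u) (0, ts) (psize P + psize Q, ts2)"
    by (simp add: steps_trans)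
  with 2(2) show ?case unfolding psize.simps by blast
next
  case (exec_Cond_True f s r P t s' Q)
  let ?ex = "\<lambda>q'. if q' = psize P then Suc (psize P + psize Q) else Suc q'"
  from exec_Cond_True.IH[OF _ exec_Cond_True.prems(2)] exec_Cond_True.prems(1)
  obtain ts1 where 1: "steps (ptrans k P) (psize P) t (0, ts) (psize P, ts1)" "represents k s' ts1"
    by auto
  have r: "r < k" "r < length ts" using exec_Cond_True.prems by (auto simp: represents_def)
  have "steps (ptrans k (Cond r f P Q)) (psize (Cond r f P Q)) t (?ex 0, ts) (?ex (psize P), ts1)"
    by (rule steps_embed[OF _ _ 1(1)]) (auto simp: Let_def)
  then have "steps (ptrans k (Cond r f P Q)) (psize (Cond r f P Q)) (Suc t) (0, ts) (psize (Cond r f P Q), ts1)"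
    using exec_Cond_True.hyps(1) r sym_bit_read[OF exec_Cond_True.prems(2) r(1)]
    by (simp add: act_keep Let_def)
  with 1(2) show ?case by blast
next
  case (exec_Cond_False f s r Q t s' P)
  from exec_Cond_False.IH[OF _ exec_Cond_False.prems(2)] exec_Cond_False.prems(1)
  obtain ts1 where 1: "steps (ptrans k Q) (psize Q) t (0, ts) (psize Q, ts1)" "represents k s' ts1"
    by auto
  have r: "r < k" "r < length ts" using exec_Cond_False.prems by (auto simp: represents_def)
  have "steps (ptrans k (Cond r f P Q)) (psize (Cond r f P Q)) t (Suc (psize P + 0), ts) (Suc (psize P + psize Q), ts1)"
    by (rule steps_embed[OF _ _ 1(1)]) (auto simp: Let_def)
  then have "steps (ptrans k (Cond r f P Q)) (psize (Cond r f P Q)) (Suc t) (0, ts) (psize (Cond r f P Q), ts1)"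
    using exec_Cond_False.hyps(1) r sym_bit_read[OF exec_Cond_False.prems(2) r(1)]
    by (simp add: act_keep Let_def)
  with 1(2) show ?case by blast
next
  case (exec_Loop_True f s r P t s' u s'')
  let ?W = "Loop r f P"
  \<comment> \<open>The exit of the body becomes state \<open>0\<close>, the loop test; the
    remaining rounds are already a run of the same table and need no renaming.\<close>
  let ?ex = "\<lambda>q'. if q' = psize P then 0 else Suc q'"
  from exec_Loop_True.IH(1)[OF _ exec_Loop_True.prems(2)] exec_Loop_True.prems(1)
  obtain ts1 where 1: "steps (ptrans k P) (psize P) t (0, ts) (psize P, ts1)" "represents k s' ts1"
    by auto
  from exec_Loop_True.IH(2)[OF exec_Loop_True.prems(1) 1(2)]
  obtain ts2 where 2: "steps (ptrans k ?W) (psize ?W) u (0, ts1) (psize ?W, ts2)" "represents k s'' ts2"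
    by blast
  have r: "r < k" "r < length ts" using exec_Loop_True.prems by (auto simp: represents_def)
  have "steps (ptrans k ?W) (psize ?W) t (?ex 0, ts) (?ex (psize P), ts1)"
    by (rule steps_embed[OF _ _ 1(1)]) (auto simp: Let_def)
  then have "steps (ptrans k ?W) (psize ?W) (Suc t) (0, ts) (0, ts1)"
    using exec_Loop_True.hyps(1) r sym_bit_read[OF exec_Loop_True.prems(2) r(1)]
    by (simp add: act_keep Let_def)
  then have "steps (ptrans k ?W) (psize ?W) (Suc (t + u)) (0, ts) (psize ?W, ts2)"
    using steps_trans 2(1) by (metis add_Suc)
  with 2(2) show ?case by blast
next
  case (exec_Loop_False f s r P)
  have r: "r < k" "r < length ts" using exec_Loop_False.prems by (auto simp: represents_def)
  then show ?case
    using exec_Loop_False sym_bit_read[OF exec_Loop_False.prems(2) r(1)]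
    by (auto simp: act_keep Let_def)
qed

text \<open>The successor provides at least one stack, so the input tape is never the output
  tape.\<close>

definition tm_of :: "prog \<Rightarrow> tm" where
  "tm_of P = (let k = Suc (regs_bound P) in
     \<lparr> num_tapes = Suc k, num_syms = 3, num_states = psize P, trans = ptrans k P \<rparr>)"

lemma ptrans_bounds:
  assumes "q < psize P" "set rs \<subseteq> {..<3}" "regs_bound P \<le> k" "length rs = Suc k"
  shows "fst (ptrans k P q rs) \<le> psize P \<and> length (snd (ptrans k P q rs)) = length rs \<and>
    fst ` set (snd (ptrans k P q rs)) \<subseteq> {..<3}"
  using assms
proof (induction P arbitrary: q)
  have keep: "length (keep rs) = length rs" "fst ` set (keep rs) \<subseteq> {..<3}"
    using assms(2) by (auto simp: keep_def)
  have upd: "fst ` set ((keep rs)[r := (a, m)]) \<subseteq> {..<3}" if "a < 3" for r a m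
    using set_update_subset_insert[of "keep rs" r "(a, m)"] keep(2) that by fastforce
  have nth: "rs ! r < 3" if "r \<le> k" for r
    using assms(2,4) that by (metis le_imp_less_Suc lessThan_iff nth_mem subset_iff)
  have bit: "bit_sym b < 3" for b by (simp add: bit_sym_def)
  {
    case Skip
    then show ?case by simp
  next
    case (Push r b)
    then show ?case using upd[OF nth] upd[OF bit] keep by simp
  next
    case (Pop r)
    then show ?case using upd[OF nth] keep by simp
  next
    case (Out b)
    then show ?case using upd[OF bit] keep by simp
  next
    case (Seq P Q)
    then show ?case
      using Seq.IH(1)[of q] Seq.IH(2)[of "q - psize P"]
      by (cases "q < psize P") (simp_all add: trans_le_add1)
  next
    case (Cond r f P Q)
    consider "q = 0" | "0 < q" "q \<le> psize P" | "psize P < q" by linarith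
    then show ?case
    proof cases
      case 2
      with Cond.IH(1)[of "q - 1"] Cond.prems show ?thesis by (auto simp: Let_def trans_le_add1)
    next
      case 3
      with Cond.IH(2)[of "q - Suc (psize P)"] Cond.prems show ?thesis by (auto simp: Let_def)
    qed (use Cond.prems keep in \<open>auto simp: Let_def\<close>)
  next
    case (Loop r f P)
    then show ?case
      using keep Loop.IH[of "q - 1"] by (auto simp: Let_def not_less)
  }
qed

lemma wf_tm_of: "wf_tm (tm_of P)"
proof -
  have "case ptrans (Suc (regs_bound P)) P q rs of (q', acts) \<Rightarrow>
      q' \<le> psize P \<and> length acts = Suc (Suc (regs_bound P)) \<and> fst ` set acts \<subseteq> {..<3}"
    if "q < psize P" "length rs = Suc (Suc (regs_bound P))" "set rs \<subseteq> {..<3}" for q rs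
    using ptrans_bounds[OF that(1,3), of "Suc (regs_bound P)"] that(2)
    by (simp add: case_prod_beta)
  then show ?thesis by (simp add: wf_tm_def tm_of_def Let_def)
qed

lemma exec_computes:
  assumes "exec P ((\<lambda>_. [])(0 := w), []) t (\<sigma>, v)" "t \<le> T"
  shows "computes_within (tm_of P) w v T"
proof -
  define k where "k = Suc (regs_bound P)"
  define ts where "ts = input_tape w # replicate k blank_tape"
  have "holds_stack (stack_dir r) (ts ! r) (((\<lambda>_. [])(0 := w)) r)" if "r < k" for r
    using that by (cases r) (auto simp: ts_def stack_dir_def input_tape_def blank_tape_def)
  moreover have "ts ! k = blank_tape" by (simp add: ts_def k_def nth_Cons')
  ultimately have "represents k ((\<lambda>_. [])(0 := w), []) ts"
    by (simp add: represents_def) (simp add: ts_def blank_tape_def)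
  from exec_steps[OF assms(1) _ this]
  obtain ts' where ts': "steps (ptrans k P) (psize P) t (0, ts) (psize P, ts')" "represents k (\<sigma>, v) ts'"
    by (auto simp: k_def)
  have "(tm_step (tm_of P) ^^ t) (start_config (tm_of P) w) = (psize P, ts')"
    by (rule steps_funpow) (use ts'(1) in \<open>simp add: tm_of_def start_config_def ts_def k_def Let_def\<close>)
  moreover have "tape_holds (last ts') v"
  proof -
    have "last ts' = ts' ! k" using ts'(2)
      by (metis represents_def last_conv_nth diff_Suc_1 list.size(3) nat.distinct(1))
    with ts'(2) show ?thesis by (cases "ts' ! k") (auto simp: represents_def tape_holds_def)
  qed
  ultimately show ?thesis
    using assms(2) by (auto simp: computes_within_def tm_of_def Let_def)
qed


section \<open>Counters and words\<close>

text \<open>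
  From now on the even-numbered stacks hold words, and an odd-numbered stack, of height \<open>n\<close>, is a
  counter with value \<open>n\<close>.
\<close>

type_synonym state = "(nat \<Rightarrow> nat) \<times> (nat \<Rightarrow> bool list) \<times> bool list"

definition stacks :: "(nat \<Rightarrow> nat) \<Rightarrow> (nat \<Rightarrow> bool list) \<Rightarrow> nat \<Rightarrow> bool list" where
  "stacks c w r = (if even r then w (r div 2) else replicate (c (r div 2)) True)"

text \<open>From here on times are upper bounds, so that costs can be rounded up and the two
  branches of a test can share one bound.\<close>

fun run :: "prog \<Rightarrow> state \<Rightarrow> nat \<Rightarrow> state \<Rightarrow> bool" where
  "run P (c, w, v) t (c', w', v') \<longleftrightarrow> (\<exists>u \<le> t. exec P (stacks c w, v) u (stacks c' w', v'))"

definition Inc :: "nat \<Rightarrow> prog" where "Inc r = Push (2 * r + 1) True"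
definition Dec :: "nat \<Rightarrow> prog" where "Dec r = Pop (2 * r + 1)"
definition Push_word :: "nat \<Rightarrow> bool \<Rightarrow> prog" where "Push_word r b = Push (2 * r) b"
definition Pop_word :: "nat \<Rightarrow> prog" where "Pop_word r = Pop (2 * r)"
definition If_zero :: "nat \<Rightarrow> prog \<Rightarrow> prog \<Rightarrow> prog" where
  "If_zero r P Q = Cond (2 * r + 1) (\<lambda>x. x = None) P Q"
definition While_pos :: "nat \<Rightarrow> prog \<Rightarrow> prog" where
  "While_pos r P = Loop (2 * r + 1) (\<lambda>x. x \<noteq> None) P"
definition If_top :: "nat \<Rightarrow> prog \<Rightarrow> prog \<Rightarrow> prog" where
  "If_top r P Q = Cond (2 * r) (\<lambda>x. x = Some True) P Q"
definition While_top :: "nat \<Rightarrow> prog \<Rightarrow> prog" where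
  "While_top r P = Loop (2 * r) (\<lambda>x. x = Some True) P"
definition While_nonempty :: "nat \<Rightarrow> prog \<Rightarrow> prog" where
  "While_nonempty r P = Loop (2 * r) (\<lambda>x. x \<noteq> None) P"

lemma stacks_counter: "(stacks c w)(Suc (2 * r) := replicate n True) = stacks (c(r := n)) w"
  by (auto simp: stacks_def fun_eq_iff elim!: oddE)

lemma stacks_word: "(stacks c w)(2 * r := xs) = stacks c (w(r := xs))"
  by (auto simp: stacks_def fun_eq_iff elim!: evenE)

lemma stacks_apply [simp]:
  "stacks c w (Suc (2 * r)) = replicate (c r) True" "stacks c w (2 * r) = w r"
  by (auto simp: stacks_def)

lemma hd_opt_replicate [simp]: "hd_opt (replicate n True) = (if n = 0 then None else Some True)"
  by (cases n) auto

lemma runI: "exec P (stacks c w, v) u (stacks c' w', v') \<Longrightarrow> u \<le> t \<Longrightarrow> run P (c, w, v) t (c', w', v')"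
  by auto

lemma run_conv: "run P s t s' \<Longrightarrow> t \<le> t' \<Longrightarrow> s' = s'' \<Longrightarrow> run P s t' s''"
  by (cases s; cases s'; cases s'') (auto intro: le_trans)

lemma run_pre: "run P s t s' \<Longrightarrow> s = s0 \<Longrightarrow> run P s0 t s'"
  by simp

lemma run_Skip: "run Skip s 0 s"
  by (cases s) (auto intro: exec.intros)

lemma run_Seq: "run P s t s' \<Longrightarrow> run Q s' u s'' \<Longrightarrow> run (P ;; Q) s (t + u) s''"
  by (cases s; cases s'; cases s'') (auto intro!: runI exec_Seq add_mono simp del: run.simps elim!: run.elims)

lemma run_Out: "run (Out b) (c, w, v) 1 (c, w, v @ [b])"
  by (rule runI[OF exec_Out]) simp

lemma run_Inc: "run (Inc r) (c, w, v) 2 (c(r := Suc (c r)), w, v)"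
proof -
  have "exec (Push (2 * r + 1) True) (stacks c w, v) 2
      ((stacks c w)(2 * r + 1 := True # stacks c w (2 * r + 1)), v)" by (rule exec_Push)
  then show ?thesis using stacks_counter[of c w r "Suc (c r)"] by (auto simp: Inc_def)
qed

lemma run_Dec: "0 < c r \<Longrightarrow> run (Dec r) (c, w, v) 1 (c(r := c r - 1), w, v)"
proof -
  assume "0 < c r"
  then have "exec (Pop (2 * r + 1)) (stacks c w, v) 1
      ((stacks c w)(2 * r + 1 := replicate (c r - 1) True), v)"
    by (intro exec_Pop[of _ _ True]) (cases "c r"; simp)
  then show ?thesis using stacks_counter[of c w r "c r - 1"] by (auto simp: Dec_def)
qed

lemma run_Push_word: "run (Push_word r b) (c, w, v) 2 (c, w(r := b # w r), v)"
  using exec_Push[of "2 * r" b "stacks c w" v] stacks_word[of c w r "b # w r"]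
  by (auto simp: Push_word_def)

lemma run_Pop_word: "w r \<noteq> [] \<Longrightarrow> run (Pop_word r) (c, w, v) 1 (c, w(r := tl (w r)), v)"
  using exec_Pop[of "stacks c w" "2 * r" "hd (w r)" "tl (w r)" v] stacks_word[of c w r "tl (w r)"]
  by (auto simp: Pop_word_def)

lemma run_If_zero:
  assumes "c r = 0 \<Longrightarrow> run P (c, w, v) t s" "c r \<noteq> 0 \<Longrightarrow> run Q (c, w, v) t s"
  shows "run (If_zero r P Q) (c, w, v) (Suc t) s"
proof -
  obtain c' w' v' where s: "s = (c', w', v')" by (cases s)
  show ?thesis
  proof (cases "c r = 0")
    case True
    with assms(1) s obtain u where "u \<le> t" "exec P (stacks c w, v) u (stacks c' w', v')" by auto
    with True show ?thesis unfolding s If_zero_def by (intro runI[OF exec_Cond_True]) auto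
  next
    case False
    with assms(2) s obtain u where "u \<le> t" "exec Q (stacks c w, v) u (stacks c' w', v')" by auto
    with False show ?thesis unfolding s If_zero_def by (intro runI[OF exec_Cond_False]) auto
  qed
qed

lemma run_If_top:
  assumes "w r \<noteq> []" "hd (w r) \<Longrightarrow> run P (c, w, v) t s" "\<not> hd (w r) \<Longrightarrow> run Q (c, w, v) t s"
  shows "run (If_top r P Q) (c, w, v) (Suc t) s"
proof -
  obtain c' w' v' where s: "s = (c', w', v')" by (cases s)
  show ?thesis
  proof (cases "hd (w r)")
    case True
    with assms(2) s obtain u where "u \<le> t" "exec P (stacks c w, v) u (stacks c' w', v')" by auto
    with True assms(1) show ?thesis unfolding s If_top_def
      by (intro runI[OF exec_Cond_True]) (auto simp: neq_Nil_conv)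
  next
    case False
    with assms(3) s obtain u where "u \<le> t" "exec Q (stacks c w, v) u (stacks c' w', v')" by auto
    with False assms(1) show ?thesis unfolding s If_top_def
      by (intro runI[OF exec_Cond_False]) (auto simp: neq_Nil_conv)
  qed
qed

lemma run_Loop_True:
  assumes "f (hd_opt (stacks c w r))" "run P (c, w, v) t s" "run (Loop r f P) s u s'"
  shows "run (Loop r f P) (c, w, v) (Suc (t + u)) s'"
proof -
  obtain c1 w1 v1 c2 w2 v2 where s: "s = (c1, w1, v1)" "s' = (c2, w2, v2)"
    by (cases s; cases s')
  with assms obtain t' u' where "t' \<le> t" "u' \<le> u"
    "exec P (stacks c w, v) t' (stacks c1 w1, v1)"
    "exec (Loop r f P) (stacks c1 w1, v1) u' (stacks c2 w2, v2)" by auto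
  with exec_Loop_True[of f "(stacks c w, v)" r P t'] assms(1) show ?thesis
    unfolding s run.simps by (intro exI[of _ "Suc (t' + u')"]) simp
qed

lemma run_Loop_False: "\<not> f (hd_opt (stacks c w r)) \<Longrightarrow> run (Loop r f P) (c, w, v) 1 (c, w, v)"
  by (auto intro!: exI[of _ 1] exec_Loop_False[of f "(_, _)", simplified])

declare run.simps [simp del]

lemma run_While_pos_step:
  assumes "c r > 0" "run P (c, w, v) t s" "run (While_pos r P) s u s'"
  shows "run (While_pos r P) (c, w, v) (Suc (t + u)) s'"
  using assms unfolding While_pos_def by (intro run_Loop_True) auto

lemma run_While_pos_done: "c r = 0 \<Longrightarrow> run (While_pos r P) (c, w, v) 1 (c, w, v)"
  unfolding While_pos_def by (rule run_Loop_False) auto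

lemma run_While_top_step:
  assumes "w r \<noteq> []" "hd (w r)" "run P (c, w, v) t s" "run (While_top r P) s u s'"
  shows "run (While_top r P) (c, w, v) (Suc (t + u)) s'"
  using assms unfolding While_top_def by (intro run_Loop_True) (auto simp: neq_Nil_conv)

lemma run_While_top_done: "w r \<noteq> [] \<Longrightarrow> \<not> hd (w r) \<Longrightarrow> run (While_top r P) (c, w, v) 1 (c, w, v)"
  unfolding While_top_def by (rule run_Loop_False) (auto simp: neq_Nil_conv)

lemma run_While_nonempty_step:
  assumes "w r \<noteq> []" "run P (c, w, v) t s" "run (While_nonempty r P) s u s'"
  shows "run (While_nonempty r P) (c, w, v) (Suc (t + u)) s'"
  using assms unfolding While_nonempty_def by (intro run_Loop_True) (auto simp: neq_Nil_conv)

lemma run_While_nonempty_done: "w r = [] \<Longrightarrow> run (While_nonempty r P) (c, w, v) 1 (c, w, v)"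
  unfolding While_nonempty_def by (rule run_Loop_False) auto

fun Outs :: "bool list \<Rightarrow> prog" where
  "Outs [] = Skip"
| "Outs (b # bs) = (Out b ;; Outs bs)"

lemma run_Outs: "run (Outs bs) (c, w, v) (length bs) (c, w, v @ bs)"
proof (induction bs arbitrary: v)
  case (Cons b bs)
  have "run (Out b ;; Outs bs) (c, w, v) (1 + length bs) (c, w, (v @ [b]) @ bs)"
    by (rule run_Seq[OF run_Out Cons])
  then show ?case by simp
qed (simp add: run_Skip)

definition Clear :: "nat \<Rightarrow> prog" where
  "Clear r = While_pos r (Dec r)"

lemma run_Clear: "run (Clear r) (c, w, v) (2 * c r + 1) (c(r := 0), w, v)"
proof (induction "c r" arbitrary: c)
  case 0
  then show ?case unfolding Clear_def
    by (intro run_conv[OF run_While_pos_done]) (auto simp: fun_eq_iff)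
next
  case (Suc n)
  have *: "run (Clear r) (c(r := c r - 1), w, v) (2 * (c r - 1) + 1) (c(r := 0), w, v)"
    using Suc(1)[of "c(r := c r - 1)"] Suc(2) by simp
  show ?case unfolding Clear_def
    by (rule run_conv, rule run_While_pos_step[OF _ run_Dec *[unfolded Clear_def]])
      (use Suc(2) in auto)
qed

text \<open>A counter can only be read by emptying it. The units taken from \<open>r\<close> are
  collected in \<open>t\<close> and returned at the end, so \<open>r\<close> survives the
  loop.\<close>

definition For :: "nat \<Rightarrow> nat \<Rightarrow> prog \<Rightarrow> prog" where
  "For r t P = (While_pos r (Dec r ;; Inc t ;; P) ;; While_pos t (Dec t ;; Inc r))"

lemma run_restore:
  assumes "r \<noteq> t"
  shows "run (While_pos t (Dec t ;; Inc r)) (c, w, v) (4 * c t + 1) (c(t := 0, r := c r + c t), w, v)"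
proof (induction "c t" arbitrary: c)
  case 0
  then show ?case
    by (intro run_conv[OF run_While_pos_done]) (auto simp: fun_eq_iff)
next
  case (Suc n)
  let ?c = "c(t := c t - 1, r := Suc (c r))"
  have *: "run (While_pos t (Dec t ;; Inc r)) (?c, w, v) (4 * (c t - 1) + 1) (c(t := 0, r := c r + c t), w, v)"
    by (rule run_conv, rule Suc(1)) (use Suc(2) assms in \<open>auto simp: fun_eq_iff\<close>)
  show ?case
    by (rule run_conv, rule run_While_pos_step, use Suc(2) in simp, rule run_Seq, rule run_Dec,
        use Suc(2) in simp, rule run_Inc) (use * Suc(2) assms in auto)
qed

text \<open>The family \<open>c\<close> describes the state after \<open>j\<close> rounds up to
  \<open>r\<close> and \<open>t\<close>, which are overridden: in round \<open>j\<close> the body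
  sees them as \<open>n - Suc j\<close> and \<open>Suc j\<close>. Each round adds 4 steps for the
  test and the transfer of a unit, and 4 more for returning it.\<close>

lemma run_For:
  assumes "r \<noteq> t" "c 0 r = n" "c 0 t = 0"
    and body: "\<And>j. j < n \<Longrightarrow> run P ((c j)(r := n - Suc j, t := Suc j), w j, v j) u
      ((c (Suc j))(r := n - Suc j, t := Suc j), w (Suc j), v (Suc j))"
  shows "run (For r t P) (c 0, w 0, v 0) (n * (u + 8) + 2) ((c n)(r := n, t := 0), w n, v n)"
proof -
  have loop: "run (While_pos r (Dec r ;; Inc t ;; P)) ((c j)(r := n - j, t := j), w j, v j) ((n - j) * (u + 4) + 1)
     ((c n)(r := 0, t := n), w n, v n)" if "j \<le> n" for j
    using that
  proof (induction "n - j" arbitrary: j)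
    case 0
    then show ?case using assms(1) by (intro run_conv[OF run_While_pos_done]) auto
  next
    case (Suc k)
    then have j: "j < n" "k = n - Suc j" by auto
    have *: "0 < ((c j)(r := n - j, t := j)) r" using j assms(1) by auto
    have upd: "(c j)(r := n - j, t := j, r := n - j - 1, t := Suc j) = (c j)(r := n - Suc j, t := Suc j)"
      using assms(1) by (auto simp: fun_eq_iff)
    have "run (Dec r ;; Inc t ;; P) ((c j)(r := n - j, t := j), w j, v j) (1 + (2 + u))
      ((c (Suc j))(r := n - Suc j, t := Suc j), w (Suc j), v (Suc j))"
      by (rule run_Seq, rule run_Dec, rule *, rule run_Seq, rule run_Inc)
        (use body[OF j(1)] upd assms(1) in \<open>simp add: fun_upd_same\<close>)
    moreover have "Suc j \<le> n" using j by simp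
    ultimately show ?case
      by - (rule run_conv, rule run_While_pos_step, rule *, assumption, rule Suc(1)[OF j(2)],
        use Suc(2) j in \<open>auto simp: Suc_diff_Suc[symmetric] algebra_simps\<close>)
  qed
  have "(c 0)(r := n, t := 0) = c 0" using assms by auto
  then have "run (While_pos r (Dec r ;; Inc t ;; P)) (c 0, w 0, v 0) (n * (u + 4) + 1)
      ((c n)(r := 0, t := n), w n, v n)" using loop[of 0] by simp
  from run_Seq[OF this run_restore[OF assms(1)]] show ?thesis
    unfolding For_def by (rule run_conv) (auto simp: fun_eq_iff assms(1) algebra_simps)
qed

text \<open>Counter \<open>0\<close> is reserved as scratch space for copying.\<close>

definition Copy :: "nat \<Rightarrow> nat \<Rightarrow> prog" where
  "Copy a b = (Clear b ;; For a 0 (Inc b))"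

lemma run_Copy:
  assumes "a \<noteq> 0" "b \<noteq> 0" "a \<noteq> b" "c 0 = 0"
  shows "run (Copy a b) (c, w, v) (2 * c b + 10 * c a + 3) (c(b := c a), w, v)"
proof -
  have "run (For a 0 (Inc b)) (c(b := 0), w, v) (c a * (2 + 8) + 2) (c(b := c a, a := c a, 0 := 0), w, v)"
    using assms
    by (intro run_conv[OF run_For[of a 0 "\<lambda>j. c(b := j)" "c a" "Inc b" "\<lambda>_. w" "\<lambda>_. v" 2]])
      (auto intro!: run_conv[OF run_Inc])
  from run_Seq[OF run_Clear this] show ?thesis
    unfolding Copy_def by (rule run_conv) (use assms in \<open>auto simp: fun_eq_iff\<close>)
qed

definition Move_word :: "nat \<Rightarrow> nat \<Rightarrow> prog" where
  "Move_word a b = While_nonempty a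
     (If_top a (Pop_word a ;; Push_word b True) (Pop_word a ;; Push_word b False))"

lemma run_Move_word:
  assumes "a \<noteq> b"
  shows "run (Move_word a b) (c, w, v) (5 * length (w a) + 1) (c, w(a := [], b := rev (w a) @ w b), v)"
proof (induction "w a" arbitrary: w)
  case Nil
  then show ?case unfolding Move_word_def
    by (intro run_conv[OF run_While_nonempty_done]) (auto simp: fun_eq_iff)
next
  case (Cons x xs)
  let ?w = "w(a := xs, b := x # w b)"
  have *: "run (Move_word a b) (c, ?w, v) (5 * length xs + 1) (c, w(a := [], b := rev (w a) @ w b), v)"
    by (rule run_conv, rule Cons(1)) (use Cons(2)[symmetric] assms in \<open>auto simp: fun_eq_iff\<close>)
  have ne: "w a \<noteq> []" using Cons(2) by (metis list.distinct(1))
  have one: "run (Pop_word a ;; Push_word b x) (c, w, v) (1 + 2) (c, ?w, v)"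
    by (rule run_conv, rule run_Seq, rule run_Pop_word, rule ne, rule run_Push_word)
      (use assms Cons(2)[symmetric] in auto)
  show ?case
    unfolding Move_word_def
    by (rule run_conv, rule run_While_nonempty_step, rule ne, rule run_If_top, rule ne)
      (use one * Cons(2)[symmetric] in \<open>auto simp: Move_word_def\<close>)
qed


section \<open>Gates\<close>

text \<open>
  A gate \<open>(q, a, b, c)\<close> is the equation \<open>q(x\<^sub>a, x\<^sub>b, x\<^sub>c) = 0\<close>, where \<open>q\<close> is given as a sum of terms
  \<open>(k, i, j, l)\<close> standing for \<open>k x\<^sub>a^i x\<^sub>b^j x\<^sub>c^l\<close>.
\<close>

type_synonym local_poly = "(int \<times> nat \<times> nat \<times> nat) list"
type_synonym gate = "local_poly \<times> nat \<times> nat \<times> nat"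

fun local_term :: "real \<Rightarrow> real \<Rightarrow> real \<Rightarrow> int \<times> nat \<times> nat \<times> nat \<Rightarrow> real" where
  "local_term a b c (k, i, j, l) = of_int k * a ^ i * b ^ j * c ^ l"

definition local_eval :: "local_poly \<Rightarrow> real \<Rightarrow> real \<Rightarrow> real \<Rightarrow> real" where
  "local_eval q a b c = (\<Sum>m\<leftarrow>q. local_term a b c m)"

lemma local_eval_simps [simp]:
  "local_eval [] a b c = 0"
  "local_eval ((k, i, j, l) # q) a b c = of_int k * a ^ i * b ^ j * c ^ l + local_eval q a b c"
  by (simp_all add: local_eval_def)

fun gate_holds :: "(nat \<Rightarrow> real) \<Rightarrow> gate \<Rightarrow> bool" where
  "gate_holds x (q, a, b, c) \<longleftrightarrow> local_eval q (x a) (x b) (x c) = 0"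

definition sat :: "(nat \<Rightarrow> real) \<Rightarrow> gate list \<Rightarrow> bool" where
  "sat x G \<longleftrightarrow> (\<forall>g \<in> set G. gate_holds x g)"

lemma sat_simps [simp]:
  "sat x []" "sat x (g # G) \<longleftrightarrow> gate_holds x g \<and> sat x G" "sat x (G @ H) \<longleftrightarrow> sat x G \<and> sat x H"
  by (auto simp: sat_def)

definition gates_below :: "nat \<Rightarrow> gate list \<Rightarrow> bool" where
  "gates_below n G \<longleftrightarrow> (\<forall>(q, a, b, c) \<in> set G. a < n \<and> b < n \<and> c < n)"

lemma gates_below_simps [simp]:
  "gates_below n []"
  "gates_below n ((q, a, b, c) # G) \<longleftrightarrow> a < n \<and> b < n \<and> c < n \<and> gates_below n G"
  "gates_below n (G @ H) \<longleftrightarrow> gates_below n G \<and> gates_below n H"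
  by (auto simp: gates_below_def ball_Un)

lemma gates_below_mono: "gates_below m G \<Longrightarrow> m \<le> n \<Longrightarrow> gates_below n G"
  unfolding gates_below_def by fastforce

definition agree :: "nat \<Rightarrow> (nat \<Rightarrow> real) \<Rightarrow> (nat \<Rightarrow> real) \<Rightarrow> bool" where
  "agree n x y \<longleftrightarrow> (\<forall>i < n. x i = y i)"

lemma agree_refl [simp]: "agree n x x"
  by (simp add: agree_def)

lemma agree_trans: "agree m x y \<Longrightarrow> agree n y z \<Longrightarrow> m \<le> n \<Longrightarrow> agree m x z"
  by (simp add: agree_def)

lemma agreeD: "agree n x y \<Longrightarrow> i < n \<Longrightarrow> y i = x i"
  by (simp add: agree_def)

lemma sat_agree: "agree n x y \<Longrightarrow> gates_below n G \<Longrightarrow> sat y G \<longleftrightarrow> sat x G"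
  unfolding sat_def gates_below_def agree_def by fastforce

text \<open>The semantic counterpart of a straight-line program: such gates never restrict the first
  \<open>m\<close> variables, so blocks of them can be chained without losing solutions.\<close>

definition extends :: "nat \<Rightarrow> gate list \<Rightarrow> nat \<Rightarrow> bool" where
  "extends m G n \<longleftrightarrow> m \<le> n \<and> gates_below n G \<and> (\<forall>x. \<exists>y. agree m x y \<and> sat y G)"

lemma extends_Nil [simp]: "extends m [] m"
  by (auto simp: extends_def intro: agree_refl)

lemma extends_append:
  assumes "extends l G m" "extends m H n"
  shows "extends l (G @ H) n"
  unfolding extends_def
proof (intro conjI allI)
  fix x
  from assms obtain y z where "agree l x y" "sat y G" "agree m y z" "sat z H"
    unfolding extends_def by meson
  with assms show "\<exists>y. agree l x y \<and> sat y (G @ H)"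
    by (intro exI[of _ z]) (auto simp: extends_def intro: agree_trans dest: sat_agree)
qed (use assms in \<open>auto simp: extends_def intro: gates_below_mono\<close>)

lemma extends_Cons: "extends l [g] m \<Longrightarrow> extends m H n \<Longrightarrow> extends l (g # H) n"
  using extends_append[of l "[g]" m H n] by simp

lemma extends_single:
  assumes "a \<ge> m" "a < n" "b < n" "c < n" "\<And>x. \<exists>y. agree m x y \<and> local_eval q (y a) (y b) (y c) = 0"
  shows "extends m [(q, a, b, c)] n"
  using assms by (auto simp: extends_def)

definition gate_const :: "int \<Rightarrow> local_poly" where "gate_const k = [(1, 1, 0, 0), (- k, 0, 0, 0)]"
definition gate_double :: local_poly where "gate_double = [(1, 1, 0, 0), (-2, 0, 1, 0)]"
definition gate_copy :: local_poly where "gate_copy = [(1, 1, 0, 0), (-1, 0, 1, 0)]"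
definition gate_add :: local_poly where "gate_add = [(1, 1, 0, 0), (-1, 0, 1, 0), (-1, 0, 0, 1)]"
definition gate_diff :: local_poly where "gate_diff = [(1, 1, 0, 0), (-1, 0, 1, 0), (1, 0, 0, 1)]"
definition gate_mult :: local_poly where "gate_mult = [(1, 1, 0, 0), (-1, 0, 1, 1)]"
definition gate_not :: local_poly where "gate_not = [(1, 1, 0, 0), (-1, 0, 0, 0), (1, 0, 1, 0)]"
definition gate_or :: local_poly where
  "gate_or = [(1, 1, 0, 0), (-1, 0, 1, 0), (-1, 0, 0, 1), (1, 0, 1, 1)]"
definition gate_square :: local_poly where "gate_square = [(1, 1, 0, 0), (-1, 0, 1, 0), (-1, 0, 0, 2)]"
definition gate_annul :: local_poly where "gate_annul = [(1, 1, 1, 0)]"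
definition gate_inverse :: local_poly where "gate_inverse = [(1, 1, 0, 0), (-1, 0, 0, 0), (1, 0, 1, 1)]"

lemma gate_eval [simp]:
  "local_eval (gate_const k) a b c = 0 \<longleftrightarrow> a = of_int k"
  "local_eval gate_double a b c = 0 \<longleftrightarrow> a = 2 * b"
  "local_eval gate_copy a b c = 0 \<longleftrightarrow> a = b"
  "local_eval gate_add a b c = 0 \<longleftrightarrow> a = b + c"
  "local_eval gate_diff a b c = 0 \<longleftrightarrow> a = b - c"
  "local_eval gate_mult a b c = 0 \<longleftrightarrow> a = b * c"
  "local_eval gate_not a b c = 0 \<longleftrightarrow> a = 1 - b"
  "local_eval gate_or a b c = 0 \<longleftrightarrow> a = b + c - b * c"
  "local_eval gate_square a b c = 0 \<longleftrightarrow> a = b + c\<^sup>2"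
  "local_eval gate_annul a b c = 0 \<longleftrightarrow> a * b = 0"
  "local_eval gate_inverse a b c = 0 \<longleftrightarrow> a = 1 - b * c"
  by (auto simp: gate_const_def gate_double_def gate_copy_def gate_add_def gate_diff_def gate_mult_def
      gate_not_def gate_or_def gate_square_def gate_annul_def gate_inverse_def)

text \<open>These gates can be solved for their first variable whatever the other two are, so with a
  fresh variable in that place they are always satisfiable.\<close>

definition functional :: "local_poly \<Rightarrow> bool" where
  "functional q \<longleftrightarrow> q \<in> range gate_const \<union>
     {gate_double, gate_copy, gate_add, gate_diff, gate_mult, gate_square}"

lemma functional_simps [simp]:
  "functional (gate_const k)" "functional gate_double" "functional gate_copy"
  "functional gate_add" "functional gate_diff" "functional gate_mult" "functional gate_square"
  by (auto simp: functional_def)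

lemma functional_eval:
  assumes "functional q"
  shows "\<exists>a. local_eval q a b c = 0"
  using assms by (auto simp: functional_def)

lemma extends_functional:
  assumes "functional q" "b < m" "c < m"
  shows "extends m [(q, m, b, c)] (Suc m)"
proof (rule extends_single)
  fix x :: "nat \<Rightarrow> real"
  from functional_eval[OF assms(1)] obtain a where "local_eval q a (x b) (x c) = 0" by blast
  with assms show "\<exists>y. agree m x y \<and> local_eval q (y m) (y b) (y c) = 0"
    by (intro exI[of _ "x(m := a)"]) (auto simp: agree_def)
qed (use assms in auto)

lemma extends_const: "extends m [(gate_const k, m, m, m)] (Suc m)"
  by (rule extends_single) (auto simp: agree_def intro!: exI[of _ "_(m := of_int k)"])

subsection \<open>Evaluating polynomials by gates\<close>

text \<open>
  Each bit of the encoding of a coefficient introduces two variables: the next power of two (with the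
  sign of the coefficient) and the part of the coefficient that has been read.  Each unit
  of an exponent introduces one variable.  The last variable is always the value computed so far.
\<close>

fun bits_gates :: "bool list \<Rightarrow> nat \<Rightarrow> gate list" where
  "bits_gates [] g = []"
| "bits_gates (b # bs) g =
     (gate_double, g + 2, g, g) # (if b then gate_add else gate_copy, g + 3, g + 1, g) #
     bits_gates bs (g + 2)"

definition int_gates :: "int \<Rightarrow> nat \<Rightarrow> gate list" where
  "int_gates i g = (gate_const (if i < 0 then -1 else 1), g, g, g) # (gate_const 0, g + 1, g + 1, g + 1) #
     bits_gates (bits_of_nat (nat \<bar>i\<bar>)) g"

definition int_end :: "int \<Rightarrow> nat \<Rightarrow> nat" where
  "int_end i g = g + 1 + 2 * length (bits_of_nat (nat \<bar>i\<bar>))"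

fun power_gates :: "nat \<Rightarrow> nat \<Rightarrow> nat \<Rightarrow> gate list" where
  "power_gates 0 z h = []"
| "power_gates (Suc e) z h = (gate_mult, h + 1, h, z) # power_gates e z (h + 1)"

fun powers_gates :: "nat list \<Rightarrow> nat \<Rightarrow> nat \<Rightarrow> gate list" where
  "powers_gates [] z h = []"
| "powers_gates (e # es) z h = power_gates e z h @ powers_gates es (Suc z) (h + e)"

text \<open>The coefficient is the initial value of the running product, and the factors of the
  powers are multiplied onto it one at a time.\<close>

fun monomial_gates :: "monomial \<Rightarrow> nat \<Rightarrow> nat \<Rightarrow> gate list" where
  "monomial_gates (k, es) z g = int_gates k g @ powers_gates es z (int_end k g)"

fun monomial_end :: "monomial \<Rightarrow> nat \<Rightarrow> nat" where
  "monomial_end (k, es) g = int_end k g + sum_list es"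

fun terms_end :: "polynomial \<Rightarrow> nat \<Rightarrow> nat" where
  "terms_end [] u = u"
| "terms_end (m # p) u = terms_end p (Suc (monomial_end m (Suc u)))"

fun terms_gates :: "polynomial \<Rightarrow> nat \<Rightarrow> nat \<Rightarrow> gate list" where
  "terms_gates [] z u = []"
| "terms_gates (m # p) z u = (let h = monomial_end m (Suc u) in
     monomial_gates m z (Suc u) @ (gate_add, Suc h, u, h) # terms_gates p z (Suc h))"

definition poly_gates :: "polynomial \<Rightarrow> nat \<Rightarrow> nat \<Rightarrow> gate list" where
  "poly_gates p z u = (gate_const 0, u, u, u) # terms_gates p z u"

fun bits_value :: "bool list \<Rightarrow> nat" where
  "bits_value [] = 0"
| "bits_value (b # bs) = of_bool b + 2 * bits_value bs"

lemma bits_of_nat_value: "bits_value (bits_of_nat n) = n"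
proof (induction n rule: less_induct)
  case (less n)
  then show ?case by (subst bits_of_nat.simps) simp
qed

text \<open>The loop invariant, for an arbitrary current power \<open>x g\<close> and partial sum
  \<open>x (g + 1)\<close>: what the remaining digits contribute is scaled by the current power.
  Since the starting power is 1 or -1, the sign needs no treatment of its own.\<close>

lemma bits_gates_value:
  "sat x (bits_gates bs g) \<Longrightarrow> x (g + 1 + 2 * length bs) = x (g + 1) + x g * real (bits_value bs)"
proof (induction bs arbitrary: g)
  case (Cons b bs)
  then have "x (g + 2) = 2 * x g" "x (g + 3) = x (g + 1) + (if b then x g else 0)"
    by (auto split: if_splits)
  moreover have "x (g + 2 + 1 + 2 * length bs) = x (g + 2 + 1) + x (g + 2) * real (bits_value bs)"
    by (rule Cons.IH) (use Cons.prems in simp)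
  ultimately show ?case
    by (simp add: algebra_simps numeral_3_eq_3)
qed simp

lemma int_gates_value:
  assumes "sat x (int_gates i g)"
  shows "x (int_end i g) = of_int i"
  using assms bits_gates_value[of x "bits_of_nat (nat \<bar>i\<bar>)" g]
  by (auto simp: int_gates_def int_end_def bits_of_nat_value split: if_splits)

lemma power_gates_value: "sat x (power_gates e z h) \<Longrightarrow> x (h + e) = x h * x z ^ e"
proof (induction e arbitrary: h)
  case (Suc e)
  then show ?case using Suc.IH[of "Suc h"] by simp
qed simp

lemma powers_gates_value:
  "sat x (powers_gates es z h) \<Longrightarrow> x (h + sum_list es) = x h * (\<Prod>i<length es. x (z + i) ^ (es ! i))"
proof (induction es arbitrary: z h)
  case (Cons e es)
  then show ?case
    using power_gates_value[of x e z h] Cons.IH[of "Suc z" "h + e"]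
    by (simp add: prod.lessThan_Suc_shift algebra_simps del: prod.lessThan_Suc)
qed simp

lemma monomial_gates_value:
  "sat x (monomial_gates m z g) \<Longrightarrow> x (monomial_end m g) = eval_monomial (\<lambda>i. x (z + i)) m"
  by (cases m) (auto simp: int_gates_value powers_gates_value)

lemma terms_gates_value:
  "sat x (terms_gates p z u) \<Longrightarrow> x (terms_end p u) = x u + eval_polynomial (\<lambda>i. x (z + i)) p"
  by (induction p arbitrary: u) (auto simp: eval_polynomial_def Let_def monomial_gates_value)

lemma poly_gates_value:
  "sat x (poly_gates p z u) \<Longrightarrow> x (terms_end p u) = eval_polynomial (\<lambda>i. x (z + i)) p"
  by (auto simp: poly_gates_def terms_gates_value)

lemma extends_bits: "extends (g + 2) (bits_gates bs g) (g + 2 + 2 * length bs)"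
proof (induction bs arbitrary: g)
  case (Cons b bs)
  have "extends (g + 2) [(gate_double, g + 2, g, g)] (g + 3)"
    using extends_functional[of gate_double g "g + 2" g] by (simp add: numeral_3_eq_3)
  moreover have "extends (g + 3) [(if b then gate_add else gate_copy, g + 3, g + 1, g)] (g + 4)"
    using extends_functional[of "if b then gate_add else gate_copy" "g + 1" "g + 3" g] by (simp add: eval_nat_numeral)
  moreover have "extends (g + 4) (bits_gates bs (g + 2)) (g + 2 + 2 * length (b # bs))"
    using Cons[of "g + 2"] by (simp add: eval_nat_numeral)
  ultimately show ?case unfolding bits_gates.simps by (blast intro: extends_Cons)
qed simp

lemma extends_int: "extends g (int_gates i g) (Suc (int_end i g))"
proof -
  have "extends (Suc g) [(gate_const 0, g + 1, g + 1, g + 1)] (g + 2)"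
    using extends_const[of "Suc g" 0] by simp
  moreover have "extends (g + 2) (bits_gates (bits_of_nat (nat \<bar>i\<bar>)) g) (Suc (int_end i g))"
    using extends_bits[of g "bits_of_nat (nat \<bar>i\<bar>)"] by (simp add: int_end_def)
  ultimately show ?thesis unfolding int_gates_def by (blast intro: extends_Cons extends_const)
qed

lemma extends_power: "z \<le> h \<Longrightarrow> extends (Suc h) (power_gates e z h) (Suc (h + e))"
proof (induction e arbitrary: h)
  case (Suc e)
  have "extends (Suc h) [(gate_mult, h + 1, h, z)] (Suc (Suc h))"
    using extends_functional[of gate_mult h "Suc h" z] Suc.prems by simp
  moreover have "extends (Suc (Suc h)) (power_gates e z (h + 1)) (Suc (h + Suc e))"
    using Suc.IH[of "h + 1"] Suc.prems by simp
  ultimately show ?case unfolding power_gates.simps by (blast intro: extends_Cons)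
qed simp

lemma extends_powers:
  "z + length es \<le> Suc h \<Longrightarrow> extends (Suc h) (powers_gates es z h) (Suc (h + sum_list es))"
proof (induction es arbitrary: z h)
  case (Cons e es)
  have "extends (Suc h) (power_gates e z h) (Suc (h + e))"
    using extends_power[of z h e] Cons.prems by simp
  moreover have "extends (Suc (h + e)) (powers_gates es (Suc z) (h + e)) (Suc (h + sum_list (e # es)))"
    using Cons.IH[of "Suc z" "h + e"] Cons.prems by (simp add: add.assoc)
  ultimately show ?case unfolding powers_gates.simps by (blast intro: extends_append)
qed simp

lemma int_end_ge: "g < int_end k g"
  by (simp add: int_end_def)

lemma extends_monomial:
  "z + length (snd m) \<le> g \<Longrightarrow> extends g (monomial_gates m z g) (Suc (monomial_end m g))"
proof (cases m)
  case (Pair k es)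
  assume "z + length (snd m) \<le> g"
  then have "extends (Suc (int_end k g)) (powers_gates es z (int_end k g)) (Suc (monomial_end m g))"
    using extends_powers[of z es "int_end k g"] int_end_ge[of g k] by (simp add: Pair)
  then show ?thesis
    unfolding Pair monomial_gates.simps by (blast intro: extends_append extends_int)
qed

lemma monomial_end_ge: "g < monomial_end m g"
  by (cases m) (simp add: int_end_def)

lemma extends_terms:
  "polynomial_in n p \<Longrightarrow> z + n \<le> u \<Longrightarrow> extends (Suc u) (terms_gates p z u) (Suc (terms_end p u))"
proof (induction p arbitrary: u)
  case (Cons m p)
  define h where "h = monomial_end m (Suc u)"
  have h: "Suc u < h" using monomial_end_ge[of "Suc u" m] by (simp add: h_def)
  have n: "length (snd m) = n" "polynomial_in n p"
    using Cons.prems by (auto simp: polynomial_in_def)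
  have "extends (Suc u) (monomial_gates m z (Suc u)) (Suc h)"
    using extends_monomial[of z m "Suc u"] n Cons.prems by (simp add: h_def)
  moreover have "extends (Suc h) [(gate_add, Suc h, u, h)] (Suc (Suc h))"
    using h by (intro extends_functional) auto
  moreover have "extends (Suc (Suc h)) (terms_gates p z (Suc h)) (Suc (terms_end p (Suc h)))"
    using Cons.IH[OF n(2), of "Suc h"] Cons.prems h by simp
  ultimately show ?case
    unfolding terms_gates.simps terms_end.simps Let_def h_def[symmetric]
    by (blast intro: extends_append extends_Cons)
qed simp

lemma extends_poly:
  "polynomial_in n p \<Longrightarrow> z + n \<le> u \<Longrightarrow> extends u (poly_gates p z u) (Suc (terms_end p u))"
  unfolding poly_gates_def by (blast intro: extends_Cons extends_const extends_terms)

section \<open>Bounding the number of variables by the length of the encoding\<close>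

lemma length_enc_list: "length (enc_list e xs) = Suc (\<Sum>x\<leftarrow>xs. Suc (length (e x)))"
  by (induction xs) (auto simp: enc_list_def)

lemma length_enc_int: "length (enc_int i) = 2 + 2 * length (bits_of_nat (nat \<bar>i\<bar>))"
  by (simp add: enc_int_def length_enc_list sum_list_triv)

lemma length_enc_unary [simp]: "length (enc_unary n) = Suc n"
  by (simp add: enc_unary_def)

text \<open>A binary digit costs two variables, and \<open>enc_list\<close> spends two bits on it;
  the initial power and partial sum are paid for by the sign bit and the end marker.\<close>

lemma int_end_le: "Suc (int_end i g) \<le> g + length (enc_int i)"
  by (simp add: int_end_def length_enc_int)

lemma monomial_end_le: "Suc (monomial_end m g) \<le> g + length (enc_monomial m)"
proof (cases m)
  case (Pair k es)
  have "sum_list es \<le> length (enc_list enc_unary es)"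
    by (induction es) (auto simp: length_enc_list)
  with Pair int_end_le[of k g] show ?thesis by simp
qed

lemma terms_end_le: "Suc (terms_end p u) \<le> u + 2 * length (enc_polynomial p) - 1"
proof (induction p arbitrary: u)
  case (Cons m p)
  have "length (enc_polynomial (m # p)) = Suc (length (enc_monomial m) + length (enc_polynomial p))"
    by (simp add: enc_polynomial_def length_enc_list)
  with Cons[of "Suc (monomial_end m (Suc u))"] monomial_end_le[of m "Suc u"]
  show ?case by simp
qed (simp add: enc_polynomial_def length_enc_list)

lemma terms_end_ge: "u \<le> terms_end p u"
proof (induction p arbitrary: u)
  case (Cons m p)
  show ?case
    using monomial_end_ge[of "Suc u" m] Cons[of "Suc (monomial_end m (Suc u))"] by simp
qed simp

subsection \<open>The polynomial of a list of gates\<close>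

text \<open>All products of two terms, without collecting equal ones. This happens once for each of
  the fixed gate polynomials, when the program is built, and not on the machine.\<close>

definition neg_square :: "local_poly \<Rightarrow> local_poly" where
  "neg_square q = concat (map (\<lambda>(k, i, j, l). map (\<lambda>(k', i', j', l'). (- (k * k'), i + i', j + j', l + l')) q) q)"

lemma local_eval_append: "local_eval (p @ q) a b c = local_eval p a b c + local_eval q a b c"
  by (simp add: local_eval_def)

lemma local_eval_neg_square: "local_eval (neg_square q) a b c = - (local_eval q a b c)\<^sup>2"
proof -
  have row: "local_eval (map (\<lambda>(k', i', j', l'). (- (k * k'), i + i', j + j', l + l')) r) a b c =
      - (of_int k * a ^ i * b ^ j * c ^ l) * local_eval r a b c" for k i j l and r :: local_poly
    by (induction r) (auto simp: algebra_simps power_add)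
  have "local_eval (concat (map (\<lambda>(k, i, j, l). map (\<lambda>(k', i', j', l'). (- (k * k'), i + i', j + j', l + l')) q) r)) a b c =
      - local_eval r a b c * local_eval q a b c" for r
    by (induction r) (auto simp: local_eval_append row algebra_simps)
  then show ?thesis by (simp add: neg_square_def power2_eq_square)
qed

definition exponent_at :: "nat \<Rightarrow> nat \<Rightarrow> nat \<Rightarrow> nat" where
  "exponent_at a e j = (if j = a then e else 0)"

text \<open>The three exponent vectors are added rather than overwritten, because a gate may name
  the same variable more than once.\<close>

fun global_monomial :: "nat \<Rightarrow> nat \<Rightarrow> nat \<Rightarrow> nat \<Rightarrow> int \<times> nat \<times> nat \<times> nat \<Rightarrow> monomial" where
  "global_monomial n a b c (k, e1, e2, e3) =
     (k, map (\<lambda>j. exponent_at a e1 j + exponent_at b e2 j + exponent_at c e3 j) [0..<n])"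

fun gate_terms :: "nat \<Rightarrow> gate \<Rightarrow> polynomial" where
  "gate_terms n (q, a, b, c) = map (global_monomial n a b c) (neg_square q)"

definition gates_terms :: "nat \<Rightarrow> gate list \<Rightarrow> polynomial" where
  "gates_terms n G = concat (map (gate_terms n) G)"

lemma prod_exponent_at: "a < n \<Longrightarrow> (\<Prod>j<n. (x j :: real) ^ exponent_at a e j) = x a ^ e"
  by (simp add: exponent_at_def if_distrib cong: if_cong)

lemma eval_global_monomial:
  "a < n \<Longrightarrow> b < n \<Longrightarrow> c < n \<Longrightarrow>
    eval_monomial x (global_monomial n a b c m) = local_term (x a) (x b) (x c) m"
  by (cases m) (simp add: power_add prod.distrib prod_exponent_at)

lemma eval_gate_terms:
  assumes "a < n" "b < n" "c < n"
  shows "eval_polynomial x (gate_terms n (q, a, b, c)) = - (local_eval q (x a) (x b) (x c))\<^sup>2"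
  using assms unfolding local_eval_neg_square[symmetric]
  by (simp add: eval_polynomial_def eval_global_monomial comp_def local_eval_def)

lemma eval_polynomial_append: "eval_polynomial x (p @ q) = eval_polynomial x p + eval_polynomial x q"
  by (simp add: eval_polynomial_def)

text \<open>A sum of negated squares vanishes only if every square does. The first claim is what
  carries the second through the induction.\<close>

lemma eval_gates_terms:
  assumes "gates_below n G"
  shows "eval_polynomial x (gates_terms n G) \<le> 0" "eval_polynomial x (gates_terms n G) \<ge> 0 \<longleftrightarrow> sat x G"
proof -
  have "eval_polynomial x (gates_terms n G) \<le> 0 \<and> (eval_polynomial x (gates_terms n G) \<ge> 0 \<longleftrightarrow> sat x G)"
    using assms
  proof (induction G)
    case (Cons g G)
    obtain q a b c where g: "g = (q, a, b, c)" by (cases g)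
    let ?r = "local_eval q (x a) (x b) (x c)"
    have "eval_polynomial x (gates_terms n (g # G)) = - ?r\<^sup>2 + eval_polynomial x (gates_terms n G)"
      using Cons.prems g eval_gate_terms[of a n b c x q]
      by (simp add: gates_terms_def eval_polynomial_append del: gate_terms.simps)
    moreover have "\<not> ?r\<^sup>2 \<le> y" "y \<le> ?r\<^sup>2" if "?r \<noteq> 0" "y \<le> 0" for y
      using that by (smt (verit) zero_less_power2)+
    moreover have "eval_polynomial x (gates_terms n G) \<le> 0"
      "eval_polynomial x (gates_terms n G) \<ge> 0 \<longleftrightarrow> sat x G"
      using Cons g by auto
    moreover have "gate_holds x g \<longleftrightarrow> ?r = 0" by (simp add: g)
    ultimately show ?case by (cases "?r = 0") auto
  qed (simp add: gates_terms_def eval_polynomial_def)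
  then show "eval_polynomial x (gates_terms n G) \<le> 0" "eval_polynomial x (gates_terms n G) \<ge> 0 \<longleftrightarrow> sat x G"
    by blast+
qed

lemma polynomial_in_gates_terms: "polynomial_in n (gates_terms n G)"
  by (auto simp: polynomial_in_def gates_terms_def)

lemma gates_terms_simps [simp]:
  "gates_terms n [] = []"
  "gates_terms n (g # G) = gate_terms n g @ gates_terms n G"
  "gates_terms n (G @ H) = gates_terms n G @ gates_terms n H"
  by (simp_all add: gates_terms_def)

definition zero_monomial :: "int \<Rightarrow> nat \<Rightarrow> monomial" where
  "zero_monomial k n = (k, replicate n 0)"

lemma eval_zero_monomial [simp]: "eval_monomial x (zero_monomial k n) = of_int k"
  by (simp add: zero_monomial_def)


section \<open>Programs that write gates\<close>

abbreviation (input) reg_size :: nat where "reg_size \<equiv> 5"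
abbreviation (input) reg_fresh :: nat where "reg_fresh \<equiv> 6"
abbreviation (input) reg_pow :: nat where "reg_pow \<equiv> 7"
abbreviation (input) reg_mon :: nat where "reg_mon \<equiv> 8"
abbreviation (input) reg_sum :: nat where "reg_sum \<equiv> 9"
abbreviation (input) reg_var :: nat where "reg_var \<equiv> 10"
abbreviation (input) reg_base :: nat where "reg_base \<equiv> 11"

text \<open>The counter runs down by one per column and the exponent is written when it passes from
  1 to 0. Afterwards it stays at 0, which is how "already passed" differs from "now".\<close>

definition Mark :: "nat \<Rightarrow> nat \<Rightarrow> prog" where
  "Mark r e = If_zero r Skip (Dec r ;; If_zero r (Outs (replicate e True)) Skip)"

lemma run_Mark:
  "run (Mark r e) (c, w, v) (e + 3)
    (c(r := c r - 1), w, v @ (if c r = 1 then replicate e True else []))"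
proof -
  have inner: "run (If_zero r (Outs (replicate e True)) Skip) (c(r := c r - 1), w, v) (Suc e)
     (c(r := c r - 1), w, v @ (if c r = 1 then replicate e True else []))" if "c r \<noteq> 0"
    by (rule run_If_zero)
      (use that in \<open>auto intro!: run_conv[OF run_Outs] run_conv[OF run_Skip]\<close>)
  have "run (Mark r e) (c, w, v) (Suc (Suc (Suc e)))
     (c(r := c r - 1), w, v @ (if c r = 1 then replicate e True else []))"
    unfolding Mark_def
    by (rule run_If_zero, rule run_conv[OF run_Skip])
      (auto intro!: run_conv[OF run_Seq[OF run_Dec inner]] simp: fun_eq_iff)
  then show ?thesis by (rule run_conv) simp_all
qed

text \<open>One pass over all columns writes the exponent list. The copies of the three indices are
  incremented so that a counter equals 1 exactly in the column of its variable.\<close>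

fun Emit_term :: "nat \<Rightarrow> nat \<Rightarrow> nat \<Rightarrow> int \<times> nat \<times> nat \<times> nat \<Rightarrow> prog" where
  "Emit_term ra rb rc (k, e1, e2, e3) =
     (Outs (True # enc_int k) ;; Copy ra 1 ;; Inc 1 ;; Copy rb 2 ;; Inc 2 ;; Copy rc 3 ;; Inc 3 ;;
      For reg_size 4 (Out True ;; Mark 1 e1 ;; Mark 2 e2 ;; Mark 3 e3 ;; Out False) ;; Out False)"

text \<open>The scratch counters: \<open>0\<close> belongs to \<open>Copy\<close>, \<open>1\<close>
  to \<open>3\<close> are the column counters of \<open>Emit_term\<close>, and \<open>4\<close>
  belongs to loops over \<open>reg_size\<close> and to \<open>Push_index\<close>.\<close>

definition clean :: "(nat \<Rightarrow> nat) \<Rightarrow> bool" where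
  "clean c \<longleftrightarrow> (\<forall>i < 5. c i = 0)"

lemma clean_upd [simp]: "r \<ge> 5 \<Longrightarrow> clean (c(r := n)) \<longleftrightarrow> clean c"
  by (auto simp: clean_def)

lemma cleanD: "clean c \<Longrightarrow> c 0 = 0" "clean c \<Longrightarrow> c (Suc 0) = 0" "clean c \<Longrightarrow> c 2 = 0" "clean c \<Longrightarrow> c 3 = 0" "clean c \<Longrightarrow> c 4 = 0"
  by (auto simp: clean_def)

definition enc_terms :: "polynomial \<Rightarrow> bool list" where
  "enc_terms p = concat (map (\<lambda>m. True # enc_monomial m) p)"

lemma enc_polynomial_eq: "enc_polynomial p = enc_terms p @ [False]"
  by (simp add: enc_polynomial_def enc_list_def enc_terms_def)

lemma enc_terms_simps [simp]:
  "enc_terms [] = []" "enc_terms (m # p) = True # enc_monomial m @ enc_terms p"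
  "enc_terms (p @ q) = enc_terms p @ enc_terms q"
  by (simp_all add: enc_terms_def)

definition enc_gates :: "nat \<Rightarrow> gate list \<Rightarrow> bool list" where
  "enc_gates n G = enc_terms (gates_terms n G)"

lemma enc_gates_Nil [simp]: "enc_gates n [] = []"
  by (simp add: enc_gates_def)

lemma enc_gates_append [simp]: "enc_gates n (G @ H) = enc_gates n G @ enc_gates n H"
  by (simp add: enc_gates_def)

lemma enc_gates_Cons: "enc_gates n (g # G) = enc_gates n [g] @ enc_gates n G"
  using enc_gates_append[of n "[g]" G] by simp

fun term_cost :: "int \<times> nat \<times> nat \<times> nat \<Rightarrow> nat" where
  "term_cost (k, e1, e2, e3) = length (enc_int k) + e1 + e2 + e3 + 50"

lemma run_Emit_term:
  assumes "clean c" "5 \<le> ra" "5 \<le> rb" "5 \<le> rc"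
    "c ra < c reg_size" "c rb < c reg_size" "c rc < c reg_size"
  shows "run (Emit_term ra rb rc m) (c, w, v) (term_cost m * (c reg_size + 1))
    (c, w, v @ True # enc_monomial (global_monomial (c reg_size) (c ra) (c rb) (c rc) m))"
proof -
  obtain k e1 e2 e3 where m: "m = (k, e1, e2, e3)" by (cases m)
  define n where "n = c reg_size"
  define E where "E j = exponent_at (c ra) e1 j + exponent_at (c rb) e2 j + exponent_at (c rc) e3 j" for j
  \<comment> \<open>\<open>C j\<close> and \<open>V j\<close> are the column counters and the output
    after \<open>j\<close> columns. Truncated subtraction matches \<open>Mark\<close>, which leaves
    an exhausted counter at zero.\<close>
  define C where "C j = c(1 := Suc (c ra) - j, 2 := Suc (c rb) - j, 3 := Suc (c rc) - j)" for j
  define V where "V j = (v @ True # enc_int k) @ concat (map (\<lambda>i. True # enc_unary (E i)) [0..<j])" for j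
  note z = cleanD[OF assms(1)]
  have VS: "V (Suc j) = (((V j @ [True]) @ (if Suc (c ra) - j = 1 then replicate e1 True else [])) @
      (if Suc (c rb) - j = 1 then replicate e2 True else [])) @
      (if Suc (c rc) - j = 1 then replicate e3 True else []) @ [False]" for j
    by (auto simp: V_def E_def exponent_at_def enc_unary_def replicate_add)
  have body: "run (Out True ;; Mark 1 e1 ;; Mark 2 e2 ;; Mark 3 e3 ;; Out False)
      ((C j)(reg_size := n - Suc j, 4 := Suc j), w, V j) (e1 + e2 + e3 + 11)
      ((C (Suc j))(reg_size := n - Suc j, 4 := Suc j), w, V (Suc j))" for j
    unfolding VS
    by (rule run_conv, rule run_Seq, rule run_Out, rule run_Seq, rule run_Mark, rule run_Seq, rule run_Mark,
        rule run_Seq, rule run_Mark, rule run_Out) (auto simp: C_def fun_eq_iff)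
  have loop: "run (For reg_size 4 (Out True ;; Mark 1 e1 ;; Mark 2 e2 ;; Mark 3 e3 ;; Out False))
      (C 0, w, V 0) (n * (e1 + e2 + e3 + 11 + 8) + 2) ((C n)(reg_size := n, 4 := 0), w, V n)"
    by (rule run_For[where c = C and w = "\<lambda>_. w" and v = V])
      (use body z in \<open>auto simp: n_def\<close>, auto simp: C_def)
  \<comment> \<open>The three indices are below \<open>n\<close>, so all column counters have run
    down to zero and the scratch registers are clean again.\<close>
  have fin: "(C n)(reg_size := n, 4 := 0) = c"
    using z assms by (auto simp: C_def fun_eq_iff n_def)
  have out: "V n @ [False] = v @ True # enc_monomial (global_monomial n (c ra) (c rb) (c rc) m)"
    by (simp add: V_def m enc_list_def E_def[abs_def] comp_def)
  show ?thesis
    unfolding m Emit_term.simps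
    apply (rule run_conv)
    apply (rule run_Seq, rule run_Outs)
    apply (rule run_Seq, rule run_Copy, (use assms z in simp_all)[4])
    apply (rule run_Seq, rule run_Inc)
    apply (rule run_Seq, rule run_Copy, (use assms z in simp_all)[4])
    apply (rule run_Seq, rule run_Inc)
    apply (rule run_Seq, rule run_Copy, (use assms z in simp_all)[4])
    apply (rule run_Seq, rule run_Inc)
    apply (rule run_Seq, rule run_pre, rule loop)
    apply (use assms z in \<open>auto simp: C_def V_def fun_eq_iff\<close>)[1]
    apply (rule run_Out)
    using assms z fin out by (auto simp: m n_def algebra_simps)
qed

fun Emit_terms :: "nat \<Rightarrow> nat \<Rightarrow> nat \<Rightarrow> local_poly \<Rightarrow> prog" where
  "Emit_terms ra rb rc [] = Skip"
| "Emit_terms ra rb rc (m # q) = (Emit_term ra rb rc m ;; Emit_terms ra rb rc q)"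

lemma run_Emit_terms:
  assumes "clean c" "5 \<le> ra" "5 \<le> rb" "5 \<le> rc"
    "c ra < c reg_size" "c rb < c reg_size" "c rc < c reg_size"
  shows "run (Emit_terms ra rb rc q) (c, w, v) ((\<Sum>m\<leftarrow>q. term_cost m) * (c reg_size + 1))
    (c, w, v @ enc_terms (map (global_monomial (c reg_size) (c ra) (c rb) (c rc)) q))"
proof (induction q arbitrary: v)
  case (Cons m q)
  show ?case
    unfolding Emit_terms.simps
    by (rule run_conv, rule run_Seq, rule run_Emit_term, (fact assms)+, rule Cons) (auto simp: algebra_simps)
qed (simp add: run_Skip)

definition gate_polys :: "local_poly list" where
  "gate_polys = [gate_const 0, gate_const 1, gate_const (-1), gate_double, gate_copy, gate_add, gate_diff,
     gate_mult, gate_not, gate_or, gate_square, gate_annul, gate_inverse]"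

text \<open>The costs of all gates are summed so that one constant bounds each of them; the 100 pays
  for copying, clearing and other loops linear in the number of variables. Thus
  \<open>unit_cost\<close> prices every elementary operation.\<close>

definition gate_cost :: nat where
  "gate_cost = 100 + (\<Sum>q\<leftarrow>gate_polys. \<Sum>m\<leftarrow>neg_square q. term_cost m)"

definition unit_cost :: "nat \<Rightarrow> nat" where
  "unit_cost n = gate_cost * (n + 1)"

lemma unit_cost_ge: "100 * n + 100 \<le> unit_cost n"
proof -
  have "100 * (n + 1) \<le> gate_cost * (n + 1)" by (rule mult_right_mono) (auto simp: gate_cost_def)
  then show ?thesis by (simp add: unit_cost_def)
qed

definition Gate :: "local_poly \<Rightarrow> nat \<Rightarrow> nat \<Rightarrow> nat \<Rightarrow> prog" where
  "Gate q ra rb rc = Emit_terms ra rb rc (neg_square q)"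

lemma run_Gate:
  assumes "q \<in> set gate_polys" "clean c" "5 \<le> ra" "5 \<le> rb" "5 \<le> rc"
    "c ra < c reg_size" "c rb < c reg_size" "c rc < c reg_size"
  shows "run (Gate q ra rb rc) (c, w, v) (unit_cost (c reg_size))
    (c, w, v @ enc_gates (c reg_size) [(q, c ra, c rb, c rc)])"
proof -
  have "(\<Sum>m\<leftarrow>neg_square q. term_cost m) \<le> (\<Sum>q\<leftarrow>gate_polys. \<Sum>m\<leftarrow>neg_square q. term_cost m)"
    using assms(1) by (intro member_le_sum_list) auto
  then have "(\<Sum>m\<leftarrow>neg_square q. term_cost m) * (c reg_size + 1) \<le> unit_cost (c reg_size)"
    unfolding unit_cost_def gate_cost_def by (intro mult_right_mono) auto
  then show ?thesis
    unfolding Gate_def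
    by (intro run_conv[OF run_Emit_terms[OF assms(2-)]]) (auto simp: enc_gates_def gates_terms_def)
qed

lemma gate_polys [simp]:
  "gate_const 0 \<in> set gate_polys" "gate_const 1 \<in> set gate_polys" "gate_const (-1) \<in> set gate_polys"
  "gate_double \<in> set gate_polys" "gate_copy \<in> set gate_polys" "gate_add \<in> set gate_polys"
  "gate_diff \<in> set gate_polys" "gate_mult \<in> set gate_polys" "gate_not \<in> set gate_polys"
  "gate_or \<in> set gate_polys" "gate_square \<in> set gate_polys" "gate_annul \<in> set gate_polys"
  "gate_inverse \<in> set gate_polys"
  by (simp_all add: gate_polys_def)

lemma run_Copy_unit:
  assumes "clean c" "a \<noteq> 0" "b \<noteq> 0" "a \<noteq> b" "c a \<le> c reg_size" "c b \<le> c reg_size"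
  shows "run (Copy a b) (c, w, v) (unit_cost (c reg_size)) (c(b := c a), w, v)"
  by (rule run_conv, rule run_Copy) (use assms unit_cost_ge[of "c reg_size"] in \<open>auto dest: cleanD\<close>)

lemma run_Clear_unit:
  assumes "c r \<le> c reg_size"
  shows "run (Clear r) (c, w, v) (unit_cost (c reg_size)) (c(r := 0), w, v)"
  by (rule run_conv, rule run_Clear) (use assms unit_cost_ge[of "c reg_size"] in auto)

text \<open>Word \<open>0\<close> is the input; what has been read from it is kept, reversed, in word \<open>1\<close>.\<close>

definition Read :: prog where
  "Read = If_top 0 (Pop_word 0 ;; Push_word 1 True) (Pop_word 0 ;; Push_word 1 False)"

lemma run_Read:
  assumes "w 0 \<noteq> []"
  shows "run Read (c, w, v) 4 (c, w(0 := tl (w 0), 1 := hd (w 0) # w 1), v)"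
  unfolding Read_def
  by (rule run_conv, rule run_If_top, rule assms)
    (use assms in \<open>auto intro!: run_conv[OF run_Seq[OF run_Pop_word run_Push_word]]\<close>)

definition New :: "nat \<Rightarrow> prog" where
  "New r = (Copy reg_fresh r ;; Inc reg_fresh)"

lemma run_New:
  assumes "clean c" "5 \<le> r" "r \<noteq> reg_fresh" "c r \<le> c reg_size" "c reg_fresh \<le> c reg_size"
  shows "run (New r) (c, w, v) (unit_cost (c reg_size) + 2) (c(r := c reg_fresh, reg_fresh := Suc (c reg_fresh)), w, v)"
  unfolding New_def
  by (rule run_conv, rule run_Seq, rule run_Copy_unit, (use assms in simp_all)[6], rule run_Inc)
    (use assms in \<open>auto simp: fun_eq_iff\<close>)

lemmas run_intros = run_Seq run_Gate run_Copy_unit run_Clear_unit run_New run_Inc run_Dec run_Read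

section \<open>Evaluating numbers, monomials and polynomials while reading them\<close>

lemma enc_list_simps [simp]:
  "enc_list e [] = [False]" "enc_list e (x # xs) = True # e x @ enc_list e xs"
  by (simp_all add: enc_list_def)

text \<open>The variables of the current power and the current partial sum are adjacent, so the new
  \<open>reg_pow\<close> is obtained from the new \<open>reg_mon\<close> by a copy and one
  decrement. The digit is tested before it is consumed, and both branches share what
  follows.\<close>

definition Eval_bits :: prog where
  "Eval_bits = (While_top 0
     (Read ;; Gate gate_double reg_fresh reg_pow reg_pow ;; Inc reg_fresh ;;
      If_top 0 (Gate gate_add reg_fresh reg_mon reg_pow) (Gate gate_copy reg_fresh reg_mon reg_pow) ;;
      Read ;; Copy reg_fresh reg_mon ;; Copy reg_mon reg_pow ;; Dec reg_pow ;; Inc reg_fresh) ;;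
    Read)"

lemma run_Eval_bits:
  assumes "clean c" "w 0 = enc_list (\<lambda>b. [b]) bs @ rest"
    "c reg_pow = g" "c reg_mon = g + 1" "c reg_fresh = g + 2" "g + 2 + 2 * length bs \<le> c reg_size"
  shows "run Eval_bits (c, w, v) (10 * unit_cost (c reg_size) * length (enc_list (\<lambda>b. [b]) bs))
    (c(reg_pow := g + 2 * length bs, reg_mon := g + 1 + 2 * length bs, reg_fresh := g + 2 + 2 * length bs),
     w(0 := rest, 1 := rev (enc_list (\<lambda>b. [b]) bs) @ w 1), v @ enc_gates (c reg_size) (bits_gates bs g))"
proof -
  let ?u = "unit_cost (c reg_size)"
  let ?body = "Read ;; Gate gate_double reg_fresh reg_pow reg_pow ;; Inc reg_fresh ;;
      If_top 0 (Gate gate_add reg_fresh reg_mon reg_pow) (Gate gate_copy reg_fresh reg_mon reg_pow) ;;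
      Read ;; Copy reg_fresh reg_mon ;; Copy reg_mon reg_pow ;; Dec reg_pow ;; Inc reg_fresh"
  have u: "100 \<le> ?u" using unit_cost_ge[of "c reg_size"] by simp
  have "run (While_top 0 ?body) (c, w, v) (10 * unit_cost (c reg_size) * (2 * length bs) + 1)
    (c(reg_pow := g + 2 * length bs, reg_mon := g + 1 + 2 * length bs, reg_fresh := g + 2 + 2 * length bs),
     w(0 := False # rest, 1 := rev (concat (map (\<lambda>b. [True, b]) bs)) @ w 1), v @ enc_gates (c reg_size) (bits_gates bs g))"
    using assms
  proof (induction bs arbitrary: c w v g)
    case Nil
    then show ?case
      by (intro run_conv[OF run_While_top_done]) (auto simp: fun_eq_iff)
  next
    case (Cons b bs)
    let ?u = "unit_cost (c reg_size)"
    let ?q = "if b then gate_add else gate_copy"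
    have u: "100 \<le> ?u" using unit_cost_ge[of "c reg_size"] by simp
    show ?case
      apply (rule run_conv, rule run_While_top_step)
      apply (use Cons.prems in simp)
      apply (use Cons.prems in simp)
      apply (rule run_intros | use Cons.prems in \<open>simp; fail\<close>)+
      \<comment> \<open>Both branches have to arrive at one state; it is given explicitly, with
        \<open>?q\<close> for the gate that the digit selects.\<close>
      apply (rule run_If_top[where s = "(c(reg_fresh := g + 3), w(0 := b # enc_list (\<lambda>b. [b]) bs @ rest, 1 := True # w 1),
         (v @ enc_gates (c reg_size) [(gate_double, g + 2, g, g)]) @ enc_gates (c reg_size) [(?q, g + 3, g + 1, g)])" and t = ?u])
      apply (use Cons.prems in simp)
      apply (rule run_conv, rule run_Gate, (use Cons.prems in \<open>simp_all add: fun_eq_iff numeral_3_eq_3\<close>)[10])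
      apply (rule run_conv, rule run_Gate, (use Cons.prems in \<open>simp_all add: fun_eq_iff numeral_3_eq_3\<close>)[10])
      apply (rule run_intros | use Cons.prems in \<open>simp; fail\<close>)+
      apply (rule Cons.IH[where g = "g + 2"])
      using u Cons.prems
      by (auto simp: clean_def fun_eq_iff algebra_simps enc_gates_Cons[of _ _ "_ # _"] enc_gates_Cons[of _ _ "bits_gates _ _"])
  qed
  then show ?thesis
    unfolding Eval_bits_def
    apply -
    apply (rule run_conv, rule run_Seq, assumption, rule run_Read)
    using u by (auto simp: fun_eq_iff algebra_simps enc_list_def comp_def length_concat sum_list_triv)
qed


definition Eval_int :: prog where
  "Eval_int = (Copy reg_fresh reg_pow ;;
     If_top 0 (Gate (gate_const (-1)) reg_fresh reg_fresh reg_fresh) (Gate (gate_const 1) reg_fresh reg_fresh reg_fresh) ;;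
     Read ;; Inc reg_fresh ;; Copy reg_fresh reg_mon ;; Gate (gate_const 0) reg_fresh reg_fresh reg_fresh ;;
     Inc reg_fresh ;; Eval_bits ;; Clear reg_pow)"

lemma enc_int_append: "enc_int i @ rest = (i < 0) # enc_list (\<lambda>b. [b]) (bits_of_nat (nat \<bar>i\<bar>)) @ rest"
  by (simp add: enc_int_def)

lemma run_Eval_int:
  assumes "clean c" "w 0 = enc_int i @ rest" "c reg_pow = 0" "c reg_mon \<le> c reg_size" "c reg_fresh = g"
    "Suc (int_end i g) \<le> c reg_size"
  shows "run Eval_int (c, w, v) (10 * unit_cost (c reg_size) * length (enc_int i))
    (c(reg_mon := int_end i g, reg_fresh := Suc (int_end i g)),
     w(0 := rest, 1 := rev (enc_int i) @ w 1), v @ enc_gates (c reg_size) (int_gates i g))"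
proof -
  let ?u = "unit_cost (c reg_size)"
  let ?q = "gate_const (if i < 0 then -1 else 1)"
  have u: "100 \<le> ?u" using unit_cost_ge[of "c reg_size"] by simp
  have g: "g + 1 < c reg_size" "g + 2 + 2 * length (bits_of_nat (nat \<bar>i\<bar>)) \<le> c reg_size"
    using assms(6) by (auto simp: int_end_def)
  note w0 = assms(2)[unfolded enc_int_append]
  show ?thesis
    unfolding Eval_int_def
    apply (rule run_conv)
    apply (rule run_Seq, rule run_Copy_unit, (use assms g in simp_all)[6])
    apply (rule run_Seq, rule run_If_top[where s = "(c(reg_pow := g), w, v @ enc_gates (c reg_size) [(?q, g, g, g)])" and t = ?u])
    apply (use w0 in simp)
    apply (rule run_conv, rule run_Gate, (use assms(1,3-5) w0 g in \<open>simp_all add: fun_eq_iff\<close>)[10])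
    apply (rule run_conv, rule run_Gate, (use assms(1,3-5) w0 g in \<open>simp_all add: fun_eq_iff\<close>)[10])
    apply (rule run_intros | use w0 assms g in \<open>simp; fail\<close>)+
    apply (rule run_Eval_bits[where g = g and bs = "bits_of_nat (nat \<bar>i\<bar>)" and rest = rest], (use assms(1,3-5) w0 g in simp_all)[6])
    apply (rule run_Clear_unit)
    using u assms(1,3-5) w0 g
    by (auto simp: clean_def fun_eq_iff algebra_simps int_gates_def int_end_def enc_int_def enc_gates_Cons[of _ _ "_ # _"] enc_gates_Cons[of _ _ "bits_gates _ _"])
qed

definition Eval_power :: prog where
  "Eval_power = (While_top 0 (Read ;; Gate gate_mult reg_fresh reg_mon reg_var ;; Copy reg_fresh reg_mon ;; Inc reg_fresh) ;;
    Read)"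

lemma enc_unary_append: "enc_unary e @ rest = replicate e True @ False # rest"
  by (simp add: enc_unary_def)

lemma run_Eval_power:
  assumes "clean c" "w 0 = enc_unary e @ rest" "c reg_mon = h" "c reg_fresh = Suc h" "Suc (h + e) \<le> c reg_size"
    "c reg_var < c reg_size"
  shows "run Eval_power (c, w, v) (10 * unit_cost (c reg_size) * length (enc_unary e))
    (c(reg_mon := h + e, reg_fresh := Suc (h + e)),
     w(0 := rest, 1 := rev (enc_unary e) @ w 1), v @ enc_gates (c reg_size) (power_gates e (c reg_var) h))"
proof -
  let ?body = "Read ;; Gate gate_mult reg_fresh reg_mon reg_var ;; Copy reg_fresh reg_mon ;; Inc reg_fresh"
  have "run (While_top 0 ?body) (c, w, v) (10 * unit_cost (c reg_size) * e + 1)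
    (c(reg_mon := h + e, reg_fresh := Suc (h + e)),
     w(0 := False # rest, 1 := replicate e True @ w 1), v @ enc_gates (c reg_size) (power_gates e (c reg_var) h))"
    using assms unfolding enc_unary_append
  proof (induction e arbitrary: c w v h)
    case 0
    then show ?case
      by (intro run_conv[OF run_While_top_done]) (auto simp: fun_eq_iff)
  next
    case (Suc e)
    let ?u = "unit_cost (c reg_size)"
    have u: "100 \<le> ?u" using unit_cost_ge[of "c reg_size"] by simp
    show ?case
      apply (rule run_conv, rule run_While_top_step)
      apply (use Suc.prems in simp)
      apply (use Suc.prems in simp)
      apply (rule run_intros | use Suc.prems in \<open>simp; fail\<close>)+
      apply (rule Suc.IH[where h = "Suc h"])
      using u Suc.prems
      by (auto simp: clean_def fun_eq_iff algebra_simps enc_gates_Cons[of _ _ "power_gates _ _ _"]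
        replicate_app_Cons_same)
  qed
  then show ?thesis
    unfolding Eval_power_def
    apply -
    apply (rule run_conv, rule run_Seq, assumption, rule run_Read)
    using unit_cost_ge[of "c reg_size"] by (auto simp: fun_eq_iff algebra_simps enc_unary_def)
qed

definition Eval_powers :: prog where
  "Eval_powers = (While_top 0 (Read ;; Eval_power ;; Inc reg_var) ;; Read)"

lemma run_Eval_powers:
  assumes "clean c" "w 0 = enc_list enc_unary es @ rest" "c reg_mon = h" "c reg_fresh = Suc h"
    "Suc (h + sum_list es) \<le> c reg_size" "c reg_var = z" "z + length es \<le> c reg_size"
  shows "run Eval_powers (c, w, v) (10 * unit_cost (c reg_size) * length (enc_list enc_unary es))
    (c(reg_mon := h + sum_list es, reg_fresh := Suc (h + sum_list es), reg_var := z + length es),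
     w(0 := rest, 1 := rev (enc_list enc_unary es) @ w 1), v @ enc_gates (c reg_size) (powers_gates es z h))"
proof -
  let ?body = "Read ;; Eval_power ;; Inc reg_var"
  \<comment> \<open>The loop stops in front of the end marker. In the reversed record of what has
    been read, the marker would come first, hence the \<open>tl\<close>.\<close>
  have "run (While_top 0 ?body) (c, w, v) (10 * unit_cost (c reg_size) * length (concat (map (\<lambda>e. True # enc_unary e) es)) + 1)
    (c(reg_mon := h + sum_list es, reg_fresh := Suc (h + sum_list es), reg_var := z + length es),
     w(0 := False # rest, 1 := tl (rev (enc_list enc_unary es)) @ w 1),
     v @ enc_gates (c reg_size) (powers_gates es z h))"
    using assms
  proof (induction es arbitrary: c w v h z)
    case Nil
    then show ?case
      by (intro run_conv[OF run_While_top_done]) (auto simp: fun_eq_iff)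
  next
    case (Cons e es)
    let ?u = "unit_cost (c reg_size)"
    have u: "100 \<le> ?u" using unit_cost_ge[of "c reg_size"] by simp
    have ne: "rev (enc_list enc_unary es) \<noteq> []" by (simp add: enc_list_def)
    show ?case
      apply (rule run_conv, rule run_While_top_step)
      apply (use Cons.prems in simp)
      apply (use Cons.prems in simp)
      apply (rule run_Seq, rule run_Read, use Cons.prems in simp)
      apply (rule run_Seq, rule run_Eval_power[where h = h and e = e and rest = "enc_list enc_unary es @ rest"],
          (use Cons.prems in simp_all)[6])
      apply (rule run_Inc)
      apply (rule Cons.IH[where h = "h + e" and z = "Suc z"])
      using u Cons.prems ne
      by (auto simp: clean_def fun_eq_iff algebra_simps)
  qed
  then show ?thesis
    unfolding Eval_powers_def
    apply -
    apply (rule run_conv, rule run_Seq, assumption, rule run_Read)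
    using unit_cost_ge[of "c reg_size"]
    by (auto simp: fun_eq_iff algebra_simps length_enc_list enc_list_def)
qed

definition Eval_monomial :: prog where
  "Eval_monomial = (Eval_int ;; Copy reg_base reg_var ;; Eval_powers ;; Clear reg_var)"

lemma run_Eval_monomial:
  assumes "clean c" "w 0 = enc_monomial m @ rest" "c reg_pow = 0" "c reg_var = 0" "c reg_mon \<le> c reg_size" "c reg_fresh = g"
    "Suc (monomial_end m g) \<le> c reg_size" "c reg_base + length (snd m) \<le> c reg_size"
  shows "run Eval_monomial (c, w, v) (12 * unit_cost (c reg_size) * length (enc_monomial m))
    (c(reg_mon := monomial_end m g, reg_fresh := Suc (monomial_end m g)),
     w(0 := rest, 1 := rev (enc_monomial m) @ w 1), v @ enc_gates (c reg_size) (monomial_gates m (c reg_base) g))"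
proof -
  let ?u = "unit_cost (c reg_size)"
  obtain k es where m: "m = (k, es)" by (cases m)
  have u: "100 \<le> ?u" using unit_cost_ge[of "c reg_size"] by simp
  obtain l where k: "length (enc_int k) = Suc l" by (simp add: length_enc_int)
  show ?thesis
    unfolding Eval_monomial_def
    apply (rule run_conv)
    apply (rule run_Seq, rule run_Eval_int[where g = g and i = k and rest = "enc_list enc_unary es @ rest"], (use assms m in simp_all)[6])
    apply (rule run_Seq, rule run_Copy_unit, (use assms m in simp_all)[6])
    apply (rule run_Seq, rule run_Eval_powers[where h = "int_end k g" and es = es and rest = rest, OF _ _ _ _ _ refl],
       (use assms m in simp_all)[6])
    apply (rule run_Clear_unit)
    using u k assms m by (auto simp: clean_def fun_eq_iff algebra_simps)
qed

definition Eval_polynomial :: prog where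
  "Eval_polynomial = (Copy reg_fresh reg_sum ;; Gate (gate_const 0) reg_fresh reg_fresh reg_fresh ;; Inc reg_fresh ;;
    While_top 0 (Read ;; Eval_monomial ;; Gate gate_add reg_fresh reg_sum reg_mon ;; Copy reg_fresh reg_sum ;;
      Inc reg_fresh ;; Clear reg_mon) ;;
    Read)"

lemma run_Eval_polynomial:
  assumes "clean c" "w 0 = enc_polynomial p @ rest" "polynomial_in n p"
    "c reg_pow = 0" "c reg_var = 0" "c reg_mon = 0" "c reg_sum \<le> c reg_size" "c reg_fresh = u"
    "Suc (terms_end p u) \<le> c reg_size" "c reg_base + n \<le> c reg_size"
  shows "run Eval_polynomial (c, w, v) (20 * unit_cost (c reg_size) * length (enc_polynomial p))
    (c(reg_sum := terms_end p u, reg_fresh := Suc (terms_end p u)),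
     w(0 := rest, 1 := rev (enc_polynomial p) @ w 1), v @ enc_gates (c reg_size) (poly_gates p (c reg_base) u))"
proof -
  let ?body = "Read ;; Eval_monomial ;; Gate gate_add reg_fresh reg_sum reg_mon ;; Copy reg_fresh reg_sum ;;
    Inc reg_fresh ;; Clear reg_mon"
  have loop: "run (While_top 0 ?body) (c, w, v) (20 * unit_cost (c reg_size) * length (enc_terms p) + 1)
    (c(reg_sum := terms_end p u, reg_fresh := Suc (terms_end p u)),
     w(0 := False # rest, 1 := rev (enc_terms p) @ w 1), v @ enc_gates (c reg_size) (terms_gates p (c reg_base) u))"
    if "clean c" "w 0 = enc_terms p @ False # rest" "polynomial_in n p"
      "c reg_pow = 0" "c reg_var = 0" "c reg_mon = 0" "c reg_sum = u" "c reg_fresh = Suc u"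
      "Suc (terms_end p u) \<le> c reg_size" "c reg_base + n \<le> c reg_size" for c w v
    using that
  proof (induction p arbitrary: c w v u)
    case Nil
    then show ?case
      by (intro run_conv[OF run_While_top_done]) (auto simp: fun_eq_iff)
  next
    case (Cons m p)
    define h where "h = monomial_end m (Suc u)"
    have U: "100 \<le> unit_cost (c reg_size)" using unit_cost_ge[of "c reg_size"] by simp
    have m: "length (snd m) = n" "polynomial_in n p" using Cons.prems by (auto simp: polynomial_in_def)
    have h: "Suc (Suc h) \<le> c reg_size" "u < h"
      using Cons.prems terms_end_ge[of "Suc h" p] monomial_end_ge[of "Suc u" m] by (auto simp: h_def)
    show ?case
      apply (rule run_conv, rule run_While_top_step, use Cons.prems in simp, use Cons.prems in simp)
      apply (rule run_Seq, rule run_Read, use Cons.prems in simp)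
      apply (rule run_Seq, rule run_Eval_monomial[where g = "Suc u" and m = m and rest = "enc_terms p @ False # rest"],
          (use Cons.prems m h in \<open>simp_all add: h_def\<close>)[8])
      apply (rule run_intros | use Cons.prems h in \<open>simp add: h_def; fail\<close>)+
      apply (rule Cons.IH[where u = "Suc h"])
      using U Cons.prems m h
      by (auto simp: clean_def fun_eq_iff algebra_simps h_def Let_def enc_gates_Cons[of _ _ "terms_gates _ _ _"])
  qed
  have "u < c reg_size" using assms(9) terms_end_ge[of u p] by simp
  then show ?thesis
    unfolding Eval_polynomial_def
    apply -
    apply (rule run_conv)
    apply (rule run_intros | use assms in \<open>simp; fail\<close>)+
    apply (rule loop)
    apply (use assms in \<open>simp_all add: enc_polynomial_eq\<close>)[10]
    apply (rule run_Read)
    using assms unit_cost_ge[of "c reg_size"]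
    by (auto simp: fun_eq_iff algebra_simps enc_polynomial_eq poly_gates_def enc_gates_Cons[of _ _ "terms_gates _ _ _"])
qed


section \<open>Formulas\<close>

text \<open>The equations \<open>v z = 0\<close> and \<open>v = 1 - z r\<close> make \<open>v\<close> the truth value of \<open>z = 0\<close>.\<close>

definition zero_test :: "nat \<Rightarrow> nat \<Rightarrow> nat \<Rightarrow> gate list" where
  "zero_test v z r = [(gate_annul, v, z, z), (gate_inverse, v, z, r)]"

lemma zero_test_sat: "sat x (zero_test v z r) \<Longrightarrow> x v = of_bool (x z = 0)"
  by (auto simp: zero_test_def)

lemma zero_test_complete:
  "x v = of_bool (x z = 0) \<Longrightarrow> x r = inverse (x z) \<Longrightarrow> sat x (zero_test v z r)"
  by (auto simp: zero_test_def)

text \<open>The equations \<open>a = r\<^sup>2\<close> and \<open>a\<^sup>2 = s\<^sup>2\<close> make \<open>a\<close> the absolute value of \<open>s\<close>.\<close>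

definition abs_gates :: "nat \<Rightarrow> gate list" where
  "abs_gates s = [(gate_mult, s + 2, s + 1, s + 1), (gate_mult, s + 3, s, s), (gate_mult, s + 3, s + 2, s + 2)]"

lemma abs_gates_sat: "sat x (abs_gates s) \<Longrightarrow> x (s + 2) = \<bar>x s\<bar>"
proof -
  assume "sat x (abs_gates s)"
  then have "x (s + 2) = x (s + 1) * x (s + 1)" "x s * x s = x (s + 2) * x (s + 2)"
    by (auto simp: abs_gates_def)
  moreover from this have "x (s + 2) \<ge> 0" by simp
  ultimately show ?thesis by (metis abs_of_nonneg abs_mult_self_eq abs_abs real_sqrt_abs2)
qed

text \<open>The variable \<open>v\<close> for the truth value is chosen by the parent, and
  \<open>f\<close> is the first fresh one. The variables of both operands are allocated before
  either operand is treated, because in prefix notation the gate of a connective is written before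
  its operands have been read. For \<open>p > 0\<close> the sum of \<open>p\<close> and its absolute
  value is tested for zero and the answer negated; for \<open>p \<ge> 0\<close> the difference of
  the absolute value and \<open>p\<close> is tested. In both, \<open>s + 1\<close> to
  \<open>s + 3\<close> serve the absolute value and \<open>s + 4\<close> is the tested
  number.\<close>

fun form_gates :: "qf_formula \<Rightarrow> nat \<Rightarrow> nat \<Rightarrow> gate list"
  and form_end :: "qf_formula \<Rightarrow> nat \<Rightarrow> nat" where
  "form_gates (EqZero p) v f = poly_gates p 0 f @ (let s = terms_end p f in zero_test v s (s + 1))"
| "form_gates (GtZero p) v f = poly_gates p 0 f @ (let s = terms_end p f in
     abs_gates s @ (gate_add, s + 4, s, s + 2) # zero_test (s + 5) (s + 4) (s + 6) @ [(gate_not, v, s + 5, s + 5)])"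
| "form_gates (GeZero p) v f = poly_gates p 0 f @ (let s = terms_end p f in
     abs_gates s @ (gate_diff, s + 4, s + 2, s) # zero_test v (s + 4) (s + 5))"
| "form_gates (Neg \<phi>) v f = (gate_not, v, f, f) # form_gates \<phi> f (f + 1)"
| "form_gates (Conj \<phi> \<psi>) v f = (gate_mult, v, f, f + 1) #
     form_gates \<phi> f (f + 2) @ form_gates \<psi> (f + 1) (form_end \<phi> (f + 2))"
| "form_gates (Disj \<phi> \<psi>) v f = (gate_or, v, f, f + 1) #
     form_gates \<phi> f (f + 2) @ form_gates \<psi> (f + 1) (form_end \<phi> (f + 2))"
| "form_end (EqZero p) f = terms_end p f + 2"
| "form_end (GtZero p) f = terms_end p f + 7"
| "form_end (GeZero p) f = terms_end p f + 6"
| "form_end (Neg \<phi>) f = form_end \<phi> (f + 1)"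
| "form_end (Conj \<phi> \<psi>) f = form_end \<psi> (form_end \<phi> (f + 2))"
| "form_end (Disj \<phi> \<psi>) f = form_end \<psi> (form_end \<phi> (f + 2))"

lemma form_end_ge: "f \<le> form_end \<phi> f"
proof (induction \<phi> arbitrary: f)
  case (Neg \<phi>)
  show ?case using Neg[of "f + 1"] by simp
next
  case (Conj \<phi> \<psi>)
  show ?case using Conj(1)[of "f + 2"] Conj(2)[of "form_end \<phi> (f + 2)"] by simp
next
  case (Disj \<phi> \<psi>)
  show ?case using Disj(1)[of "f + 2"] Disj(2)[of "form_end \<phi> (f + 2)"] by simp
qed (simp_all add: terms_end_ge trans_le_add1 le_SucI)

lemma form_end_le: "form_end \<phi> f \<le> f + 2 * length (enc_formula \<phi>)"
proof (induction \<phi> arbitrary: f)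
  case (EqZero p)
  then show ?case using terms_end_le[of p f] by simp
next
  case (GtZero p)
  then show ?case using terms_end_le[of p f] by simp
next
  case (GeZero p)
  then show ?case using terms_end_le[of p f] by simp
next
  case (Neg \<phi>)
  show ?case using Neg[of "f + 1"] by simp
next
  case (Conj \<phi> \<psi>)
  show ?case using Conj(1)[of "f + 2"] Conj(2)[of "form_end \<phi> (f + 2)"] by simp
next
  case (Disj \<phi> \<psi>)
  show ?case using Disj(1)[of "f + 2"] Disj(2)[of "form_end \<phi> (f + 2)"] by simp
qed

text \<open>Every solution forces \<open>v\<close> to be exactly 0 or 1 according to the truth of
  the formula. An implication in one direction would not pass through \<open>Neg\<close>.\<close>

lemma form_gates_value: "sat x (form_gates \<phi> v f) \<Longrightarrow> x v = of_bool (holds x \<phi>)"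
proof (induction \<phi> arbitrary: v f)
  case (EqZero p)
  then have "sat x (poly_gates p 0 f)" "sat x (zero_test v (terms_end p f) (terms_end p f + 1))"
    by (auto simp: Let_def)
  then show ?case using zero_test_sat poly_gates_value by fastforce
next
  case (GtZero p)
  define s where "s = terms_end p f"
  have "x s = eval_polynomial x p" using GtZero poly_gates_value[of x p 0 f] by (simp add: s_def)
  moreover have "x (s + 2) = \<bar>x s\<bar>" using GtZero by (intro abs_gates_sat) (simp add: Let_def s_def)
  moreover have "x (s + 4) = x s + x (s + 2)" "x v = 1 - x (s + 5)"
    using GtZero by (simp_all add: Let_def s_def)
  moreover have "x (s + 5) = of_bool (x (s + 4) = 0)"
    by (rule zero_test_sat[of x _ _ "s + 6"]) (use GtZero in \<open>simp add: Let_def s_def\<close>)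
  ultimately show ?case by auto
next
  case (GeZero p)
  define s where "s = terms_end p f"
  have "x s = eval_polynomial x p" using GeZero poly_gates_value[of x p 0 f] by (simp add: s_def)
  moreover have "x (s + 2) = \<bar>x s\<bar>" using GeZero by (intro abs_gates_sat) (simp add: Let_def s_def)
  moreover have "x (s + 4) = x (s + 2) - x s"
    using GeZero by (simp_all add: Let_def s_def)
  moreover have "x v = of_bool (x (s + 4) = 0)"
    by (rule zero_test_sat[of x _ _ "s + 5"]) (use GeZero in \<open>simp add: Let_def s_def\<close>)
  ultimately show ?case by auto
next
  case (Neg \<phi>)
  show ?case using Neg.prems Neg.IH[of f "f + 1"] by auto
next
  case (Conj \<phi> \<psi>)
  show ?case using Conj.prems Conj.IH(1)[of f "f + 2"] Conj.IH(2)[of "f + 1" "form_end \<phi> (f + 2)"] by auto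
next
  case (Disj \<phi> \<psi>)
  show ?case using Disj.prems Disj.IH(1)[of f "f + 2"] Disj.IH(2)[of "f + 1" "form_end \<phi> (f + 2)"] by auto
qed

lemma gates_below_form:
  "formula_in n \<phi> \<Longrightarrow> n \<le> f \<Longrightarrow> v < f \<Longrightarrow> gates_below (form_end \<phi> f) (form_gates \<phi> v f)"
proof (induction \<phi> arbitrary: v f)
  case (EqZero p)
  then show ?case using extends_poly[of n p 0 f] terms_end_ge[of f p]
    by (auto simp: zero_test_def Let_def extends_def intro: gates_below_mono)
next
  case (GtZero p)
  then show ?case using extends_poly[of n p 0 f] terms_end_ge[of f p]
    by (auto simp: zero_test_def abs_gates_def Let_def extends_def intro: gates_below_mono)
next
  case (GeZero p)
  then show ?case using extends_poly[of n p 0 f] terms_end_ge[of f p]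
    by (auto simp: zero_test_def abs_gates_def Let_def extends_def intro: gates_below_mono)
next
  case (Neg \<phi>)
  then show ?case using form_end_ge[of "f + 1" \<phi>] by auto
next
  case (Conj \<phi> \<psi>)
  let ?e = "form_end \<phi> (f + 2)"
  have "gates_below ?e (form_gates \<phi> f (f + 2))" "gates_below (form_end \<psi> ?e) (form_gates \<psi> (f + 1) ?e)"
    using Conj form_end_ge[of "f + 2" \<phi>] by auto
  then show ?case using Conj.prems form_end_ge[of "f + 2" \<phi>] form_end_ge[of ?e \<psi>]
    by (auto intro: gates_below_mono)
next
  case (Disj \<phi> \<psi>)
  let ?e = "form_end \<phi> (f + 2)"
  have "gates_below ?e (form_gates \<phi> f (f + 2))" "gates_below (form_end \<psi> ?e) (form_gates \<psi> (f + 1) ?e)"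
    using Disj form_end_ge[of "f + 2" \<phi>] by auto
  then show ?case using Disj.prems form_end_ge[of "f + 2" \<phi>] form_end_ge[of ?e \<psi>]
    by (auto intro: gates_below_mono)
qed

lemma eval_polynomial_agree:
  assumes "polynomial_in n p" "agree n x y"
  shows "eval_polynomial y p = eval_polynomial x p"
proof -
  have "eval_monomial y m = eval_monomial x m" if "m \<in> set p" for m
    using that assms by (cases m) (auto simp: polynomial_in_def agree_def intro!: prod.cong)
  then show ?thesis unfolding eval_polynomial_def by (metis map_cong)
qed

lemma holds_agree: "formula_in n \<phi> \<Longrightarrow> agree n x y \<Longrightarrow> holds y \<phi> \<longleftrightarrow> holds x \<phi>"
  by (induction \<phi>) (auto simp: eval_polynomial_agree)

lemma agree_le: "agree n x y \<Longrightarrow> m \<le> n \<Longrightarrow> agree m x y"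
  by (simp add: agree_def)

text \<open>The common part of conjunction and disjunction, with the induction hypotheses as
  premises. The truth values of the operands go into \<open>f\<close> and \<open>f + 1\<close>; the
  gates of the left operand are solved from \<open>f + 2\<close> on, and those of the right operand
  from \<open>form_end\<close> on, which leaves the solution for the left one intact.\<close>

lemma binary_gates_complete:
  assumes \<phi>: "formula_in n \<phi>" "\<And>v f x. n \<le> f \<Longrightarrow> v < f \<Longrightarrow> x v = of_bool (holds x \<phi>) \<Longrightarrow> \<exists>y. agree f x y \<and> sat y (form_gates \<phi> v f)"
    and \<psi>: "formula_in n \<psi>" "\<And>v f x. n \<le> f \<Longrightarrow> v < f \<Longrightarrow> x v = of_bool (holds x \<psi>) \<Longrightarrow> \<exists>y. agree f x y \<and> sat y (form_gates \<psi> v f)"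
    and f: "n \<le> f" "v < f" and q: "local_eval q (x v) (of_bool (holds x \<phi>)) (of_bool (holds x \<psi>)) = 0"
  shows "\<exists>y. agree f x y \<and> sat y ((q, v, f, f + 1) # form_gates \<phi> f (f + 2) @ form_gates \<psi> (f + 1) (form_end \<phi> (f + 2)))"
proof -
  let ?e = "form_end \<phi> (f + 2)"
  let ?x = "x(f := of_bool (holds x \<phi>), f + 1 := of_bool (holds x \<psi>))"
  have e: "f + 2 \<le> ?e" by (rule form_end_ge)
  have nx: "agree n x ?x" using f by (auto simp: agree_def)
  have "\<exists>y. agree (f + 2) ?x y \<and> sat y (form_gates \<phi> f (f + 2))"
    by (rule \<phi>(2)) (use f holds_agree[OF \<phi>(1) nx] in auto)
  then obtain y where y: "agree (f + 2) ?x y" "sat y (form_gates \<phi> f (f + 2))" by blast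
  \<comment> \<open>The truth of the right operand depends on the variables below \<open>n\<close>
    only, so the value prepared in \<open>f + 1\<close> is still the right one after the left gates
    have been solved.\<close>
  have ny: "agree n x y" by (rule agree_trans[OF nx y(1)]) (use f in simp)
  have "\<exists>z. agree ?e y z \<and> sat z (form_gates \<psi> (f + 1) ?e)"
    by (rule \<psi>(2)) (use f e holds_agree[OF \<psi>(1) ny] agreeD[OF y(1), of "f + 1"] in auto)
  then obtain z where z: "agree ?e y z" "sat z (form_gates \<psi> (f + 1) ?e)" by blast
  have yz: "agree (f + 2) ?x z" using y(1) z(1) e by (auto intro: agree_trans)
  have "sat z (form_gates \<phi> f (f + 2))"
    using sat_agree[OF z(1) gates_below_form[OF \<phi>(1)]] y(2) f by simp
  moreover have fx: "agree f x ?x" by (simp add: agree_def)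
  have "agree f x z" by (rule agree_trans[OF fx yz]) simp
  moreover from this have "z v = x v" by (rule agreeD) (use f in simp)
  moreover have "z f = ?x f" "z (f + 1) = ?x (f + 1)" by (rule agreeD[OF yz], simp)+
  ultimately show ?thesis using z(2) q by (intro exI[of _ z]) auto
qed

lemma form_gates_complete:
  "formula_in n \<phi> \<Longrightarrow> n \<le> f \<Longrightarrow> v < f \<Longrightarrow> x v = of_bool (holds x \<phi>) \<Longrightarrow>
    \<exists>y. agree f x y \<and> sat y (form_gates \<phi> v f)"
proof (induction \<phi> arbitrary: v f x)
  case (EqZero p)
  define s where "s = terms_end p f"
  from EqZero have ext: "extends f (poly_gates p 0 f) (Suc s)"
    using extends_poly[of n p 0 f] by (simp add: s_def)
  then obtain y where y: "agree f x y" "sat y (poly_gates p 0 f)" unfolding extends_def by blast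
  \<comment> \<open>If \<open>y s\<close> is 0 then \<open>v\<close> is 1 and the equations of the
    test hold for any value of the witness, so the convention \<open>inverse 0 = 0\<close> does no
    harm.\<close>
  define z where "z = y(s + 1 := inverse (y s))"
  have fs: "f \<le> s" using terms_end_ge by (simp add: s_def)
  have yz: "agree (Suc s) y z" by (auto simp: z_def agree_def)
  have "agree f x z" using y(1) yz fs by (auto intro: agree_trans)
  moreover have "sat z (poly_gates p 0 f)" using y(2) sat_agree[OF yz] ext by (simp add: extends_def)
  moreover have "y s = eval_polynomial y p" using poly_gates_value[OF y(2)] by (simp add: s_def)
  then have "sat z (zero_test v s (s + 1))"
    using EqZero.prems fs y(1) eval_polynomial_agree[of n p x y] agree_le[OF y(1)]
    by (intro zero_test_complete) (auto simp: z_def agreeD[OF y(1)])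
  ultimately show ?case by (auto simp: Let_def s_def)
next
  case (GtZero p)
  define s where "s = terms_end p f"
  from GtZero have ext: "extends f (poly_gates p 0 f) (Suc s)"
    using extends_poly[of n p 0 f] by (simp add: s_def)
  then obtain y where y: "agree f x y" "sat y (poly_gates p 0 f)" unfolding extends_def by blast
  \<comment> \<open>In order: the square root that certifies the absolute value, the absolute value,
    the common square, the number to be tested, the outcome of the test, and its inverse
    witness.\<close>
  define z where "z = y(s + 1 := sqrt \<bar>y s\<bar>, s + 2 := \<bar>y s\<bar>, s + 3 := y s * y s, s + 4 := y s + \<bar>y s\<bar>,
     s + 5 := of_bool (y s + \<bar>y s\<bar> = 0), s + 6 := inverse (y s + \<bar>y s\<bar>))"
  have fs: "f \<le> s" using terms_end_ge by (simp add: s_def)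
  have yz: "agree (Suc s) y z" by (auto simp: z_def agree_def)
  have "agree f x z" using y(1) yz fs by (auto intro: agree_trans)
  moreover have "sat z (poly_gates p 0 f)" using y(2) sat_agree[OF yz] ext by (simp add: extends_def)
  moreover have "sat z (abs_gates s)" "gate_holds z (gate_add, s + 4, s, s + 2)"
    by (simp_all add: abs_gates_def z_def)
  moreover have "sat z (zero_test (s + 5) (s + 4) (s + 6))"
    by (intro zero_test_complete) (auto simp: z_def)
  moreover have "y s = eval_polynomial y p" using poly_gates_value[OF y(2)] by (simp add: s_def)
  then have "gate_holds z (gate_not, v, s + 5, s + 5)"
    using GtZero.prems fs y(1) eval_polynomial_agree[of n p x y] agree_le[OF y(1)]
    by (auto simp: z_def agreeD[OF y(1)])
  ultimately show ?case by (auto simp: Let_def s_def)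
next
  case (GeZero p)
  define s where "s = terms_end p f"
  from GeZero have ext: "extends f (poly_gates p 0 f) (Suc s)"
    using extends_poly[of n p 0 f] by (simp add: s_def)
  then obtain y where y: "agree f x y" "sat y (poly_gates p 0 f)" unfolding extends_def by blast
  define z where "z = y(s + 1 := sqrt \<bar>y s\<bar>, s + 2 := \<bar>y s\<bar>, s + 3 := y s * y s, s + 4 := \<bar>y s\<bar> - y s,
     s + 5 := inverse (\<bar>y s\<bar> - y s))"
  have fs: "f \<le> s" using terms_end_ge by (simp add: s_def)
  have yz: "agree (Suc s) y z" by (auto simp: z_def agree_def)
  have "agree f x z" using y(1) yz fs by (auto intro: agree_trans)
  moreover have "sat z (poly_gates p 0 f)" using y(2) sat_agree[OF yz] ext by (simp add: extends_def)
  moreover have "sat z (abs_gates s)" "gate_holds z (gate_diff, s + 4, s + 2, s)"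
    by (simp_all add: abs_gates_def z_def)
  moreover have "y s = eval_polynomial y p" using poly_gates_value[OF y(2)] by (simp add: s_def)
  then have "sat z (zero_test v (s + 4) (s + 5))"
    using GeZero.prems fs y(1) eval_polynomial_agree[of n p x y] agree_le[OF y(1)]
    by (intro zero_test_complete) (auto simp: z_def agreeD[OF y(1)])
  ultimately show ?case by (auto simp: Let_def s_def)
next
  case (Neg \<phi>)
  let ?x = "x(f := of_bool (holds x \<phi>))"
  have "agree n x ?x" using Neg.prems by (auto simp: agree_def)
  then have xf: "?x f = of_bool (holds ?x \<phi>)" using Neg.prems holds_agree[of n \<phi> x ?x] by simp
  have "\<exists>y. agree (f + 1) ?x y \<and> sat y (form_gates \<phi> f (f + 1))"
    by (rule Neg.IH[OF _ _ _ xf]) (use Neg.prems in auto)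
  then obtain y where y: "agree (f + 1) ?x y" "sat y (form_gates \<phi> f (f + 1))" by blast
  have "agree f x ?x" by (simp add: agree_def)
  then have "agree f x y" using y(1) by (rule agree_trans) simp
  moreover have "y f = ?x f" "y v = x v"
    using agreeD[OF y(1), of f] agreeD[OF \<open>agree f x y\<close>, of v] Neg.prems by simp_all
  ultimately have "agree f x y" "y f = ?x f" "y v = x v" by blast+
  with y Neg.prems show ?case by (intro exI[of _ y]) auto
next
  case (Conj \<phi> \<psi>)
  then show ?case unfolding form_gates.simps by (intro binary_gates_complete[of n]) auto
next
  case (Disj \<phi> \<psi>)
  then show ?case unfolding form_gates.simps by (intro binary_gates_complete[of n]) auto
qed

definition etr_gates :: "nat \<Rightarrow> qf_formula \<Rightarrow> gate list" where
  "etr_gates f \<Phi> = (gate_const 1, f, f, f) # form_gates \<Phi> f (f + 1)"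

lemma etr_gates_below: "formula_in n \<Phi> \<Longrightarrow> n \<le> f \<Longrightarrow> gates_below (form_end \<Phi> (f + 1)) (etr_gates f \<Phi>)"
  using gates_below_form[of n \<Phi> "f + 1" f] form_end_ge[of "f + 1" \<Phi>] by (simp add: etr_gates_def)

lemma etr_gates_sat:
  assumes "formula_in n \<Phi>" "n \<le> f"
  shows "(\<exists>x. sat x (etr_gates f \<Phi>)) \<longleftrightarrow> (\<exists>x. holds x \<Phi>)"
proof
  assume "\<exists>x. sat x (etr_gates f \<Phi>)"
  then obtain x where x: "x f = 1" "sat x (form_gates \<Phi> f (f + 1))" by (auto simp: etr_gates_def)
  then have "holds x \<Phi>" using form_gates_value[OF x(2)] by auto
  then show "\<exists>x. holds x \<Phi>" by blast
next
  assume "\<exists>x. holds x \<Phi>"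
  then obtain x where x: "holds x \<Phi>" ..
  \<comment> \<open>\<open>f\<close> lies beyond the variables of the formula, so it can be used for
    the truth value of the whole.\<close>
  have "holds (x(f := 1)) \<Phi>"
    using holds_agree[OF assms(1), of x "x(f := 1)"] x assms by (simp add: agree_def)
  then obtain y where y: "agree (f + 1) (x(f := 1)) y" "sat y (form_gates \<Phi> f (f + 1))"
    using form_gates_complete[OF assms(1), of "f + 1" f "x(f := 1)"] assms by auto
  then have "sat y (etr_gates f \<Phi>)" using agreeD[OF y(1), of f] by (simp add: etr_gates_def)
  then show "\<exists>x. sat x (etr_gates f \<Phi>)" by blast
qed


section \<open>Reading formulas\<close>

abbreviation (input) reg_node :: nat where "reg_node \<equiv> 12"
abbreviation (input) reg_a :: nat where "reg_a \<equiv> 13"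
abbreviation (input) reg_b :: nat where "reg_b \<equiv> 14"
abbreviation (input) reg_c :: nat where "reg_c \<equiv> 15"
abbreviation (input) reg_d :: nat where "reg_d \<equiv> 16"

text \<open>Word \<open>2\<close> is a stack of variable indices in unary: the subformulas that are still to be read.\<close>

definition Push_index :: "nat \<Rightarrow> prog" where
  "Push_index r = (Push_word 2 False ;; For r 4 (Push_word 2 True))"

lemma run_Push_index:
  assumes "clean c" "5 \<le> r" "c r \<le> c reg_size"
  shows "run (Push_index r) (c, w, v) (unit_cost (c reg_size)) (c, w(2 := enc_unary (c r) @ w 2), v)"
proof -
  have "run (For r 4 (Push_word 2 True)) (c, w(2 := replicate 0 True @ False # w 2), v) (c r * (2 + 8) + 2)
    (c(r := c r, 4 := 0), w(2 := replicate (c r) True @ False # w 2), v)"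
    by (rule run_For[where c = "\<lambda>_. c" and w = "\<lambda>j. w(2 := replicate j True @ False # w 2)" and v = "\<lambda>_. v"])
      (use assms in \<open>auto dest: cleanD intro!: run_conv[OF run_Push_word]\<close>)
  then have *: "run (For r 4 (Push_word 2 True)) (c, w(2 := False # w 2), v) (c r * (2 + 8) + 2)
    (c(r := c r, 4 := 0), w(2 := replicate (c r) True @ False # w 2), v)" by simp
  show ?thesis
    unfolding Push_index_def
    by (rule run_conv, rule run_Seq, rule run_Push_word, rule *)
      (use assms unit_cost_ge[of "c reg_size"] cleanD(5)[OF assms(1)] in \<open>auto simp: enc_unary_def fun_eq_iff\<close>)
qed

definition Pop_index :: prog where
  "Pop_index = (Clear reg_node ;; While_top 2 (Pop_word 2 ;; Inc reg_node) ;; Pop_word 2)"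

lemma run_Pop_index:
  assumes "w 2 = enc_unary i @ stk" "i \<le> c reg_size" "c reg_node \<le> c reg_size"
  shows "run Pop_index (c, w, v) (unit_cost (c reg_size)) (c(reg_node := i), w(2 := stk), v)"
proof -
  have loop: "run (While_top 2 (Pop_word 2 ;; Inc reg_node)) (c, w, v) (4 * i + 1)
     (c(reg_node := c reg_node + i), w(2 := False # stk), v)" if "w 2 = replicate i True @ False # stk" for c w i
    using that
  proof (induction i arbitrary: c w)
    case 0
    then show ?case by (intro run_conv[OF run_While_top_done]) (auto simp: fun_eq_iff)
  next
    case (Suc i)
    show ?case
      apply (rule run_conv, rule run_While_top_step, use Suc.prems in simp, use Suc.prems in simp)
      apply (rule run_Seq, rule run_Pop_word, use Suc.prems in simp)
      apply (rule run_Inc)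
      apply (rule Suc.IH)
      using Suc.prems by (auto simp: fun_eq_iff)
  qed
  show ?thesis
    unfolding Pop_index_def
    apply (rule run_conv, rule run_Seq, rule run_Clear, rule run_Seq, rule loop)
    apply (use assms(1) in \<open>simp add: enc_unary_def\<close>)
    apply (rule run_Pop_word, simp)
    using assms unit_cost_ge[of "c reg_size"] by (auto simp: fun_eq_iff)
qed

definition Zero_test :: "nat \<Rightarrow> nat \<Rightarrow> prog" where
  "Zero_test rv rz = (Gate gate_annul rv rz rz ;; Gate gate_inverse rv rz reg_fresh ;; Inc reg_fresh)"

lemma run_Zero_test:
  assumes "clean c" "5 \<le> rv" "5 \<le> rz" "c rv < c reg_size" "c rz < c reg_size" "c reg_fresh < c reg_size"
  shows "run (Zero_test rv rz) (c, w, v) (2 * unit_cost (c reg_size) + 2)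
    (c(reg_fresh := Suc (c reg_fresh)), w, v @ enc_gates (c reg_size) (zero_test (c rv) (c rz) (c reg_fresh)))"
  unfolding Zero_test_def
  apply (rule run_conv)
  apply (rule run_intros | use assms in \<open>simp; fail\<close>)+
  by (auto simp: zero_test_def enc_gates_Cons[of _ _ "[_]"])

definition Abs_value :: prog where
  "Abs_value = (New reg_a ;; New reg_b ;; Gate gate_mult reg_b reg_a reg_a ;;
     Gate gate_mult reg_fresh reg_sum reg_sum ;; Gate gate_mult reg_fresh reg_b reg_b ;; Inc reg_fresh)"

lemma run_Abs_value:
  assumes "clean c" "c reg_sum = s" "c reg_fresh = Suc s" "s + 4 \<le> c reg_size" "c reg_a \<le> c reg_size" "c reg_b \<le> c reg_size"
  shows "run Abs_value (c, w, v) (6 * unit_cost (c reg_size))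
    (c(reg_a := s + 1, reg_b := s + 2, reg_fresh := s + 4), w, v @ enc_gates (c reg_size) (abs_gates s))"
  unfolding Abs_value_def
  apply (rule run_conv)
  apply (rule run_intros | use assms in \<open>simp; fail\<close>)+
  using assms unit_cost_ge[of "c reg_size"]
  by (auto simp: fun_eq_iff abs_gates_def numeral_3_eq_3 enc_gates_Cons[of _ _ "_ # _"])

definition Eq_node :: prog where
  "Eq_node = (Eval_polynomial ;; Zero_test reg_node reg_sum)"

definition Gt_node :: prog where
  "Gt_node = (Eval_polynomial ;; Abs_value ;; Gate gate_add reg_fresh reg_sum reg_b ;; New reg_c ;; New reg_d ;;
     Zero_test reg_d reg_c ;; Gate gate_not reg_node reg_d reg_d)"

definition Ge_node :: prog where
  "Ge_node = (Eval_polynomial ;; Abs_value ;; Gate gate_diff reg_fresh reg_b reg_sum ;; New reg_c ;;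
     Zero_test reg_node reg_c)"

definition Neg_node :: prog where
  "Neg_node = (Gate gate_not reg_node reg_fresh reg_fresh ;; Push_index reg_fresh ;; Inc reg_fresh)"

text \<open>The right operand is pushed first, so that the left one, which comes next in the input,
  is on top.\<close>

definition Binary_node :: "local_poly \<Rightarrow> prog" where
  "Binary_node q = (New reg_a ;; New reg_b ;; Gate q reg_node reg_a reg_b ;; Push_index reg_b ;; Push_index reg_a)"

fun node_prog :: "bool \<Rightarrow> bool \<Rightarrow> bool \<Rightarrow> prog" where
  "node_prog a b d = (if a then (if d then Binary_node gate_or else Binary_node gate_mult)
     else if b then (if d then Neg_node else Ge_node) else if d then Gt_node else Eq_node)"

definition Node :: prog where
  "Node = (Pop_index ;;
     If_top 0
       (Read ;; Read ;; If_top 0 (Read ;; Binary_node gate_or) (Read ;; Binary_node gate_mult))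
       (Read ;; If_top 0
          (Read ;; If_top 0 (Read ;; Neg_node) (Read ;; Ge_node))
          (Read ;; If_top 0 (Read ;; Gt_node) (Read ;; Eq_node))))"

lemma run_Read_Seq:
  assumes "w 0 = x # xs" "run P (c, w(0 := xs, 1 := x # w 1), v) t s"
  shows "run (Read ;; P) (c, w, v) (t + 4) s"
  by (rule run_conv, rule run_Seq, rule run_Read) (use assms in auto)

lemma run_branch:
  assumes "w 0 = x # xs" "run (if x then P else Q) (c, w(0 := xs, 1 := x # w 1), v) t s"
  shows "run (If_top 0 (Read ;; P) (Read ;; Q)) (c, w, v) (t + 5) s"
proof -
  have "run (If_top 0 (Read ;; P) (Read ;; Q)) (c, w, v) (Suc (t + 4)) s"
    by (rule run_If_top) (use assms in \<open>auto intro: run_Read_Seq\<close>)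
  then show ?thesis by (rule run_conv) auto
qed

lemma run_Node:
  assumes "w 2 = enc_unary i @ stk" "i \<le> c reg_size" "c reg_node \<le> c reg_size" "w 0 = a # b # d # xs"
    and node: "run (node_prog a b d) (c(reg_node := i), w(0 := xs, 1 := [d, b, a] @ w 1, 2 := stk), v) t s"
  shows "run Node (c, w, v) (t + 2 * unit_cost (c reg_size)) s"
proof -
  let ?w = "w(2 := stk)"
  let ?w1 = "?w(0 := b # d # xs, 1 := a # ?w 1)"
  let ?w2 = "?w1(0 := d # xs, 1 := b # ?w1 1)"
  let ?c = "c(reg_node := i)"
  have upd: "?w2(0 := xs, 1 := d # ?w2 1) = w(0 := xs, 1 := [d, b, a] @ w 1, 2 := stk)"
    by (auto simp: fun_eq_iff)
  have branch: "run (If_top 0 (Read ;; P) (Read ;; Q)) (?c, ?w2, v) (t + 5) s"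
    if "node_prog a b d = (if d then P else Q)" for P Q
    by (rule run_branch[of _ d xs], simp) (use node that in \<open>simp only: upd\<close>)
  have "run (If_top 0
       (Read ;; Read ;; If_top 0 (Read ;; Binary_node gate_or) (Read ;; Binary_node gate_mult))
       (Read ;; If_top 0
          (Read ;; If_top 0 (Read ;; Neg_node) (Read ;; Ge_node))
          (Read ;; If_top 0 (Read ;; Gt_node) (Read ;; Eq_node)))) (?c, ?w, v) ((t + 10) + 5) s"
  proof (rule run_branch[of _ a "b # d # xs"])
    show "run (if a then Read ;; If_top 0 (Read ;; Binary_node gate_or) (Read ;; Binary_node gate_mult)
        else If_top 0 (Read ;; If_top 0 (Read ;; Neg_node) (Read ;; Ge_node))
          (Read ;; If_top 0 (Read ;; Gt_node) (Read ;; Eq_node))) (?c, ?w1, v) (t + 10) s"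
    proof (cases a)
      case True
      have "run (Read ;; If_top 0 (Read ;; Binary_node gate_or) (Read ;; Binary_node gate_mult)) (?c, ?w1, v) ((t + 5) + 4) s"
        by (rule run_Read_Seq[of _ b "d # xs"], simp, rule branch) (simp add: True)
      with True show ?thesis by (auto elim: run_conv)
    next
      case False
      have "run (If_top 0 (Read ;; If_top 0 (Read ;; Neg_node) (Read ;; Ge_node))
          (Read ;; If_top 0 (Read ;; Gt_node) (Read ;; Eq_node))) (?c, ?w1, v) ((t + 5) + 5) s"
      proof (rule run_branch[of _ b "d # xs"])
        have "run (If_top 0 (Read ;; Neg_node) (Read ;; Ge_node)) (?c, ?w2, v) (t + 5) s" if b
          by (rule branch) (simp add: False that)
        moreover have "run (If_top 0 (Read ;; Gt_node) (Read ;; Eq_node)) (?c, ?w2, v) (t + 5) s" if "\<not> b"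
          by (rule branch) (simp add: False that)
        ultimately show "run (if b then If_top 0 (Read ;; Neg_node) (Read ;; Ge_node)
          else If_top 0 (Read ;; Gt_node) (Read ;; Eq_node)) (?c, ?w2, v) (t + 5) s" by presburger
      qed simp
      with False show ?thesis by (auto elim: run_conv)
    qed
  qed (use assms(4) in simp)
  then show ?thesis
    unfolding Node_def
    by - (rule run_conv, rule run_Seq, rule run_Pop_index, rule assms, rule assms, rule assms, assumption,
      use unit_cost_ge[of "c reg_size"] in auto)
qed

text \<open>Programs have no recursion. Prefix notation is parsed by a single loop whose stack lists
  the truth variables of the operands still to come; it is empty exactly when the formula has been
  read.\<close>

definition Formula :: prog where
  "Formula = While_nonempty 2 Node"

text \<open>What a node may rely on when it starts. The registers required to be zero are those that
  the evaluation of polynomials expects cleared; the others are bounded so that overwriting them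
  costs at most one unit.\<close>

definition idle :: "(nat \<Rightarrow> nat) \<Rightarrow> bool" where
  "idle c \<longleftrightarrow> clean c \<and> c reg_pow = 0 \<and> c reg_mon = 0 \<and> c reg_var = 0 \<and> c reg_base = 0 \<and>
     c reg_fresh \<le> c reg_size \<and> c reg_sum \<le> c reg_size \<and> c reg_node \<le> c reg_size \<and>
     c reg_a \<le> c reg_size \<and> c reg_b \<le> c reg_size \<and> c reg_c \<le> c reg_size \<and> c reg_d \<le> c reg_size"

lemma run_Eval_polynomial_idle:
  assumes "idle c" "c reg_fresh = f" "polynomial_in m p" "m \<le> f" "w 0 = enc_polynomial p @ rest" "terms_end p f < c reg_size"
  shows "run Eval_polynomial (c, w, v) (20 * unit_cost (c reg_size) * length (enc_polynomial p))
    (c(reg_sum := terms_end p f, reg_fresh := Suc (terms_end p f)), w(0 := rest, 1 := rev (enc_polynomial p) @ w 1),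
     v @ enc_gates (c reg_size) (poly_gates p 0 f))"
  using run_Eval_polynomial[of c w p rest m f v] assms terms_end_ge[of f p] by (simp add: idle_def)

text \<open>The final registers are only asserted to exist: the next node depends on
  \<open>idle\<close>, the number of variables and the next fresh variable, and on nothing else that
  the atom has left behind.\<close>

definition reads_atom :: "nat \<Rightarrow> prog \<Rightarrow> polynomial \<Rightarrow> qf_formula \<Rightarrow> bool" where
  "reads_atom m P p \<phi> \<longleftrightarrow> (\<forall>c w v f rest. idle c \<longrightarrow> c reg_node < f \<longrightarrow> c reg_fresh = f \<longrightarrow> m \<le> f \<longrightarrow>
     w 0 = enc_polynomial p @ rest \<longrightarrow> form_end \<phi> f \<le> c reg_size \<longrightarrow>
     (\<exists>c'. idle c' \<and> c' reg_size = c reg_size \<and> c' reg_fresh = form_end \<phi> f \<and>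
        run P (c, w, v) (40 * unit_cost (c reg_size) * length (enc_polynomial p))
        (c', w(0 := rest, 1 := rev (enc_polynomial p) @ w 1), v @ enc_gates (c reg_size) (form_gates \<phi> (c reg_node) f))))"

lemma length_enc_polynomial_Suc: "length (enc_polynomial p) = Suc (length (enc_terms p))"
  by (simp add: enc_polynomial_eq)

lemma reads_Eq_node:
  assumes "polynomial_in m p"
  shows "reads_atom m Eq_node p (EqZero p)"
  unfolding reads_atom_def
proof (intro allI impI, goal_cases)
  case (1 c w v f rest)
  let ?s = "terms_end p f"
  note idle = 1(1)[unfolded idle_def]
  show ?case
    apply (intro exI[of _ "c(reg_sum := ?s, reg_fresh := ?s + 2)"] conjI)
    apply (use 1 idle terms_end_ge[of f p] in \<open>simp_all add: idle_def\<close>)[3]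
    unfolding Eq_node_def
    apply (rule run_conv, rule run_Seq, rule run_Eval_polynomial_idle, rule 1(1), rule 1(3), rule assms, rule 1(4), rule 1(5))
    apply (use 1 in simp)
    apply (rule run_Zero_test, (use 1 idle terms_end_ge[of f p] in simp_all)[6])
    using unit_cost_ge[of "c reg_size"] by (auto simp: fun_eq_iff Let_def length_enc_polynomial_Suc)
qed

lemma reads_Gt_node:
  assumes "polynomial_in m p"
  shows "reads_atom m Gt_node p (GtZero p)"
  unfolding reads_atom_def
proof (intro allI impI, goal_cases)
  case (1 c w v f rest)
  define s where "s = terms_end p f"
  note fold = s_def[symmetric]
  note idle = 1(1)[unfolded idle_def]
  have fs: "f \<le> s" unfolding s_def by (rule terms_end_ge)
  have num: "Suc (Suc (Suc s)) = s + 3" "Suc (s + 3) = s + 4" "Suc (s + 4) = s + 5" "Suc (s + 5) = s + 6"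
    "Suc (s + 6) = s + 7" by simp_all
  show ?case
    apply (intro exI[of _ "c(reg_sum := s, reg_a := s + 1, reg_b := s + 2, reg_c := s + 4, reg_d := s + 5, reg_fresh := s + 7)"] conjI)
    apply (use 1 idle fs in \<open>simp_all add: idle_def fold\<close>)[3]
    unfolding Gt_node_def
    apply (rule run_conv, rule run_Seq, rule run_Eval_polynomial_idle, rule 1(1), rule 1(3), rule assms, rule 1(4), rule 1(5))
    apply (use 1 in simp)
    apply (rule run_Seq, rule run_Abs_value[where s = s], (use 1 idle fs in \<open>simp_all add: fold\<close>)[6])
    apply (rule run_intros | use 1 idle fs in \<open>simp add: fold; fail\<close>)+
    apply (rule run_Zero_test, (use 1 idle fs in \<open>simp_all add: fold\<close>)[6])
    apply (rule run_Gate, (use 1 idle fs in \<open>simp_all add: fold\<close>)[8])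
    using unit_cost_ge[of "c reg_size"]
    by (auto simp: fun_eq_iff Let_def fold length_enc_polynomial_Suc enc_gates_Cons[of _ _ "_ @ _"] num)
qed

lemma reads_Ge_node:
  assumes "polynomial_in m p"
  shows "reads_atom m Ge_node p (GeZero p)"
  unfolding reads_atom_def
proof (intro allI impI, goal_cases)
  case (1 c w v f rest)
  define s where "s = terms_end p f"
  note fold = s_def[symmetric]
  note idle = 1(1)[unfolded idle_def]
  have fs: "f \<le> s" unfolding s_def by (rule terms_end_ge)
  have num: "Suc (Suc (Suc s)) = s + 3" "Suc (s + 3) = s + 4" "Suc (s + 4) = s + 5" "Suc (s + 5) = s + 6" by simp_all
  show ?case
    apply (intro exI[of _ "c(reg_sum := s, reg_a := s + 1, reg_b := s + 2, reg_c := s + 4, reg_fresh := s + 6)"] conjI)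
    apply (use 1 idle fs in \<open>simp_all add: idle_def fold\<close>)[3]
    unfolding Ge_node_def
    apply (rule run_conv, rule run_Seq, rule run_Eval_polynomial_idle, rule 1(1), rule 1(3), rule assms, rule 1(4), rule 1(5))
    apply (use 1 in simp)
    apply (rule run_Seq, rule run_Abs_value[where s = s], (use 1 idle fs in \<open>simp_all add: fold\<close>)[6])
    apply (rule run_intros | use 1 idle fs in \<open>simp add: fold; fail\<close>)+
    apply (rule run_Zero_test, (use 1 idle fs in \<open>simp_all add: fold\<close>)[6])
    using unit_cost_ge[of "c reg_size"]
    by (auto simp: fun_eq_iff Let_def fold length_enc_polynomial_Suc enc_gates_Cons[of _ _ "zero_test _ _ _"] num)
qed


lemma run_Neg_node:
  assumes "clean c" "c reg_node < f" "c reg_fresh = f" "f < c reg_size"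
  shows "run Neg_node (c, w, v) (3 * unit_cost (c reg_size))
    (c(reg_fresh := f + 1), w(2 := enc_unary f @ w 2), v @ enc_gates (c reg_size) [(gate_not, c reg_node, f, f)])"
  unfolding Neg_node_def
  apply (rule run_conv, rule run_Seq, rule run_Gate, (use assms in simp_all)[8])
  apply (rule run_Seq, rule run_Push_index, (use assms in simp_all)[3], rule run_Inc)
  using assms unit_cost_ge[of "c reg_size"] by (auto simp: fun_eq_iff)

lemma run_Binary_node:
  assumes "q \<in> set gate_polys" "clean c" "c reg_node < f" "c reg_fresh = f" "f + 2 \<le> c reg_size"
    "c reg_a \<le> c reg_size" "c reg_b \<le> c reg_size"
  shows "run (Binary_node q) (c, w, v) (6 * unit_cost (c reg_size))
    (c(reg_a := f, reg_b := f + 1, reg_fresh := f + 2), w(2 := enc_unary f @ enc_unary (f + 1) @ w 2),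
     v @ enc_gates (c reg_size) [(q, c reg_node, f, f + 1)])"
  unfolding Binary_node_def
  apply (rule run_conv)
  apply (rule run_intros | use assms in \<open>simp; fail\<close>)+
  apply (rule run_Push_index, (use assms in simp_all)[3])
  apply (rule run_Push_index, (use assms in simp_all)[3])
  using assms unit_cost_ge[of "c reg_size"] by (auto simp: fun_eq_iff)

lemma run_Formula_step:
  assumes "w 2 = enc_unary i @ stk" "i \<le> c reg_size" "c reg_node \<le> c reg_size" "w 0 = a # b # d # xs"
    and "run (node_prog a b d) (c(reg_node := i), w(0 := xs, 1 := [d, b, a] @ w 1, 2 := stk), v) t s'"
    and "run Formula s' t' s"
  shows "run Formula (c, w, v) (t + t' + 3 * unit_cost (c reg_size)) s"
  unfolding Formula_def
  apply (rule run_conv, rule run_While_nonempty_step)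
  apply (use assms(1) in \<open>simp add: enc_unary_def\<close>)
  apply (rule run_Node, rule assms(1), rule assms(2), rule assms(3), rule assms(4), rule assms(5))
  apply (rule assms(6)[unfolded Formula_def])
  using unit_cost_ge[of "c reg_size"] by auto

text \<open>Stated with a continuation, because a subformula takes several rounds of one and the
  same loop and is not a run of a program of its own: every run of the loop from behind the
  subformula yields one from its beginning, at 50 units per input bit.\<close>

definition reads_formula :: "nat \<Rightarrow> qf_formula \<Rightarrow> bool" where
  "reads_formula m \<phi> \<longleftrightarrow> (\<forall>c w v i f rest stk. idle c \<longrightarrow> w 0 = enc_formula \<phi> @ rest \<longrightarrow> w 2 = enc_unary i @ stk \<longrightarrow>
    c reg_fresh = f \<longrightarrow> i < f \<longrightarrow> m \<le> f \<longrightarrow> form_end \<phi> f \<le> c reg_size \<longrightarrow>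
    (\<exists>c'. idle c' \<and> c' reg_size = c reg_size \<and> c' reg_fresh = form_end \<phi> f \<and>
      (\<forall>t s. run Formula (c', w(0 := rest, 1 := rev (enc_formula \<phi>) @ w 1, 2 := stk),
           v @ enc_gates (c reg_size) (form_gates \<phi> i f)) t s \<longrightarrow>
         run Formula (c, w, v) (50 * unit_cost (c reg_size) * length (enc_formula \<phi>) + t) s)))"

lemma reads_formulaD:
  assumes "reads_formula m \<phi>" "idle c" "w 0 = enc_formula \<phi> @ rest" "w 2 = enc_unary i @ stk" "c reg_fresh = f" "i < f"
    "m \<le> f" "form_end \<phi> f \<le> c reg_size"
  obtains c' where "idle c'" "c' reg_size = c reg_size" "c' reg_fresh = form_end \<phi> f"
    "\<And>t s. run Formula (c', w(0 := rest, 1 := rev (enc_formula \<phi>) @ w 1, 2 := stk),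
         v @ enc_gates (c reg_size) (form_gates \<phi> i f)) t s \<Longrightarrow>
       run Formula (c, w, v) (50 * unit_cost (c reg_size) * length (enc_formula \<phi>) + t) s"
proof -
  from assms(1)[unfolded reads_formula_def, rule_format, where v = v, OF assms(2-8)] show thesis
    using that by blast
qed

lemma idle_node: "idle c \<Longrightarrow> i \<le> c reg_size \<Longrightarrow> idle (c(reg_node := i))"
  by (simp add: idle_def)

lemma reads_formula_atom:
  assumes "reads_atom m (node_prog a b d) p \<phi>" and enc: "enc_formula \<phi> = [a, b, d] @ enc_polynomial p"
  shows "reads_formula m \<phi>"
  unfolding reads_formula_def
proof (intro allI impI, goal_cases)
  case (1 c w v i f rest stk)
  let ?w = "w(0 := enc_polynomial p @ rest, 1 := [d, b, a] @ w 1, 2 := stk)"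
  let ?c = "c(reg_node := i)"
  have iN: "i \<le> c reg_size" using 1 form_end_ge[of f \<phi>] by simp
  have idle: "idle ?c" using 1(1) iN by (rule idle_node)
  have "\<exists>c'. idle c' \<and> c' reg_size = ?c reg_size \<and> c' reg_fresh = form_end \<phi> f \<and>
        run (node_prog a b d) (?c, ?w, v) (40 * unit_cost (?c reg_size) * length (enc_polynomial p))
        (c', ?w(0 := rest, 1 := rev (enc_polynomial p) @ ?w 1), v @ enc_gates (?c reg_size) (form_gates \<phi> (?c reg_node) f))"
    by (rule assms(1)[unfolded reads_atom_def, rule_format, OF idle]) (use 1 in simp_all)
  then obtain c' where c': "idle c'" "c' reg_size = c reg_size" "c' reg_fresh = form_end \<phi> f" and
    node: "run (node_prog a b d) (?c, ?w, v) (40 * unit_cost (c reg_size) * length (enc_polynomial p))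
        (c', ?w(0 := rest, 1 := rev (enc_polynomial p) @ ?w 1), v @ enc_gates (c reg_size) (form_gates \<phi> i f))"
    by (simp del: node_prog.simps) blast
  have w_eq: "?w(0 := rest, 1 := rev (enc_polynomial p) @ ?w 1) = w(0 := rest, 1 := rev (enc_formula \<phi>) @ w 1, 2 := stk)"
    by (auto simp: fun_eq_iff enc)
  show ?case
  proof (intro exI[of _ c'] conjI allI impI, goal_cases)
    case (4 t s)
    show ?case
      apply (rule run_conv, rule run_Formula_step, rule 1(3), rule iN, use 1(1) in \<open>simp add: idle_def\<close>)
      apply (use 1(2) enc in simp)
      apply (rule node, rule 4[folded w_eq])
      by (auto simp: enc)
  qed (use c' in auto)
qed

lemma reads_Neg:
  assumes "reads_formula m \<phi>"
  shows "reads_formula m (Neg \<phi>)"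
  unfolding reads_formula_def
proof (intro allI impI, goal_cases)
  case a: (1 c w v i f rest stk)
  let ?w = "w(0 := enc_formula \<phi> @ rest, 1 := [True, True, False] @ w 1, 2 := stk)"
  let ?w1 = "?w(2 := enc_unary f @ ?w 2)"
  let ?c = "c(reg_node := i, reg_fresh := f + 1)"
  let ?v = "v @ enc_gates (c reg_size) [(gate_not, i, f, f)]"
  let ?u = "unit_cost (c reg_size)"
  have f: "f + 1 \<le> c reg_size" using form_end_ge[of "f + 1" \<phi>] a by simp
  have node: "run (node_prog False True True) (c(reg_node := i), ?w, v) (3 * ?u) (?c, ?w1, ?v)"
    using run_Neg_node[of "c(reg_node := i)" f ?w v] a f by (simp add: idle_def)
  have idle: "idle ?c" using a f by (simp add: idle_def)
  obtain c' where c': "idle c'" "c' reg_size = ?c reg_size" "c' reg_fresh = form_end \<phi> (f + 1)"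
    and further: "\<And>t s. run Formula (c', ?w1(0 := rest, 1 := rev (enc_formula \<phi>) @ ?w1 1, 2 := stk),
         ?v @ enc_gates (?c reg_size) (form_gates \<phi> f (f + 1))) t s \<Longrightarrow>
       run Formula (?c, ?w1, ?v) (50 * unit_cost (?c reg_size) * length (enc_formula \<phi>) + t) s"
    by (rule reads_formulaD[OF assms idle, of ?w1 rest f stk "f + 1" ?v]) (use a in auto)
  have w_eq: "?w1(0 := rest, 1 := rev (enc_formula \<phi>) @ ?w1 1, 2 := stk) =
      w(0 := rest, 1 := rev (enc_formula (Neg \<phi>)) @ w 1, 2 := stk)"
    by (auto simp: fun_eq_iff)
  have v_eq: "?v @ enc_gates (?c reg_size) (form_gates \<phi> f (f + 1)) = v @ enc_gates (c reg_size) (form_gates (Neg \<phi>) i f)"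
    by (simp add: enc_gates_Cons[of _ _ "form_gates _ _ _"])
  show ?case
  proof (intro exI[of _ c'] conjI allI impI, goal_cases)
    case (4 t s)
    have *: "run Formula (?c, ?w1, ?v) (50 * unit_cost (?c reg_size) * length (enc_formula \<phi>) + t) s"
      by (rule further) (use 4 in \<open>simp only: w_eq v_eq\<close>)
    show ?case
      apply (rule run_conv, rule run_Formula_step[OF a(3) _ _ _ node *])
      using a f by (auto simp: idle_def algebra_simps)
  qed (use c' in auto)
qed

lemma reads_binary:
  assumes "reads_formula m \<phi>" "reads_formula m \<psi>" "q \<in> set gate_polys" "node_prog True False d = Binary_node q"
    and enc: "enc_formula \<chi> = [True, False, d] @ enc_formula \<phi> @ enc_formula \<psi>"
    and gates: "\<And>i f. form_gates \<chi> i f = (q, i, f, f + 1) #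
      form_gates \<phi> f (f + 2) @ form_gates \<psi> (f + 1) (form_end \<phi> (f + 2))"
    and fin: "\<And>f. form_end \<chi> f = form_end \<psi> (form_end \<phi> (f + 2))"
  shows "reads_formula m \<chi>"
  unfolding reads_formula_def
proof (intro allI impI, goal_cases)
  case a: (1 c w v i f rest stk)
  let ?e = "form_end \<phi> (f + 2)"
  let ?w = "w(0 := (enc_formula \<phi> @ enc_formula \<psi>) @ rest, 1 := [d, False, True] @ w 1, 2 := stk)"
  let ?w1 = "?w(2 := enc_unary f @ enc_unary (f + 1) @ ?w 2)"
  let ?w2 = "?w1(0 := enc_formula \<psi> @ rest, 1 := rev (enc_formula \<phi>) @ ?w1 1, 2 := enc_unary (f + 1) @ stk)"
  let ?c = "c(reg_node := i, reg_a := f, reg_b := f + 1, reg_fresh := f + 2)"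
  let ?v = "v @ enc_gates (c reg_size) [(q, i, f, f + 1)]"
  let ?v1 = "?v @ enc_gates (?c reg_size) (form_gates \<phi> f (f + 2))"
  let ?u = "unit_cost (c reg_size)"
  have e: "f + 2 \<le> ?e" "?e \<le> form_end \<psi> ?e" by (rule form_end_ge)+
  then have f: "f + 2 \<le> c reg_size" "?e \<le> c reg_size" using a(7) fin by simp_all
  have node: "run (node_prog True False d) (c(reg_node := i), ?w, v) (6 * ?u) (?c, ?w1, ?v)"
    unfolding assms(4) using run_Binary_node[of q "c(reg_node := i)" f ?w v] a f assms(3) by (simp add: idle_def)
  have idle: "idle ?c" using a f by (simp add: idle_def)
  \<comment> \<open>For the left operand, the text and the index of the right operand count as part
    of the remaining input and of the remaining stack.\<close>
  obtain c1 where c1: "idle c1" "c1 reg_size = ?c reg_size" "c1 reg_fresh = ?e"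
    and further1: "\<And>t s. run Formula (c1, ?w2, ?v1) t s \<Longrightarrow>
       run Formula (?c, ?w1, ?v) (50 * unit_cost (?c reg_size) * length (enc_formula \<phi>) + t) s"
    by (rule reads_formulaD[OF assms(1) idle, of ?w1 "enc_formula \<psi> @ rest" f "enc_unary (f + 1) @ stk" "f + 2" ?v])
      (use a f in auto)
  obtain c2 where c2: "idle c2" "c2 reg_size = c1 reg_size" "c2 reg_fresh = form_end \<psi> ?e"
    and further2: "\<And>t s. run Formula (c2, ?w2(0 := rest, 1 := rev (enc_formula \<psi>) @ ?w2 1, 2 := stk),
        ?v1 @ enc_gates (c1 reg_size) (form_gates \<psi> (f + 1) ?e)) t s \<Longrightarrow>
       run Formula (c1, ?w2, ?v1) (50 * unit_cost (c1 reg_size) * length (enc_formula \<psi>) + t) s"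
    by (rule reads_formulaD[OF assms(2) c1(1), of ?w2 rest "f + 1" stk ?e ?v1])
      (use a f c1 e fin in auto)
  have w_eq: "?w2(0 := rest, 1 := rev (enc_formula \<psi>) @ ?w2 1, 2 := stk) =
      w(0 := rest, 1 := rev (enc_formula \<chi>) @ w 1, 2 := stk)"
    by (auto simp: fun_eq_iff enc)
  have v_eq: "?v1 @ enc_gates (c1 reg_size) (form_gates \<psi> (f + 1) ?e) = v @ enc_gates (c reg_size) (form_gates \<chi> i f)"
    using c1 by (simp add: gates enc_gates_Cons[of _ _ "_ @ _"])
  show ?case
  proof (intro exI[of _ c2] conjI allI impI, goal_cases)
    case (4 t s)
    have *: "run Formula (?c, ?w1, ?v) (50 * unit_cost (?c reg_size) * length (enc_formula \<phi>) +
        (50 * unit_cost (c1 reg_size) * length (enc_formula \<psi>) + t)) s"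
      by (rule further1, rule further2) (use 4 in \<open>simp only: w_eq v_eq\<close>)
    show ?case
      apply (rule run_conv, rule run_Formula_step[OF a(3) _ _ _ node *])
      using a f c1 by (auto simp: idle_def enc algebra_simps)
  qed (use c1 c2 fin in auto)
qed

lemma reads_formula: "formula_in m \<phi> \<Longrightarrow> reads_formula m \<phi>"
proof (induction \<phi>)
  case (EqZero p)
  then show ?case
    using reads_formula_atom[of m False False False p] reads_Eq_node[of m p] by simp
next
  case (GtZero p)
  then show ?case
    using reads_formula_atom[of m False False True p] reads_Gt_node[of m p] by simp
next
  case (GeZero p)
  then show ?case
    using reads_formula_atom[of m False True False p] reads_Ge_node[of m p] by simp
next
  case (Neg \<phi>)
  then show ?case by (simp add: reads_Neg)
next
  case (Conj \<phi> \<psi>)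
  then show ?case by - (rule reads_binary[where q = gate_mult and d = False and \<phi> = \<phi> and \<psi> = \<psi>], auto)
next
  case (Disj \<phi> \<psi>)
  then show ?case by - (rule reads_binary[where q = gate_or and d = True and \<phi> = \<phi> and \<psi> = \<psi>], auto)
qed


section \<open>The reduction of the existential theory of the reals to clustering\<close>

lemma poly_reducibleI:
  assumes "\<And>x. x \<in> instances A \<Longrightarrow> f x \<in> instances B"
    and "\<And>x. x \<in> instances A \<Longrightarrow> yes A x \<longleftrightarrow> yes B (f x)"
    and "\<And>x. x \<in> instances A \<Longrightarrow> \<exists>c w. run P (\<lambda>_. 0, (\<lambda>_. [])(0 := encode A x), [])
        (poly p (length (encode A x))) (c, w, encode B (f x))"
  shows "A \<le>\<^sub>p B"
proof -
  have "computes_within (tm_of P) (encode A x) (encode B (f x)) (poly p (length (encode A x)))"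
    if x: "x \<in> instances A" for x
  proof -
    have "stacks (\<lambda>_. 0) ((\<lambda>_. [])(0 := encode A x)) = (\<lambda>_. [])(0 := encode A x)"
      by (auto simp: stacks_def fun_eq_iff)
    with assms(3)[OF x] show ?thesis by (auto simp: run.simps intro: exec_computes)
  qed
  with assms(1,2) show ?thesis
    unfolding poly_reducible_def by (intro exI[of _ f] exI[of _ "tm_of P"] exI[of _ p]) (simp add: wf_tm_of)
qed

section \<open>Fixing the number of variables in advance\<close>

primrec Add :: "nat \<Rightarrow> nat \<Rightarrow> prog" where
  "Add r 0 = Skip"
| "Add r (Suc k) = (Inc r ;; Add r k)"

lemma run_Add: "run (Add r k) (c, w, v) (2 * k) (c(r := c r + k), w, v)"
proof (induction k arbitrary: c)
  case (Suc k)
  show ?case unfolding Add.simps by (rule run_conv, rule run_Seq, rule run_Inc, rule Suc) auto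
qed (simp add: run_Skip)

text \<open>The body may be started in any state that differs from \<open>c\<close> in the counters
  \<open>r\<close>, \<open>a\<close>, \<open>t\<close> only. This makes nested loops, and hence
  products, accessible one level at a time.\<close>

lemma run_For_add:
  assumes "a \<noteq> t" "r \<noteq> a" "r \<noteq> t" "c t = 0"
    and "\<And>c'. (\<And>x. x \<notin> {r, a, t} \<Longrightarrow> c' x = c x) \<Longrightarrow> run P (c', w, v) u (c'(r := c' r + k), w, v)"
  shows "run (For a t P) (c, w, v) (c a * (u + 8) + 2) (c(r := c r + c a * k), w, v)"
proof -
  have "run (For a t P) (c(r := c r + 0 * k), w, v) (c a * (u + 8) + 2) (c(r := c r + c a * k, a := c a, t := 0), w, v)"
    by (rule run_For[where c = "\<lambda>j. c(r := c r + j * k)" and w = "\<lambda>_. w" and v = "\<lambda>_. v"])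
      (use assms in \<open>auto intro!: run_conv[OF assms(5)] simp: fun_eq_iff split: if_splits\<close>)
  then show ?thesis by (rule run_conv[OF run_pre]) (use assms in \<open>auto simp: fun_eq_iff\<close>)
qed

abbreviation (input) reg_len :: nat where "reg_len \<equiv> 17"

text \<open>Reading moves the input, reversed, to word \<open>1\<close>; moving it back reverses it
  again, so the input is intact once its length is known.\<close>

definition Count :: prog where
  "Count = (While_nonempty 0 (Read ;; Inc reg_len) ;; Move_word 1 0)"

lemma run_Count:
  assumes "w 1 = []"
  shows "run Count (c, w, v) (20 * length (w 0) + 2) (c(reg_len := c reg_len + length (w 0)), w, v)"
proof -
  have loop: "run (While_nonempty 0 (Read ;; Inc reg_len)) (c, w, v) (7 * length (w 0) + 1)
    (c(reg_len := c reg_len + length (w 0)), w(0 := [], 1 := rev (w 0) @ w 1), v)" for c w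
  proof (induction "w 0" arbitrary: c w)
    case Nil
    then show ?case by (intro run_conv[OF run_While_nonempty_done]) (auto simp: fun_eq_iff)
  next
    case (Cons b xs)
    have w0: "w 0 = b # xs" using Cons(2) by simp
    show ?case
      apply (rule run_conv, rule run_While_nonempty_step, use w0 in simp)
      apply (rule run_Seq, rule run_Read, use w0 in simp, rule run_Inc)
      apply (rule Cons(1), use w0 in simp)
      using w0 by (auto simp: fun_eq_iff)
  qed
  show ?thesis
    unfolding Count_def
    by (rule run_conv, rule run_Seq, rule loop, rule run_Move_word) (use assms in \<open>auto simp: fun_eq_iff\<close>)
qed

text \<open>
  For an input of length \<open>L\<close> the output has \<open>12 L\<^sup>3\<close> variables; the first \<open>L\<^sup>2\<close> are set aside for the
  variables of the input.
\<close>

definition Prologue :: prog where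
  "Prologue = (Count ;; Copy reg_len 18 ;; Copy reg_len 19 ;;
     For reg_len 20 (For 18 21 (For 19 22 (Add reg_size 12))) ;;
     For reg_len 20 (For 18 21 (Add reg_fresh 1)) ;;
     For reg_size 4 (Out True) ;; Out False)"

definition start :: "nat \<Rightarrow> nat \<Rightarrow> nat" where
  "start L = (\<lambda>_. 0)(reg_size := 12 * L ^ 3, reg_fresh := L ^ 2, reg_len := L, 18 := L, 19 := L)"

lemma run_Prologue:
  assumes "length xs = L"
  shows "run Prologue (\<lambda>_. 0, (\<lambda>_. [])(0 := xs), []) (1000 * (L + 1) ^ 3)
    (start L, (\<lambda>_. [])(0 := xs), enc_unary (12 * L ^ 3))"
proof -
  let ?w = "(\<lambda>_. [])(0 := xs) :: nat \<Rightarrow> bool list"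
  let ?c = "(\<lambda>_. 0)(reg_len := L, 18 := L, 19 := L) :: nat \<Rightarrow> nat"
  let ?d = "?c(reg_size := 12 * L ^ 3)"
  have cube: "run (For reg_len 20 (For 18 21 (For 19 22 (Add reg_size 12)))) (?c, ?w, [])
      (L * ((L * ((L * (24 + 8) + 2) + 8) + 2) + 8) + 2) (?d, ?w, [])"
  proof -
    have "run (For reg_len 20 (For 18 21 (For 19 22 (Add reg_size 12)))) (?c, ?w, [])
      (?c reg_len * ((L * ((L * (24 + 8) + 2) + 8) + 2) + 8) + 2) (?c(reg_size := ?c reg_size + ?c reg_len * (L * (L * 12))), ?w, [])"
    proof (rule run_For_add, simp, simp, simp, simp)
      fix c assume c: "\<And>x. x \<notin> {reg_size, reg_len, 20} \<Longrightarrow> c x = ?c x"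
      have "run (For 18 21 (For 19 22 (Add reg_size 12))) (c, ?w, [])
        (c 18 * ((L * (24 + 8) + 2) + 8) + 2) (c(reg_size := c reg_size + c 18 * (L * 12)), ?w, [])"
      proof (rule run_For_add, simp, simp, simp, use c[of 21] in simp)
        fix c' assume c': "\<And>x. x \<notin> {reg_size, 18, 21} \<Longrightarrow> c' x = c x"
        have "run (For 19 22 (Add reg_size 12)) (c', ?w, [])
          (c' 19 * (24 + 8) + 2) (c'(reg_size := c' reg_size + c' 19 * 12), ?w, [])"
          by (rule run_For_add) (use c[of 22] c'[of 22] run_Add[of reg_size 12] in simp_all)
        then show "run (For 19 22 (Add reg_size 12)) (c', ?w, [])
          (L * (24 + 8) + 2) (c'(reg_size := c' reg_size + L * 12), ?w, [])"
          using c[of 19] c'[of 19] by simp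
      qed
      then show "run (For 18 21 (For 19 22 (Add reg_size 12))) (c, ?w, [])
        (L * ((L * (24 + 8) + 2) + 8) + 2) (c(reg_size := c reg_size + L * (L * 12)), ?w, [])"
        using c[of 18] by simp
    qed
    then show ?thesis by (rule run_conv) (auto simp: fun_eq_iff power3_eq_cube)
  qed
  have square: "run (For reg_len 20 (For 18 21 (Add reg_fresh 1))) (?d, ?w, [])
      (L * ((L * (2 + 8) + 2) + 8) + 2) (start L, ?w, [])"
  proof -
    have "run (For reg_len 20 (For 18 21 (Add reg_fresh 1))) (?d, ?w, [])
      (?d reg_len * ((L * (2 + 8) + 2) + 8) + 2) (?d(reg_fresh := ?d reg_fresh + ?d reg_len * (L * 1)), ?w, [])"
    proof (rule run_For_add, simp, simp, simp, simp)
      fix c assume c: "\<And>x. x \<notin> {reg_fresh, reg_len, 20} \<Longrightarrow> c x = ?d x"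
      have "run (For 18 21 (Add reg_fresh 1)) (c, ?w, [])
        (c 18 * (2 + 8) + 2) (c(reg_fresh := c reg_fresh + c 18 * 1), ?w, [])"
        by (rule run_For_add) (use c[of 21] run_conv[OF run_Add[of reg_fresh 1]] in simp_all)
      then show "run (For 18 21 (Add reg_fresh 1)) (c, ?w, [])
        (L * (2 + 8) + 2) (c(reg_fresh := c reg_fresh + L * 1), ?w, [])"
        using c[of 18] by simp
    qed
    then show ?thesis by (rule run_conv) (auto simp: fun_eq_iff power2_eq_square start_def)
  qed
  let ?N = "12 * L ^ 3"
  have "run (For reg_size 4 (Out True)) (start L, ?w, replicate 0 True) (?N * (1 + 8) + 2)
      ((start L)(reg_size := ?N, 4 := 0), ?w, replicate ?N True)"
    by (rule run_For[where c = "\<lambda>_. start L" and w = "\<lambda>_. ?w" and v = "\<lambda>j. replicate j True"])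
      (auto simp: start_def intro!: run_conv[OF run_Out] simp: replicate_append_same)
  then have dims: "run (For reg_size 4 (Out True)) (start L, ?w, []) (?N * (1 + 8) + 2)
      ((start L)(reg_size := ?N, 4 := 0), ?w, replicate ?N True)" by simp
  have "(start L)(reg_size := ?N, 4 := 0) = start L" by (auto simp: start_def fun_eq_iff)
  note dims = dims[unfolded this]
  show ?thesis
    unfolding Prologue_def
    apply (rule run_conv)
    apply (rule run_Seq, rule run_Count, simp)
    apply (rule run_Seq, rule run_Copy, (simp_all)[4])
    apply (rule run_Seq, rule run_Copy, (simp_all)[4])
    apply (rule run_Seq, rule run_pre, rule cube, simp add: assms)
    apply (rule run_Seq, rule square)
    apply (rule run_Seq, rule dims)
    apply (rule run_Out)
    using assms by (auto simp: enc_unary_def power3_eq_cube algebra_simps)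
qed

definition Zero_monomial :: "int \<Rightarrow> prog" where
  "Zero_monomial k = (Outs (True # enc_int k) ;; For reg_size 4 (Out True ;; Out False) ;; Out False)"

lemma enc_list_replicate: "enc_list e (replicate n x) = concat (replicate n (True # e x)) @ [False]"
  by (induction n) auto

lemma concat_replicate_snoc: "concat (replicate n xs) @ xs = xs @ concat (replicate n xs)"
  by (induction n) auto

lemma run_Zero_monomial:
  assumes "clean c"
  shows "run (Zero_monomial k) (c, w, v) (unit_cost (c reg_size) + length (enc_int k))
    (c, w, v @ enc_terms [zero_monomial k (c reg_size)])"
proof -
  let ?v = "v @ True # enc_int k"
  have "run (For reg_size 4 (Out True ;; Out False)) (c, w, ?v @ concat (replicate 0 [True, False])) (c reg_size * (2 + 8) + 2)
      (c(reg_size := c reg_size, 4 := 0), w, ?v @ concat (replicate (c reg_size) [True, False]))"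
    by (rule run_For[where c = "\<lambda>_. c" and w = "\<lambda>_. w" and v = "\<lambda>j. ?v @ concat (replicate j [True, False])"])
      (use assms in \<open>auto dest: cleanD intro!: run_conv[OF run_Seq[OF run_Out run_Out]]
        simp: concat_replicate_snoc[of _ "[True, False]", symmetric, simplified]\<close>)
  then have loop: "run (For reg_size 4 (Out True ;; Out False)) (c, w, ?v) (c reg_size * (2 + 8) + 2)
      (c(reg_size := c reg_size, 4 := 0), w, ?v @ concat (replicate (c reg_size) [True, False]))" by simp
  show ?thesis
    unfolding Zero_monomial_def
    apply (rule run_conv, rule run_Seq, rule run_Outs, rule run_Seq, rule loop, rule run_Out)
    using unit_cost_ge[of "c reg_size"] cleanD(5)[OF assms]
    by (auto simp: zero_monomial_def enc_list_replicate enc_unary_def fun_eq_iff)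
qed

definition Read_unary :: "nat \<Rightarrow> prog" where
  "Read_unary r = (While_top 0 (Read ;; Inc r) ;; Read)"

lemma run_Read_unary:
  assumes "w 0 = enc_unary n @ rest"
  shows "run (Read_unary r) (c, w, v) (7 * (n + 1)) (c(r := c r + n), w(0 := rest, 1 := rev (enc_unary n) @ w 1), v)"
proof -
  have loop: "run (While_top 0 (Read ;; Inc r)) (c, w, v) (7 * n + 1)
     (c(r := c r + n), w(0 := False # rest, 1 := replicate n True @ w 1), v)"
    if "w 0 = replicate n True @ False # rest" for c w
    using that
  proof (induction n arbitrary: c w)
    case 0
    then show ?case by (intro run_conv[OF run_While_top_done]) (auto simp: fun_eq_iff)
  next
    case (Suc n)
    show ?case
      apply (rule run_conv, rule run_While_top_step, use Suc.prems in simp, use Suc.prems in simp)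
      apply (rule run_Seq, rule run_Read, use Suc.prems in simp, rule run_Inc)
      apply (rule Suc.IH)
      using Suc.prems by (auto simp: fun_eq_iff replicate_app_Cons_same)
  qed
  show ?thesis
    unfolding Read_unary_def
    by (rule run_conv, rule run_Seq, rule loop, use assms in \<open>simp add: enc_unary_def\<close>, rule run_Read)
      (auto simp: fun_eq_iff enc_unary_def)
qed

abbreviation (input) reg_dim :: nat where "reg_dim \<equiv> 23"

text \<open>The price of an elementary operation with \<open>12 L\<^sup>3\<close> variables, times a
  number of operations of order \<open>L\<^sup>3\<close>. One polynomial of degree six serves both
  reductions.\<close>

definition time_poly :: "nat poly" where
  "time_poly = [:2000 * gate_cost:] * ([:12:] * [:0, 1:] ^ 3 + 1) * [:1, 1:] ^ 3"

lemma poly_time_poly: "poly time_poly L = 2000 * unit_cost (12 * L ^ 3) * (L + 1) ^ 3"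
  by (simp add: time_poly_def unit_cost_def algebra_simps)

text \<open>The constant term 1 is there because the threshold must be positive. The separation
  could be any positive number, as one point has no partner to be separated from.\<close>

definition etr_to_cmrc :: "nat \<times> qf_formula \<Rightarrow> cmrc_instance" where
  "etr_to_cmrc x = (let L = length (encode ETR x); n = 12 * L ^ 3 in
     \<lparr> dimension = n, objective = zero_monomial 1 n # gates_terms n (etr_gates (L ^ 2) (snd x)),
       threshold = (1, 1), separation = (1, 1), num_points = 1 \<rparr>)"

text \<open>The number of variables of the sentence is read to step over it: these variables keep
  their indices, and fresh ones start at \<open>L\<^sup>2\<close>, which is at least that number.
  The \<open>False\<close> in the last output closes the list of monomials.\<close>

definition Etr_to_cmrc :: prog where
  "Etr_to_cmrc = (Prologue ;; Zero_monomial 1 ;; Read_unary reg_dim ;; Gate (gate_const 1) reg_fresh reg_fresh reg_fresh ;;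
     Push_index reg_fresh ;; Inc reg_fresh ;; Formula ;;
     Outs (False # enc_fraction (1, 1) @ enc_fraction (1, 1) @ enc_unary 1))"

text \<open>A formula needs fewer than two variables per input bit beyond the initial
  \<open>L\<^sup>2 + 1\<close>, which is far below the bound; the cubic demand is that of the
  converse reduction.\<close>

lemma etr_size:
  assumes "length (encode ETR (n, \<Phi>)) = L"
  shows "form_end \<Phi> (L ^ 2 + 1) \<le> 12 * L ^ 3" "n \<le> L ^ 2" "L \<ge> 1"
proof -
  have L: "L = n + 1 + length (enc_formula \<Phi>)" using assms by (simp add: ETR_def)
  have "L * 1 \<le> L * L" "L * L * 1 \<le> L * L * L" by (rule mult_le_mono2, use L in simp)+
  then show "form_end \<Phi> (L ^ 2 + 1) \<le> 12 * L ^ 3" "n \<le> L ^ 2" "L \<ge> 1"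
    using form_end_le[of \<Phi> "L ^ 2 + 1"] L by (auto simp: power2_eq_square power3_eq_cube)
qed

lemma run_Etr_to_cmrc:
  assumes "(n, \<Phi>) \<in> instances ETR"
  shows "\<exists>c w. run Etr_to_cmrc (\<lambda>_. 0, (\<lambda>_. [])(0 := encode ETR (n, \<Phi>)), [])
    (poly time_poly (length (encode ETR (n, \<Phi>)))) (c, w, encode CMRC (etr_to_cmrc (n, \<Phi>)))"
proof -
  define L where "L = length (encode ETR (n, \<Phi>))"
  define N where "N = 12 * L ^ 3"
  note size = etr_size[OF L_def[symmetric], folded N_def]
  have size': "L ^ 2 + 1 \<le> N" using size(1) form_end_ge[of "L ^ 2 + 1" \<Phi>] by simp
  have in\<Phi>: "formula_in n \<Phi>" using assms by (simp add: ETR_def)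
  have enc: "encode ETR (n, \<Phi>) = enc_unary n @ enc_formula \<Phi>" by (simp add: ETR_def)
  let ?w = "(\<lambda>_. [])(0 := encode ETR (n, \<Phi>)) :: nat \<Rightarrow> bool list"
  let ?w1 = "?w(0 := enc_formula \<Phi>, 1 := rev (enc_unary n))"
  let ?w2 = "?w1(2 := enc_unary (L ^ 2))"
  let ?c = "(start L)(reg_dim := n, reg_fresh := L ^ 2 + 1)"
  let ?v = "(enc_unary N @ enc_terms [zero_monomial 1 N]) @ enc_gates N [(gate_const 1, L ^ 2, L ^ 2, L ^ 2)]"
  have c: "start L reg_size = N" "start L reg_fresh = L ^ 2" "clean (start L)"
    by (auto simp: start_def N_def clean_def)
  have idle: "idle ?c" using size' c by (simp add: idle_def) (simp add: start_def)
  obtain c' where c': "idle c'" "c' reg_size = ?c reg_size" "c' reg_fresh = form_end \<Phi> (L ^ 2 + 1)"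
    and further: "\<And>t s. run Formula (c', ?w2(0 := [], 1 := rev (enc_formula \<Phi>) @ ?w2 1, 2 := []),
         ?v @ enc_gates (?c reg_size) (form_gates \<Phi> (L ^ 2) (L ^ 2 + 1))) t s \<Longrightarrow>
       run Formula (?c, ?w2, ?v) (50 * unit_cost (?c reg_size) * length (enc_formula \<Phi>) + t) s"
    by (rule reads_formulaD[OF reads_formula[OF in\<Phi>] idle, of ?w2 "[]" "L ^ 2" "[]" "L ^ 2 + 1" ?v])
      (use size c in auto)
  let ?w3 = "?w2(0 := [], 1 := rev (enc_formula \<Phi>) @ ?w2 1, 2 := [])"
  have fin: "run Formula (?c, ?w2, ?v) (50 * unit_cost (?c reg_size) * length (enc_formula \<Phi>) + 1)
    (c', ?w3, ?v @ enc_gates (?c reg_size) (form_gates \<Phi> (L ^ 2) (L ^ 2 + 1)))"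
    by (rule further, unfold Formula_def, rule run_While_nonempty_done) simp
  have len: "length (enc_formula \<Phi>) \<le> L" "n + 1 \<le> L" by (auto simp: L_def enc)
  let ?U = "unit_cost N"
  have cost: "1000 * (L + 1) ^ 3 + ((?U + length (enc_int 1)) + (7 * (n + 1) + (?U + (?U + (2 + ((50 * ?U * length (enc_formula \<Phi>) + 1) +
      length (False # enc_fraction (1, 1) @ enc_fraction (1, 1) @ enc_unary 1))))))) \<le> 2000 * ?U * (L + 1) ^ 3"
    (is "?lhs \<le> _")
  proof -
    have one: "length (enc_int 1) = 4" by (simp add: length_enc_int bits_of_nat.simps)
    have U: "100 \<le> ?U" using unit_cost_ge[of N] by simp
    have cube: "L + 1 \<le> (L + 1) ^ 3" using self_le_power[of "L + 1" 3] by simp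
    have mono: "?U * length (enc_formula \<Phi>) \<le> ?U * (L + 1) ^ 3" "100 * (L + 1) ^ 3 \<le> ?U * (L + 1) ^ 3"
      "?U * 1 \<le> ?U * (L + 1) ^ 3"
      using len cube U by (auto intro!: mult_le_mono)
    have assoc: "50 * ?U * length (enc_formula \<Phi>) = 50 * (?U * length (enc_formula \<Phi>))"
      "2000 * ?U * (L + 1) ^ 3 = 2000 * (?U * (L + 1) ^ 3)" by simp_all
    \<comment> \<open>With the nonlinear subterms replaced by variables, the estimate becomes linear
      arithmetic.\<close>
    have sum: "1000 * Y + ((u + 4) + (7 * k + (u + (u + (2 + ((50 * Z + 1) + Suc (4 + 4 + (4 + 4 + Suc 1)))))))) \<le> 2000 * X"
      if "Z \<le> X" "100 * Y \<le> X" "u \<le> X" "k \<le> Y" "1 \<le> Y" for X Y Z u k :: nat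
      using that by linarith
    show ?thesis
      unfolding assoc length_append length_Cons enc_fraction.simps one length_enc_unary
      by (rule sum) (use mono len cube in auto)
  qed
  have "run Etr_to_cmrc (\<lambda>_. 0, ?w, []) (2000 * ?U * (L + 1) ^ 3)
    (c', ?w3, (?v @ enc_gates (?c reg_size) (form_gates \<Phi> (L ^ 2) (L ^ 2 + 1))) @
       (False # enc_fraction (1, 1) @ enc_fraction (1, 1) @ enc_unary 1))"
    unfolding Etr_to_cmrc_def
    apply (rule run_conv)
    apply (rule run_Seq, rule run_Prologue, rule L_def[symmetric])
    apply (rule run_Seq, rule run_Zero_monomial, rule c)
    apply (rule run_Seq, rule run_Read_unary[where n = n and rest = "enc_formula \<Phi>"], simp add: enc)
    apply (rule run_Seq, rule run_Gate, (use c size' in simp_all)[8])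
    apply (rule run_Seq, rule run_Push_index, (use c size' in simp_all)[3])
    apply (rule run_Seq, rule run_Inc)
    apply (rule run_Seq, rule run_pre, rule fin, use c in \<open>simp add: N_def fun_eq_iff start_def\<close>)
    apply (rule run_Outs)
    using cost c by (simp_all add: N_def)
  moreover have "(?v @ enc_gates (?c reg_size) (form_gates \<Phi> (L ^ 2) (L ^ 2 + 1))) @
       (False # enc_fraction (1, 1) @ enc_fraction (1, 1) @ enc_unary 1) = encode CMRC (etr_to_cmrc (n, \<Phi>))"
    using c by (simp add: CMRC_def enc_cmrc_def etr_to_cmrc_def Let_def L_def[symmetric] N_def[symmetric]
      enc_polynomial_eq etr_gates_def enc_gates_def)
  ultimately show ?thesis unfolding poly_time_poly L_def[symmetric] N_def[symmetric] by auto
qed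

lemma ex_gates_value:
  assumes "gates_below n G"
  shows "(\<exists>x. eval_polynomial x (zero_monomial 1 n # gates_terms n G) \<ge> 1) \<longleftrightarrow> (\<exists>x. sat x G)"
  using eval_gates_terms(2)[OF assms] by (simp add: eval_polynomial_def)

theorem ER_hard_CMRC: "ER_hard CMRC"
  unfolding ER_hard_def
proof (rule poly_reducibleI[where f = etr_to_cmrc and P = Etr_to_cmrc and p = time_poly])
  fix x assume x: "x \<in> instances ETR"
  obtain n \<Phi> where [simp]: "x = (n, \<Phi>)" by (cases x)
  define L where "L = length (encode ETR x)"
  define N where "N = 12 * L ^ 3"
  note size = etr_size[of n \<Phi> L, folded N_def]
  have L: "length (encode ETR (n, \<Phi>)) = L" by (simp add: L_def)
  note size = size[OF L]
  have in\<Phi>: "formula_in n \<Phi>" using x by (simp add: ETR_def)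
  have below: "gates_below N (etr_gates (L ^ 2) \<Phi>)"
    by (rule gates_below_mono[OF etr_gates_below[OF in\<Phi> size(2)] size(1)])
  have N: "N \<ge> 1" using size(3) by (simp add: N_def)
  show "etr_to_cmrc x \<in> instances CMRC"
    using N polynomial_in_gates_terms[of N "etr_gates (L ^ 2) \<Phi>"]
    by (simp add: CMRC_def cmrc_valid_def etr_to_cmrc_def Let_def L N_def[symmetric] polynomial_in_def zero_monomial_def)
  have "yes CMRC (etr_to_cmrc x) \<longleftrightarrow> (\<exists>x. eval_polynomial x (zero_monomial 1 N # gates_terms N (etr_gates (L ^ 2) \<Phi>)) \<ge> 1)"
    by (auto simp: CMRC_def cmrc_yes_def etr_to_cmrc_def Let_def L N_def[symmetric])
  then show "yes ETR x \<longleftrightarrow> yes CMRC (etr_to_cmrc x)"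
    unfolding ex_gates_value[OF below] etr_gates_sat[OF in\<Phi> size(2)] by (simp add: ETR_def)
  show "\<exists>c w. run Etr_to_cmrc (\<lambda>_. 0, (\<lambda>_. [])(0 := encode ETR x), [])
        (poly time_poly (length (encode ETR x))) (c, w, encode CMRC (etr_to_cmrc x))"
    using run_Etr_to_cmrc[of n \<Phi>] x by simp
qed


section \<open>The reduction of clustering to the existential theory of the reals\<close>

text \<open>
  The \<open>l\<close>-th coordinate of the \<open>i\<close>-th point is the variable \<open>i d + l\<close>.  The variable \<open>t\<close> is the
  threshold and \<open>e\<close> the square of the separation; \<open>u\<close> is the first variable that may be used.
\<close>

definition dist_gates :: "nat \<Rightarrow> nat \<Rightarrow> nat \<Rightarrow> nat \<Rightarrow> gate list" where
  "dist_gates x y u d = concat (map (\<lambda>l.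
     [(gate_diff, u + 2 * l + 1, x + l, y + l), (gate_square, u + 2 * l + 2, u + 2 * l, u + 2 * l + 1)]) [0..<d])"

text \<open>The partial sums of squared differences sit at even offsets from \<open>u\<close> and
  the differences at odd ones. The last gate says that the squared distance is \<open>e\<close> plus
  a square, that is, at least \<open>e\<close>; with the root of the slack this takes
  \<open>2 * d + 2\<close> variables.\<close>

definition pair_gates :: "nat \<Rightarrow> nat \<Rightarrow> nat \<Rightarrow> nat \<Rightarrow> nat \<Rightarrow> gate list" where
  "pair_gates e d x y u = (gate_const 0, u, u, u) # dist_gates x y u d @
     [(gate_square, u + 2 * d, e, u + 2 * d + 1)]"

definition pairs_gates :: "nat \<Rightarrow> nat \<Rightarrow> nat \<Rightarrow> nat \<Rightarrow> nat \<Rightarrow> gate list" where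
  "pairs_gates e d x u n = concat (map (\<lambda>j. pair_gates e d x (j * d) (u + j * (2 * d + 2))) [0..<n])"

text \<open>A point is compared with the earlier points only; symmetry of the distance covers the
  other pairs. The variable after the value of the objective is the root of its excess over the
  threshold.\<close>

definition point_gates :: "polynomial \<Rightarrow> nat \<Rightarrow> nat \<Rightarrow> nat \<Rightarrow> nat \<Rightarrow> nat \<Rightarrow> gate list" where
  "point_gates p t e d i u = poly_gates p (i * d) u @ (let s = terms_end p u in
     (gate_square, s, t, s + 1) # pairs_gates e d (i * d) (s + 2) i)"

primrec points_start :: "polynomial \<Rightarrow> nat \<Rightarrow> nat \<Rightarrow> nat \<Rightarrow> nat" where
  "points_start p d u 0 = u"
| "points_start p d u (Suc i) = terms_end p (points_start p d u i) + 2 + i * (2 * d + 2)"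

definition points_gates :: "polynomial \<Rightarrow> nat \<Rightarrow> nat \<Rightarrow> nat \<Rightarrow> nat \<Rightarrow> nat \<Rightarrow> gate list" where
  "points_gates p t e d u k = concat (map (\<lambda>i. point_gates p t e d i (points_start p d u i)) [0..<k])"

lemma dist_gates_Suc: "dist_gates x y u (Suc d) = dist_gates x y u d @
     [(gate_diff, u + 2 * d + 1, x + d, y + d), (gate_square, u + 2 * d + 2, u + 2 * d, u + 2 * d + 1)]"
  by (simp add: dist_gates_def)

lemma pairs_gates_Suc:
  "pairs_gates e d x u (Suc n) = pairs_gates e d x u n @ pair_gates e d x (n * d) (u + n * (2 * d + 2))"
  by (simp add: pairs_gates_def)

lemma points_gates_Suc:
  "points_gates p t e d u (Suc k) = points_gates p t e d u k @ point_gates p t e d k (points_start p d u k)"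
  by (simp add: points_gates_def)

lemma dist_gates_value:
  "sat v (dist_gates x y u d) \<Longrightarrow> v (u + 2 * d) = v u + (\<Sum>l<d. (v (x + l) - v (y + l))\<^sup>2)"
  by (induction d) (auto simp: dist_gates_Suc)

lemma pair_gates_value:
  assumes "sat v (pair_gates e d x y u)"
  shows "v e \<le> (\<Sum>l<d. (v (x + l) - v (y + l))\<^sup>2)"
proof -
  have "v (u + 2 * d) = (\<Sum>l<d. (v (x + l) - v (y + l))\<^sup>2)"
    using assms dist_gates_value[of v x y u d] by (simp add: pair_gates_def)
  moreover have "v (u + 2 * d) = v e + (v (u + 2 * d + 1))\<^sup>2" using assms by (simp add: pair_gates_def)
  ultimately show ?thesis by (metis le_add_same_cancel1 zero_le_power2)
qed

lemma point_gates_value: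
  assumes "sat v (point_gates p t e d i u)"
  shows "v t \<le> eval_polynomial (\<lambda>l. v (i * d + l)) p"
    and "j < i \<Longrightarrow> v e \<le> (\<Sum>l<d. (v (i * d + l) - v (j * d + l))\<^sup>2)"
proof -
  let ?s = "terms_end p u"
  have "v ?s = eval_polynomial (\<lambda>l. v (i * d + l)) p"
    using assms by (intro poly_gates_value) (simp add: point_gates_def)
  moreover have "v ?s = v t + (v (?s + 1))\<^sup>2" using assms by (simp add: point_gates_def Let_def)
  ultimately show "v t \<le> eval_polynomial (\<lambda>l. v (i * d + l)) p"
    by (metis le_add_same_cancel1 zero_le_power2)
  have "sat v (pairs_gates e d (i * d) (?s + 2) i)" using assms by (simp add: point_gates_def Let_def)
  then show "v e \<le> (\<Sum>l<d. (v (i * d + l) - v (j * d + l))\<^sup>2)" if "j < i"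
    using that by (intro pair_gates_value) (auto simp: pairs_gates_def sat_def)
qed

lemma points_gates_value:
  "sat v (points_gates p t e d u k) \<Longrightarrow> i < k \<Longrightarrow> sat v (point_gates p t e d i (points_start p d u i))"
  by (auto simp: points_gates_def sat_def)

lemma extends_dist: "x + d \<le> Suc u \<Longrightarrow> y + d \<le> Suc u \<Longrightarrow> extends (Suc u) (dist_gates x y u d) (Suc (u + 2 * d))"
proof (induction d)
  case (Suc d)
  let ?m = "Suc (u + 2 * d)"
  have "extends (Suc u) (dist_gates x y u d) ?m" using Suc by simp
  moreover have "extends ?m [(gate_diff, ?m, x + d, y + d)] (Suc ?m)"
    by (rule extends_functional) (use Suc.prems in auto)
  moreover have "extends (Suc ?m) [(gate_square, Suc ?m, u + 2 * d, ?m)] (Suc (Suc ?m))"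
    by (rule extends_functional) auto
  ultimately have "extends (Suc u) (dist_gates x y u d @ (gate_diff, ?m, x + d, y + d) # [(gate_square, Suc ?m, u + 2 * d, ?m)]) (Suc (Suc ?m))"
    by (blast intro: extends_append extends_Cons)
  then show ?case by (simp add: dist_gates_Suc)
qed (simp add: dist_gates_def)

text \<open>The counterpart of \<open>extends_append\<close> for gates that encode inequalities:
  they are solvable from certain assignments but not from all, so the solution is prolonged from a
  particular \<open>x\<close>.\<close>

lemma sat_append_extend:
  assumes "agree l w x" "sat x G" "gates_below m G" "l \<le> m" "\<exists>y. agree m x y \<and> sat y H"
  shows "\<exists>y. agree l w y \<and> sat y (G @ H)"
  using assms by (auto dest: sat_agree intro: agree_trans)

lemma gates_below_dist: "x + d \<le> Suc u \<Longrightarrow> y + d \<le> Suc u \<Longrightarrow> gates_below (Suc (u + 2 * d)) (dist_gates x y u d)"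
  using extends_dist by (simp add: extends_def)

lemma gates_below_pair:
  assumes "x + d \<le> u" "y + d \<le> u" "e < u"
  shows "gates_below (u + 2 * d + 2) (pair_gates e d x y u)"
  using assms gates_below_mono[OF gates_below_dist[of x d u y]] by (simp add: pair_gates_def)

lemma pair_gates_complete:
  assumes "x + d \<le> u" "y + d \<le> u" "e < u" "v e \<le> (\<Sum>l<d. (v (x + l) - v (y + l))\<^sup>2)"
  shows "\<exists>v'. agree u v v' \<and> sat v' (pair_gates e d x y u)"
proof -
  let ?G = "(gate_const 0, u, u, u) # dist_gates x y u d"
  have ext: "extends u ?G (Suc (u + 2 * d))"
    by (rule extends_Cons[OF extends_const extends_dist]) (use assms in auto)
  then obtain v1 where v1: "agree u v v1" "sat v1 ?G" unfolding extends_def by blast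
  have "v1 (u + 2 * d) = (\<Sum>l<d. (v1 (x + l) - v1 (y + l))\<^sup>2)"
    using v1(2) dist_gates_value[of v1 x y u d] by simp
  also have "\<dots> = (\<Sum>l<d. (v (x + l) - v (y + l))\<^sup>2)"
    using assms by (intro sum.cong) (auto simp: agreeD[OF v1(1)])
  finally have ge: "v1 e \<le> v1 (u + 2 * d)" using assms agreeD[OF v1(1), of e] by simp
  \<comment> \<open>The inequality just shown makes the excess nonnegative, so its square root
    serves as the slack variable.\<close>
  let ?v2 = "v1(u + 2 * d + 1 := sqrt (v1 (u + 2 * d) - v1 e))"
  have "\<exists>v'. agree (Suc (u + 2 * d)) v1 v' \<and> sat v' [(gate_square, u + 2 * d, e, u + 2 * d + 1)]"
    using ge assms by (intro exI[of _ ?v2]) (auto simp: agree_def)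
  from sat_append_extend[OF v1 _ _ this] ext show ?thesis
    by (auto simp: extends_def pair_gates_def)
qed

lemma gates_below_pairs:
  assumes "x + d \<le> u" "n * d \<le> u" "e < u"
  shows "gates_below (u + n * (2 * d + 2)) (pairs_gates e d x u n)"
  using assms
proof (induction n)
  case (Suc n)
  let ?u = "u + n * (2 * d + 2)"
  have "gates_below ?u (pairs_gates e d x u n)" using Suc by simp
  moreover have "gates_below (?u + 2 * d + 2) (pair_gates e d x (n * d) ?u)"
    by (rule gates_below_pair) (use Suc.prems in \<open>auto simp: algebra_simps\<close>)
  ultimately show ?case
    unfolding pairs_gates_Suc by (auto intro: gates_below_mono simp: algebra_simps)
qed (simp add: pairs_gates_def)

lemma pairs_gates_complete:
  assumes "x + d \<le> u" "n * d \<le> u" "e < u" "\<And>j. j < n \<Longrightarrow> v e \<le> (\<Sum>l<d. (v (x + l) - v (j * d + l))\<^sup>2)"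
  shows "\<exists>v'. agree u v v' \<and> sat v' (pairs_gates e d x u n)"
  using assms
proof (induction n)
  case (Suc n)
  let ?u = "u + n * (2 * d + 2)"
  have "\<exists>v'. agree u v v' \<and> sat v' (pairs_gates e d x u n)" by (rule Suc.IH) (use Suc.prems in auto)
  then obtain v1 where v1: "agree u v v1" "sat v1 (pairs_gates e d x u n)" by blast
  have "(\<Sum>l<d. (v1 (x + l) - v1 (n * d + l))\<^sup>2) = (\<Sum>l<d. (v (x + l) - v (n * d + l))\<^sup>2)"
    using Suc.prems by (intro sum.cong) (auto simp: agreeD[OF v1(1)])
  then have "\<exists>v'. agree ?u v1 v' \<and> sat v' (pair_gates e d x (n * d) ?u)"
    using Suc.prems(4)[of n] Suc.prems agreeD[OF v1(1), of e]
    by (intro pair_gates_complete) (auto simp: algebra_simps)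
  moreover have "gates_below ?u (pairs_gates e d x u n)" using Suc.prems by (intro gates_below_pairs) auto
  ultimately show ?case
    unfolding pairs_gates_Suc by (intro sat_append_extend[OF v1]) auto
qed (auto simp: pairs_gates_def intro: agree_refl)

lemma gates_below_point:
  assumes "polynomial_in d p" "(i + 1) * d \<le> u" "t < u" "e < u"
  shows "gates_below (terms_end p u + 2 + i * (2 * d + 2)) (point_gates p t e d i u)"
proof -
  let ?s = "terms_end p u"
  have us: "u \<le> ?s" by (rule terms_end_ge)
  have "gates_below (Suc ?s) (poly_gates p (i * d) u)"
    using extends_poly[of d p "i * d" u] assms by (simp add: extends_def algebra_simps)
  moreover have "gates_below (?s + 2 + i * (2 * d + 2)) (pairs_gates e d (i * d) (?s + 2) i)"
    by (rule gates_below_pairs) (use assms us in \<open>auto simp: algebra_simps\<close>)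
  ultimately show ?thesis using assms us by (auto simp: point_gates_def Let_def intro: gates_below_mono)
qed

lemma point_gates_complete:
  assumes "polynomial_in d p" "(i + 1) * d \<le> u" "t < u" "e < u"
    and "v t \<le> eval_polynomial (\<lambda>l. v (i * d + l)) p"
    and "\<And>j. j < i \<Longrightarrow> v e \<le> (\<Sum>l<d. (v (i * d + l) - v (j * d + l))\<^sup>2)"
  shows "\<exists>v'. agree u v v' \<and> sat v' (point_gates p t e d i u)"
proof -
  let ?s = "terms_end p u"
  have us: "u \<le> ?s" by (rule terms_end_ge)
  have ext: "extends u (poly_gates p (i * d) u) (Suc ?s)"
    using extends_poly[of d p "i * d" u] assms by (simp add: algebra_simps)
  then obtain v1 where v1: "agree u v v1" "sat v1 (poly_gates p (i * d) u)" unfolding extends_def by blast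
  have "v1 ?s = eval_polynomial (\<lambda>l. v1 (i * d + l)) p" by (rule poly_gates_value[OF v1(2)])
  also have "\<dots> = eval_polynomial (\<lambda>l. v (i * d + l)) p"
    using assms by (intro eval_polynomial_agree) (auto simp: agree_def agreeD[OF v1(1)])
  finally have ge: "v1 t \<le> v1 ?s" using assms agreeD[OF v1(1), of t] by simp
  define v2 where "v2 = v1(?s + 1 := sqrt (v1 ?s - v1 t))"
  have v12: "agree (Suc ?s) v1 v2" by (auto simp: agree_def v2_def)
  have uv2: "agree u v v2" by (rule agree_trans[OF v1(1) v12]) (use us in simp)
  have square: "gate_holds v2 (gate_square, ?s, t, ?s + 1)" using ge assms us by (auto simp: v2_def)
  have "(\<Sum>l<d. (v2 (i * d + l) - v2 (j * d + l))\<^sup>2) = (\<Sum>l<d. (v (i * d + l) - v (j * d + l))\<^sup>2)" if "j < i" for j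
  proof (intro sum.cong refl)
    fix l assume "l \<in> {..<d}"
    moreover have "j * d \<le> i * d" by (rule mult_le_mono1) (use that in simp)
    moreover have "i * d + d \<le> u" using assms(2) by simp
    ultimately have "i * d + l < u" "j * d + l < u" unfolding lessThan_iff by linarith+
    then show "(v2 (i * d + l) - v2 (j * d + l))\<^sup>2 = (v (i * d + l) - v (j * d + l))\<^sup>2"
      by (simp add: agreeD[OF uv2])
  qed
  then have "\<exists>v'. agree (?s + 2) v2 v' \<and> sat v' (pairs_gates e d (i * d) (?s + 2) i)"
    using assms us agreeD[OF uv2, of e]
    by (intro pairs_gates_complete) auto
  moreover have "sat v2 (poly_gates p (i * d) u @ [(gate_square, ?s, t, ?s + 1)])"
    using square sat_agree[OF v12, of "poly_gates p (i * d) u"] v1(2) ext by (simp add: extends_def del: gate_holds.simps)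
  moreover have "gates_below (?s + 2) (poly_gates p (i * d) u @ [(gate_square, ?s, t, ?s + 1)])"
    using ext us assms by (auto simp: extends_def intro: gates_below_mono)
  ultimately have "\<exists>y. agree u v y \<and> sat y ((poly_gates p (i * d) u @ [(gate_square, ?s, t, ?s + 1)]) @
      pairs_gates e d (i * d) (?s + 2) i)"
    using us by (intro sat_append_extend[OF uv2]) auto
  then show ?thesis by (simp add: point_gates_def Let_def)
qed

lemma points_start_ge: "u \<le> points_start p d u i"
proof (induction i)
  case (Suc i)
  then show ?case using terms_end_ge[of "points_start p d u i" p] by simp
qed simp

lemma points_start_mono: "i \<le> j \<Longrightarrow> points_start p d u i \<le> points_start p d u j"
proof (induction rule: dec_induct)
  case (step n)
  then show ?case using terms_end_ge[of "points_start p d u n" p] by simp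
qed simp

lemma gates_below_points:
  assumes "polynomial_in d p" "k * d \<le> u" "t < u" "e < u"
  shows "gates_below (points_start p d u k) (points_gates p t e d u k)"
  using assms
proof (induction k)
  case (Suc k)
  let ?u = "points_start p d u k"
  have uu: "u \<le> ?u" by (rule points_start_ge)
  have "gates_below (points_start p d u (Suc k)) (point_gates p t e d k ?u)"
    using gates_below_point[of d p k ?u t e] Suc.prems uu by simp
  moreover have "gates_below (points_start p d u (Suc k)) (points_gates p t e d u k)"
    by (rule gates_below_mono[OF Suc.IH]) (use Suc.prems points_start_mono[of k "Suc k" p d u] in auto)
  ultimately show ?case by (simp add: points_gates_Suc)
qed (simp add: points_gates_def)

lemma points_gates_complete:
  assumes "polynomial_in d p" "k * d \<le> u" "t < u" "e < u"
    and "\<And>i. i < k \<Longrightarrow> v t \<le> eval_polynomial (\<lambda>l. v (i * d + l)) p"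
    and "\<And>i j. i < k \<Longrightarrow> j < i \<Longrightarrow> v e \<le> (\<Sum>l<d. (v (i * d + l) - v (j * d + l))\<^sup>2)"
  shows "\<exists>v'. agree u v v' \<and> sat v' (points_gates p t e d u k)"
  using assms
proof (induction k)
  case (Suc k)
  let ?u = "points_start p d u k"
  have uu: "u \<le> ?u" by (rule points_start_ge)
  have "\<exists>v'. agree u v v' \<and> sat v' (points_gates p t e d u k)" by (rule Suc.IH) (use Suc.prems in auto)
  then obtain v1 where v1: "agree u v v1" "sat v1 (points_gates p t e d u k)" by blast
  have eq: "v1 (j * d + l) = v (j * d + l)" if "j \<le> k" "l < d" for j l
  proof (rule agreeD[OF v1(1)])
    have "j * d \<le> k * d" by (rule mult_le_mono1) (use that in simp)
    moreover have "k * d + d \<le> u" using Suc.prems(2) by simp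
    ultimately show "j * d + l < u" using that by linarith
  qed
  have "\<exists>v'. agree ?u v1 v' \<and> sat v' (point_gates p t e d k ?u)"
  proof (rule point_gates_complete)
    have "eval_polynomial (\<lambda>l. v1 (k * d + l)) p = eval_polynomial (\<lambda>l. v (k * d + l)) p"
      by (rule eval_polynomial_agree[OF Suc.prems(1)]) (simp add: agree_def eq)
    then show "v1 t \<le> eval_polynomial (\<lambda>l. v1 (k * d + l)) p"
      using Suc.prems(5)[of k] agreeD[OF v1(1), of t] Suc.prems by simp
    fix j assume j: "j < k"
    have "(\<Sum>l<d. (v1 (k * d + l) - v1 (j * d + l))\<^sup>2) = (\<Sum>l<d. (v (k * d + l) - v (j * d + l))\<^sup>2)"
      using j by (intro sum.cong) (auto simp: eq)
    then show "v1 e \<le> (\<Sum>l<d. (v1 (k * d + l) - v1 (j * d + l))\<^sup>2)"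
      using Suc.prems(6)[of k j] j agreeD[OF v1(1), of e] Suc.prems by simp
  qed (use Suc.prems uu in auto)
  moreover have "gates_below ?u (points_gates p t e d u k)" using Suc.prems by (intro gates_below_points) auto
  ultimately show ?case
    unfolding points_gates_Suc using uu by (intro sat_append_extend[OF v1]) auto
qed (auto simp: points_gates_def intro: agree_refl)

text \<open>A fraction enters as the solution of numerator = denominator times value, which is
  unique because the denominator is not 0; a negative denominator needs no special care. The
  separation is needed only through its square \<open>e\<close>, since distances are compared
  squared.\<close>

definition params_gates :: "fraction \<Rightarrow> fraction \<Rightarrow> nat \<Rightarrow> nat \<Rightarrow> nat \<Rightarrow> gate list" where
  "params_gates \<theta> \<delta> t e u = (let a = int_end (fst \<theta>) u; b = int_end (snd \<theta>) (Suc a);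
       a' = int_end (fst \<delta>) (Suc b); b' = int_end (snd \<delta>) (Suc a') in
     int_gates (fst \<theta>) u @ int_gates (snd \<theta>) (Suc a) @ (gate_mult, a, b, t) #
     int_gates (fst \<delta>) (Suc b) @ int_gates (snd \<delta>) (Suc a') @
     [(gate_mult, a', b', Suc b'), (gate_mult, e, Suc b', Suc b')])"

definition params_end :: "fraction \<Rightarrow> fraction \<Rightarrow> nat \<Rightarrow> nat" where
  "params_end \<theta> \<delta> u = int_end (snd \<delta>) (Suc (int_end (fst \<delta>) (Suc (int_end (snd \<theta>) (Suc (int_end (fst \<theta>) u)))))) + 2"

lemma fraction_value_eq: "fraction_value f = of_int (fst f) / of_int (snd f)"
  by (cases f) simp

lemma params_gates_value:
  assumes "sat v (params_gates \<theta> \<delta> t e u)" "snd \<theta> \<noteq> 0" "snd \<delta> \<noteq> 0"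
  shows "v t = fraction_value \<theta>" "v e = (fraction_value \<delta>)\<^sup>2"
proof -
  define a where "a = int_end (fst \<theta>) u"
  define b where "b = int_end (snd \<theta>) (Suc a)"
  define a' where "a' = int_end (fst \<delta>) (Suc b)"
  define b' where "b' = int_end (snd \<delta>) (Suc a')"
  note defs = a_def[symmetric] b_def[symmetric] a'_def[symmetric] b'_def[symmetric]
  have s: "sat v (int_gates (fst \<theta>) u)" "sat v (int_gates (snd \<theta>) (Suc a))" "v a = v b * v t"
    "sat v (int_gates (fst \<delta>) (Suc b))" "sat v (int_gates (snd \<delta>) (Suc a'))"
    "v a' = v b' * v (Suc b')" "v e = v (Suc b') * v (Suc b')"
    using assms(1) by (simp_all add: params_gates_def Let_def defs)
  have "v a = of_int (fst \<theta>)" "v b = of_int (snd \<theta>)" "v a' = of_int (fst \<delta>)" "v b' = of_int (snd \<delta>)"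
    using int_gates_value[OF s(1)] int_gates_value[OF s(2)] int_gates_value[OF s(4)] int_gates_value[OF s(5)]
    by (simp_all add: defs)
  with s assms show "v t = fraction_value \<theta>" "v e = (fraction_value \<delta>)\<^sup>2"
    by (auto simp: fraction_value_eq power2_eq_square field_simps)
qed

lemma params_gates_below:
  assumes "t < u" "e < u"
  shows "gates_below (params_end \<theta> \<delta> u) (params_gates \<theta> \<delta> t e u)" "u \<le> params_end \<theta> \<delta> u"
proof -
  define a where "a = int_end (fst \<theta>) u"
  define b where "b = int_end (snd \<theta>) (Suc a)"
  define a' where "a' = int_end (fst \<delta>) (Suc b)"
  define b' where "b' = int_end (snd \<delta>) (Suc a')"
  note defs = a_def[symmetric] b_def[symmetric] a'_def[symmetric] b'_def[symmetric]
  have less: "u < a" "a < b" "b < a'" "a' < b'"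
    using int_end_ge[of u "fst \<theta>"] int_end_ge[of "Suc a" "snd \<theta>"] int_end_ge[of "Suc b" "fst \<delta>"]
      int_end_ge[of "Suc a'" "snd \<delta>"] by (simp_all add: defs)
  then show "u \<le> params_end \<theta> \<delta> u" by (simp add: params_end_def defs)
  have "gates_below (Suc a) (int_gates (fst \<theta>) u)" "gates_below (Suc b) (int_gates (snd \<theta>) (Suc a))"
    "gates_below (Suc a') (int_gates (fst \<delta>) (Suc b))" "gates_below (Suc b') (int_gates (snd \<delta>) (Suc a'))"
    using extends_int[of u "fst \<theta>"] extends_int[of "Suc a" "snd \<theta>"] extends_int[of "Suc b" "fst \<delta>"]
      extends_int[of "Suc a'" "snd \<delta>"] by (simp_all add: extends_def defs)
  then show "gates_below (params_end \<theta> \<delta> u) (params_gates \<theta> \<delta> t e u)"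
    using less assms by (auto simp: params_gates_def params_end_def Let_def defs intro: gates_below_mono)
qed

lemma params_gates_complete:
  assumes "t < u" "e < u" "snd \<theta> \<noteq> 0" "snd \<delta> \<noteq> 0" "v t = fraction_value \<theta>" "v e = (fraction_value \<delta>)\<^sup>2"
  shows "\<exists>v'. agree u v v' \<and> sat v' (params_gates \<theta> \<delta> t e u)"
proof -
  define a where "a = int_end (fst \<theta>) u"
  define b where "b = int_end (snd \<theta>) (Suc a)"
  define a' where "a' = int_end (fst \<delta>) (Suc b)"
  define b' where "b' = int_end (snd \<delta>) (Suc a')"
  note defs = a_def[symmetric] b_def[symmetric] a'_def[symmetric] b'_def[symmetric]
  let ?G = "(int_gates (fst \<theta>) u @ int_gates (snd \<theta>) (Suc a)) @ int_gates (fst \<delta>) (Suc b) @ int_gates (snd \<delta>) (Suc a')"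
  have less: "u < a" "a < b" "b < a'" "a' < b'"
    using int_end_ge[of u "fst \<theta>"] int_end_ge[of "Suc a" "snd \<theta>"] int_end_ge[of "Suc b" "fst \<delta>"]
      int_end_ge[of "Suc a'" "snd \<delta>"] by (simp_all add: defs)
  have ext: "extends u ?G (Suc b')"
    using extends_int[of u "fst \<theta>"] extends_int[of "Suc a" "snd \<theta>"] extends_int[of "Suc b" "fst \<delta>"]
      extends_int[of "Suc a'" "snd \<delta>"] unfolding defs by (blast intro: extends_append)
  then obtain v1 where v1: "agree u v v1" "sat v1 ?G" unfolding extends_def by blast
  \<comment> \<open>The integers are determined, and \<open>t\<close> and \<open>e\<close> have
    their values already; what remains is the variable for the separation itself, of which
    \<open>e\<close> is the square.\<close>
  define v2 where "v2 = v1(Suc b' := fraction_value \<delta>)"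
  have v12: "agree (Suc b') v1 v2" by (auto simp: agree_def v2_def)
  have uv2: "agree u v v2" by (rule agree_trans[OF v1(1) v12]) (use less in simp)
  have s: "sat v2 ?G" using sat_agree[OF v12] ext v1(2) by (simp add: extends_def)
  then have vals: "v2 a = of_int (fst \<theta>)" "v2 b = of_int (snd \<theta>)" "v2 a' = of_int (fst \<delta>)" "v2 b' = of_int (snd \<delta>)"
    using int_gates_value[of v2 "fst \<theta>" u] int_gates_value[of v2 "snd \<theta>" "Suc a"]
      int_gates_value[of v2 "fst \<delta>" "Suc b"] int_gates_value[of v2 "snd \<delta>" "Suc a'"]
    by (simp_all add: defs)
  have "v2 t = fraction_value \<theta>" "v2 e = (fraction_value \<delta>)\<^sup>2" "v2 (Suc b') = fraction_value \<delta>"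
    using agreeD[OF uv2, of t] agreeD[OF uv2, of e] assms by (simp_all add: v2_def)
  then have "sat v2 (params_gates \<theta> \<delta> t e u)"
    using s vals assms by (simp add: params_gates_def Let_def defs fraction_value_eq power2_eq_square)
  with uv2 show ?thesis by blast
qed

text \<open>
  The first evaluation of the objective constrains nothing.  It is there because the machine reads the
  objective before it knows the number of points.
\<close>

definition cmrc_gates :: "nat \<Rightarrow> cmrc_instance \<Rightarrow> gate list" where
  "cmrc_gates f I = (let p = objective I; d = dimension I; s = terms_end p (f + 2) in
     poly_gates p 0 (f + 2) @ params_gates (threshold I) (separation I) f (f + 1) (Suc s) @
     points_gates p f (f + 1) d (params_end (threshold I) (separation I) (Suc s)) (num_points I))"

definition cmrc_end :: "nat \<Rightarrow> cmrc_instance \<Rightarrow> nat" where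
  "cmrc_end f I = points_start (objective I) (dimension I)
     (params_end (threshold I) (separation I) (Suc (terms_end (objective I) (f + 2)))) (num_points I)"

lemma cmrc_gates_below:
  assumes "cmrc_valid I" "num_points I * dimension I \<le> f" "dimension I \<le> f"
  shows "gates_below (cmrc_end f I) (cmrc_gates f I)"
proof -
  let ?p = "objective I" and ?d = "dimension I"
  let ?s = "terms_end ?p (f + 2)"
  let ?e = "params_end (threshold I) (separation I) (Suc ?s)"
  have p: "polynomial_in ?d ?p" using assms(1) by (simp add: cmrc_valid_def)
  have fs: "f + 2 \<le> ?s" by (rule terms_end_ge)
  note par = params_gates_below[of f "Suc ?s" "f + 1" "threshold I" "separation I"]
  have e: "Suc ?s \<le> ?e" using par fs by simp
  have end_ge: "?e \<le> cmrc_end f I" unfolding cmrc_end_def by (rule points_start_ge)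
  have "gates_below (Suc ?s) (poly_gates ?p 0 (f + 2))"
    using extends_poly[OF p, of 0 "f + 2"] assms by (simp add: extends_def)
  moreover have "gates_below ?e (params_gates (threshold I) (separation I) f (f + 1) (Suc ?s))"
    using par fs by simp
  moreover have "gates_below (cmrc_end f I) (points_gates ?p f (f + 1) ?d ?e (num_points I))"
    unfolding cmrc_end_def by (rule gates_below_points[OF p]) (use assms fs e in auto)
  ultimately show ?thesis using e end_ge by (auto simp: cmrc_gates_def Let_def intro: gates_below_mono)
qed

text \<open>The gates see squared distances only; for a positive separation, comparing squares is
  equivalent.\<close>

lemma L2_set_ge_iff:
  assumes "r > 0"
  shows "r \<le> L2_set g A \<longleftrightarrow> r\<^sup>2 \<le> (\<Sum>i\<in>A. (g i)\<^sup>2)"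
  unfolding L2_set_def using assms
  by (metis abs_of_pos real_le_lsqrt real_le_rsqrt real_sqrt_abs real_sqrt_le_iff)

lemma cmrc_gates_sat:
  assumes "cmrc_valid I" "num_points I * dimension I \<le> f" "dimension I \<le> f"
  shows "(\<exists>x. sat x (cmrc_gates f I)) \<longleftrightarrow> cmrc_yes I"
proof -
  let ?p = "objective I" and ?d = "dimension I" and ?k = "num_points I"
  let ?\<theta> = "fraction_value (threshold I)" and ?\<delta> = "fraction_value (separation I)"
  let ?s = "terms_end ?p (f + 2)"
  let ?e = "params_end (threshold I) (separation I) (Suc ?s)"
  have p: "polynomial_in ?d ?p" and nz: "snd (threshold I) \<noteq> 0" "snd (separation I) \<noteq> 0" and pos: "?\<delta> > 0" "?d \<ge> 1"
    using assms(1) by (auto simp: cmrc_valid_def)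
  have fs: "f + 2 \<le> ?s" by (rule terms_end_ge)
  have es: "Suc ?s \<le> ?e" using params_gates_below(2)[of f "Suc ?s" "f + 1"] fs by simp
  show ?thesis
  proof
    assume "\<exists>x. sat x (cmrc_gates f I)"
    then obtain x where "sat x (cmrc_gates f I)" by blast
    then have x: "sat x (params_gates (threshold I) (separation I) f (f + 1) (Suc ?s))"
      "sat x (points_gates ?p f (f + 1) ?d ?e ?k)" by (simp_all add: cmrc_gates_def Let_def)
    note par = params_gates_value[OF x(1) nz]
    define P where "P i l = x (i * ?d + l)" for i l
    note point = point_gates_value[OF points_gates_value[OF x(2)]]
    have apart: "?\<delta> \<le> L2_set (\<lambda>l. P i l - P j l) {..<?d}" if "i < ?k" "j < i" for i j
      using point(2)[OF that] par by (simp add: L2_set_ge_iff[OF pos(1)] P_def)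
    have "?\<delta> \<le> L2_set (\<lambda>l. P i l - P j l) {..<?d}" if "i < ?k" "j < ?k" "i \<noteq> j" for i j
    proof (cases "j < i")
      \<comment> \<open>The gates compare a point with earlier ones, so this case swaps the two
        points.\<close>
      case False
      with apart[of j i] that show ?thesis
        by (simp add: L2_set_def power2_commute)
    qed (use apart that in auto)
    moreover have "?\<theta> \<le> eval_polynomial (P i) ?p" if "i < ?k" for i
      using point(1)[OF that] par by (simp add: P_def[abs_def])
    ultimately show "cmrc_yes I" unfolding cmrc_yes_def by blast
  next
    assume "cmrc_yes I"
    then obtain P where P: "\<And>i. i < ?k \<Longrightarrow> ?\<theta> \<le> eval_polynomial (P i) ?p"
      "\<And>i j. i < ?k \<Longrightarrow> j < ?k \<Longrightarrow> i \<noteq> j \<Longrightarrow> ?\<delta> \<le> L2_set (\<lambda>l. P i l - P j l) {..<?d}"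
      unfolding cmrc_yes_def by blast
    \<comment> \<open>Division with remainder inverts the numbering \<open>i * d + l\<close> of the
      coordinates. The parameters at \<open>f\<close> and \<open>f + 1\<close> overwrite none of
      them, because \<open>k * d \<le> f\<close>.\<close>
    define x where "x = (\<lambda>n. P (n div ?d) (n mod ?d) :: real)(f := ?\<theta>, f + 1 := ?\<delta>\<^sup>2)"
    have coord: "i * ?d + l < f" if "i < ?k" "l < ?d" for i l
    proof -
      have "Suc i * ?d \<le> ?k * ?d" using that by (intro mult_le_mono1) simp
      then show ?thesis using that assms(2) unfolding mult_Suc by linarith
    qed
    have xP: "x (i * ?d + l) = P i l" if "i < ?k" "l < ?d" for i l
      using coord[OF that] that by (simp add: x_def)
    from extends_poly[OF p, of 0 "f + 2"] assms obtain y
      where y: "agree (f + 2) x y" "sat y (poly_gates ?p 0 (f + 2))" "gates_below (Suc ?s) (poly_gates ?p 0 (f + 2))"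
      unfolding extends_def by auto
    have "\<exists>y'. agree (Suc ?s) y y' \<and> sat y' (params_gates (threshold I) (separation I) f (f + 1) (Suc ?s))"
      by (rule params_gates_complete) (use fs nz agreeD[OF y(1)] in \<open>simp_all add: x_def\<close>)
    from sat_append_extend[OF y _ this] fs obtain z where z: "agree (f + 2) x z"
      "sat z (poly_gates ?p 0 (f + 2) @ params_gates (threshold I) (separation I) f (f + 1) (Suc ?s))" by auto
    have zP: "z (i * ?d + l) = P i l" if "i < ?k" "l < ?d" for i l
      using agreeD[OF z(1), of "i * ?d + l"] coord[OF that] xP[OF that] by simp
    have zf: "z f = ?\<theta>" "z (f + 1) = ?\<delta>\<^sup>2" using agreeD[OF z(1)] by (simp_all add: x_def)
    have "\<exists>z'. agree ?e z z' \<and> sat z' (points_gates ?p f (f + 1) ?d ?e ?k)"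
    proof (rule points_gates_complete[OF p])
      fix i assume i: "i < ?k"
      have "eval_polynomial (\<lambda>l. z (i * ?d + l)) ?p = eval_polynomial (P i) ?p"
        by (rule eval_polynomial_agree[OF p]) (simp add: agree_def zP[OF i])
      then show "z f \<le> eval_polynomial (\<lambda>l. z (i * ?d + l)) ?p" using P(1)[OF i] zf by simp
      fix j assume j: "j < i"
      have "(\<Sum>l<?d. (z (i * ?d + l) - z (j * ?d + l))\<^sup>2) = (\<Sum>l<?d. (P i l - P j l)\<^sup>2)"
        using i j by (intro sum.cong) (auto simp: zP)
      then show "z (f + 1) \<le> (\<Sum>l<?d. (z (i * ?d + l) - z (j * ?d + l))\<^sup>2)"
        using P(2)[of i j] i j zf by (simp add: L2_set_ge_iff[OF pos(1)])
    qed (use assms fs es in auto)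
    from sat_append_extend[OF z _ _ this] es fs
      params_gates_below(1)[of f "Suc ?s" "f + 1" "threshold I" "separation I"]
      gates_below_mono[OF y(3) es]
    show "\<exists>x. sat x (cmrc_gates f I)" by (auto simp: cmrc_gates_def Let_def)
  qed
qed


section \<open>The program for clustering instances\<close>

abbreviation (input) reg_threshold :: nat where "reg_threshold \<equiv> 24"
abbreviation (input) reg_separation :: nat where "reg_separation \<equiv> 25"
abbreviation (input) reg_count :: nat where "reg_count \<equiv> 26"
abbreviation (input) reg_index :: nat where "reg_index \<equiv> 27"
abbreviation (input) reg_x :: nat where "reg_x \<equiv> 28"
abbreviation (input) reg_y :: nat where "reg_y \<equiv> 29"

definition Clear_word :: "nat \<Rightarrow> prog" where
  "Clear_word r = While_nonempty r (Pop_word r)"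

lemma run_Clear_word: "run (Clear_word r) (c, w, v) (2 * length (w r) + 1) (c, w(r := []), v)"
proof (induction "w r" arbitrary: w)
  case Nil
  then show ?case unfolding Clear_word_def
    by (intro run_conv[OF run_While_nonempty_done]) (auto simp: fun_eq_iff)
next
  case (Cons x xs)
  have wr: "w r = x # xs" using Cons(2) by simp
  show ?case
    unfolding Clear_word_def
    apply (rule run_conv, rule run_While_nonempty_step, use wr in simp, rule run_Pop_word, use wr in simp)
    apply (rule Cons(1)[unfolded Clear_word_def], use wr in simp)
    using wr by auto
qed

text \<open>\<open>reg_b\<close> holds the current partial sum and \<open>reg_a\<close> the current
  difference. \<open>reg_y\<close> is deliberately left advanced by \<open>d\<close>: it then points
  to the next earlier point, ready for the next round of the loop over pairs.\<close>

definition Pair :: prog where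
  "Pair = (Copy reg_base reg_x ;; Copy reg_fresh reg_b ;; Gate (gate_const 0) reg_fresh reg_fresh reg_fresh ;; Inc reg_fresh ;;
     For reg_dim 32 (Gate gate_diff reg_fresh reg_x reg_y ;; Copy reg_fresh reg_a ;; Inc reg_fresh ;;
       Gate gate_square reg_fresh reg_b reg_a ;; Copy reg_fresh reg_b ;; Inc reg_fresh ;; Clear reg_a ;; Inc reg_x ;; Inc reg_y) ;;
     Gate gate_square reg_b reg_separation reg_fresh ;; Inc reg_fresh ;; Clear reg_b ;; Clear reg_x)"

lemma run_Pair:
  assumes "clean c" "c reg_a = 0" "c reg_b = 0" "c reg_x = 0" "c 32 = 0" "c reg_dim = d" "c reg_fresh = u"
    "c reg_base = x" "c reg_y = y" "x + d \<le> u" "y + d \<le> u" "c reg_separation < u" "u + 2 * d + 2 \<le> c reg_size"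
  shows "run Pair (c, w, v) (10 * unit_cost (c reg_size) * (d + 1)) (c(reg_fresh := u + 2 * d + 2, reg_y := y + d), w,
    v @ enc_gates (c reg_size) (pair_gates (c reg_separation) d x y u))"
proof -
  let ?U = "unit_cost (c reg_size)"
  let ?P = "Gate gate_diff reg_fresh reg_x reg_y ;; Copy reg_fresh reg_a ;; Inc reg_fresh ;;
       Gate gate_square reg_fresh reg_b reg_a ;; Copy reg_fresh reg_b ;; Inc reg_fresh ;; Clear reg_a ;; Inc reg_x ;; Inc reg_y"
  define C where "C l = c(reg_x := x + l, reg_b := u + 2 * l, reg_fresh := u + 2 * l + 1, reg_y := y + l)" for l
  define V where "V l = (v @ enc_gates (c reg_size) [(gate_const 0, u, u, u)]) @ enc_gates (c reg_size) (dist_gates x y u l)" for l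
  have U: "100 \<le> ?U" using unit_cost_ge[of "c reg_size"] by simp
  have "8 * d \<le> ?U * d" by (rule mult_le_mono1) (use U in simp)
  then have cost: "6 + 8 * d \<le> 4 * ?U + 4 * (?U * d)" using U by linarith
  have body: "run ?P ((C l)(reg_dim := d - Suc l, 32 := Suc l), w, V l) (6 * ?U)
      ((C (Suc l))(reg_dim := d - Suc l, 32 := Suc l), w, V (Suc l))" if l: "l < d" for l
    apply (rule run_conv)
    apply (rule run_intros | use assms l in \<open>simp add: C_def; fail\<close>)+
    using U assms l
    by (auto simp: C_def V_def fun_eq_iff dist_gates_Suc enc_gates_Cons[of _ _ "_ # _"])
  have loop: "run (For reg_dim 32 ?P) (C 0, w, V 0) (d * (6 * ?U + 8) + 2) ((C d)(reg_dim := d, 32 := 0), w, V d)"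
    by (rule run_For[where c = C and w = "\<lambda>_. w" and v = V]) (use body assms in \<open>auto simp: C_def\<close>)
  have V0: "V 0 = v @ enc_gates (c reg_size) [(gate_const 0, u, u, u)]" by (simp add: V_def dist_gates_def)
  show ?thesis
    unfolding Pair_def
    apply (rule run_conv)
    apply (rule run_intros | use assms in \<open>simp; fail\<close>)+
    apply (rule run_pre, rule loop, use assms in \<open>simp add: C_def V0 fun_eq_iff\<close>)
    apply (rule run_intros | use assms in \<open>simp add: C_def; fail\<close>)+
    using U assms cost
    by (auto simp: C_def V_def fun_eq_iff pair_gates_def algebra_simps enc_gates_Cons[of _ _ "_ @ _"])
qed

text \<open>The objective is kept in word \<open>3\<close> and evaluated anew for every point. Two
  moves, each a reversal, bring it to the input in the right order; the evaluation leaves it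
  reversed in word \<open>1\<close>, and one more move restores word \<open>3\<close>.\<close>

definition Point :: prog where
  "Point = (Move_word 3 1 ;; Move_word 1 0 ;; Eval_polynomial ;; Move_word 1 3 ;;
     Gate gate_square reg_sum reg_threshold reg_fresh ;; Inc reg_fresh ;; Clear reg_sum ;;
     For reg_index 31 Pair ;; Clear reg_y ;; Inc reg_index ;; For reg_dim 32 (Inc reg_base))"

definition between_points :: "(nat \<Rightarrow> nat) \<Rightarrow> bool" where
  "between_points c \<longleftrightarrow> clean c \<and> c reg_pow = 0 \<and> c reg_mon = 0 \<and> c reg_sum = 0 \<and> c reg_var = 0 \<and> c reg_a = 0 \<and>
     c reg_b = 0 \<and> c reg_x = 0 \<and> c reg_y = 0 \<and> c 31 = 0 \<and> c 32 = 0"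

lemma run_Point:
  assumes "between_points c" "c reg_dim = d" "c reg_fresh = u" "c reg_base = i * d" "c reg_index = i" "polynomial_in d p"
    "(i + 1) * d \<le> u" "c reg_separation < u" "c reg_threshold < u" "terms_end p u + 2 + i * (2 * d + 2) \<le> c reg_size"
    "w 0 = []" "w 1 = []" "w 3 = enc_polynomial p"
  shows "run Point (c, w, v) (40 * unit_cost (c reg_size) * length (enc_polynomial p) + 11 * unit_cost (c reg_size) * (d + 1) * i
      + 10 * unit_cost (c reg_size))
    (c(reg_fresh := terms_end p u + 2 + i * (2 * d + 2), reg_index := Suc i, reg_base := Suc i * d), w,
     v @ enc_gates (c reg_size) (point_gates p (c reg_threshold) (c reg_separation) d i u))"
proof -
  let ?U = "unit_cost (c reg_size)"
  let ?s = "terms_end p u"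
  have U: "100 + 100 * c reg_size \<le> ?U" using unit_cost_ge[of "c reg_size"] by simp
  have us: "u \<le> ?s" by (rule terms_end_ge)
  have idle: "clean c" "c reg_pow = 0" "c reg_mon = 0" "c reg_sum = 0" "c reg_var = 0" "c reg_a = 0"
     "c reg_b = 0" "c reg_x = 0" "c reg_y = 0" "c 31 = 0" "c 32 = 0"
    using assms(1) by (auto simp: between_points_def)
  have id: "i * d + d \<le> u" using assms(7) by simp
  have "i \<le> i * (2 * d + 2)" by simp
  then have iN: "i + 2 \<le> c reg_size" using assms(10) by linarith
  have "length (enc_polynomial p) * 15 \<le> length (enc_polynomial p) * (20 * ?U)" "8 * i \<le> ?U * i"
    by (rule mult_le_mono, use U in simp_all)+
  moreover have "d \<le> c reg_size" using us id assms(10) by linarith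
  ultimately have cost: "11 + (length (enc_polynomial p) * 15 + (8 * i + 10 * d)) \<le>
      7 * ?U + (?U * i + (length (enc_polynomial p) * (20 * ?U) + ?U * (i * d)))"
    using U by linarith
  define V where "V j = v @ enc_gates (c reg_size) (poly_gates p (i * d) u) @ enc_gates (c reg_size) [(gate_square, ?s, c reg_threshold, ?s + 1)] @
     enc_gates (c reg_size) (pairs_gates (c reg_separation) d (i * d) (?s + 2) j)" for j
  define C where "C j = c(reg_fresh := ?s + 2 + j * (2 * d + 2), reg_y := j * d)" for j
  have pairs: "run (For reg_index 31 Pair) (C 0, w, V 0) (i * (10 * ?U * (d + 1) + 8) + 2) ((C i)(reg_index := i, 31 := 0), w, V i)"
  proof (rule run_For[where c = C and w = "\<lambda>_. w" and v = V])
    fix j assume j: "j < i"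
    let ?c = "(C j)(reg_index := i - Suc j, 31 := Suc j)"
    let ?u = "?s + 2 + j * (2 * d + 2)"
    have "Suc j * d \<le> i * d" "Suc j * (2 * d + 2) \<le> i * (2 * d + 2)"
      by (rule mult_le_mono1, use j in simp)+
    then have le: "j * d + d \<le> i * d" "j * (2 * d + 2) + 2 * d + 2 \<le> i * (2 * d + 2)"
      by (simp_all add: algebra_simps)
    have "run Pair (?c, w, V j) (10 * unit_cost (?c reg_size) * (d + 1)) (?c(reg_fresh := ?u + 2 * d + 2, reg_y := j * d + d), w,
      V j @ enc_gates (?c reg_size) (pair_gates (?c reg_separation) d (i * d) (j * d) ?u))"
    proof (rule run_Pair)
      show "i * d + d \<le> ?u" "j * d + d \<le> ?u" using le id us by linarith+
      show "?u + 2 * d + 2 \<le> ?c reg_size" using le assms(10) by (simp add: C_def)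
    qed (use assms(2-9) idle us in \<open>simp_all add: C_def\<close>)
    then show "run Pair (?c, w, V j) (10 * ?U * (d + 1)) ((C (Suc j))(reg_index := i - Suc j, 31 := Suc j), w, V (Suc j))"
      by (rule run_conv) (auto simp: C_def V_def fun_eq_iff pairs_gates_Suc)
  qed (use assms(5) idle in \<open>simp_all add: C_def\<close>)
  let ?c = "(C i)(reg_y := 0, reg_index := Suc i)"
  have base: "run (For reg_dim 32 (Inc reg_base)) (?c, w, V i) (?c reg_dim * (2 + 8) + 2) (?c(reg_base := ?c reg_base + ?c reg_dim * 1), w, V i)"
    by (rule run_For_add) (use idle in \<open>auto simp: C_def intro!: run_conv[OF run_Inc]\<close>)
  have words: "w(3 := [], 1 := [], 0 := [], 3 := enc_polynomial p) = w"
    using assms(11-13) by (auto simp: fun_eq_iff)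
  show ?thesis
    unfolding Point_def
    apply (rule run_conv)
    apply (rule run_Seq, rule run_Move_word, simp)
    apply (rule run_Seq, rule run_Move_word, simp)
    apply (rule run_Seq, rule run_Eval_polynomial[where u = u and p = p and rest = "[]", OF _ _ assms(6)],
       (use assms(2-13) idle id us in simp_all)[9])
    apply (rule run_Seq, rule run_Move_word, simp)
    apply (rule run_intros | use assms(2-13) idle us in \<open>simp; fail\<close>)+
    apply (rule run_pre, rule pairs, use assms(2-13) idle in \<open>simp add: C_def V_def fun_eq_iff pairs_gates_def\<close>)
    apply (rule run_intros | use assms(2-13) id us in \<open>simp add: C_def; fail\<close>)+
    apply (rule run_pre, rule base, use assms(2-13) idle in \<open>simp add: C_def fun_eq_iff\<close>)
    using U assms(2-13) idle id us iN cost
    by (auto simp: C_def V_def fun_eq_iff point_gates_def Let_def algebra_simps enc_gates_Cons[of _ _ "pairs_gates _ _ _ _ _"])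
qed

definition Points :: prog where
  "Points = For reg_count 30 Point"

lemma run_Points:
  assumes "between_points c" "c 30 = 0" "c reg_count = k" "c reg_dim = d" "c reg_fresh = u" "c reg_base = 0" "c reg_index = 0" "polynomial_in d p"
    "k * d \<le> u" "c reg_separation < u" "c reg_threshold < u" "points_start p d u k \<le> c reg_size"
    "w 0 = []" "w 1 = []" "w 3 = enc_polynomial p"
  shows "run Points (c, w, v) (k * (40 * unit_cost (c reg_size) * length (enc_polynomial p) + 11 * unit_cost (c reg_size) * (d + 1) * k
      + 10 * unit_cost (c reg_size) + 8) + 2)
    (c(reg_fresh := points_start p d u k, reg_index := k, reg_base := k * d), w,
     v @ enc_gates (c reg_size) (points_gates p (c reg_threshold) (c reg_separation) d u k))"
proof -
  let ?U = "unit_cost (c reg_size)"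
  define C where "C i = c(reg_fresh := points_start p d u i, reg_index := i, reg_base := i * d)" for i
  define V where "V i = v @ enc_gates (c reg_size) (points_gates p (c reg_threshold) (c reg_separation) d u i)" for i
  have "run Points (C 0, w, V 0) (k * (40 * ?U * length (enc_polynomial p) + 11 * ?U * (d + 1) * k + 10 * ?U + 8) + 2)
    ((C k)(reg_count := k, 30 := 0), w, V k)"
    unfolding Points_def
  proof (rule run_For[where c = C and w = "\<lambda>_. w" and v = V])
    fix i assume i: "i < k"
    let ?u = "points_start p d u i"
    let ?c = "(C i)(reg_count := k - Suc i, 30 := Suc i)"
    have "Suc i * d \<le> k * d" by (rule mult_le_mono1) (use i in simp)
    then have id: "(i + 1) * d \<le> ?u" using assms(9) points_start_ge[of u p d i] by simp
    have uN: "points_start p d u (Suc i) \<le> c reg_size"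
      using points_start_mono[of "Suc i" k p d u] i assms(12) by linarith
    have "run Point (?c, w, V i) (40 * unit_cost (?c reg_size) * length (enc_polynomial p) +
        11 * unit_cost (?c reg_size) * (d + 1) * i + 10 * unit_cost (?c reg_size))
      (?c(reg_fresh := terms_end p ?u + 2 + i * (2 * d + 2), reg_index := Suc i, reg_base := Suc i * d), w,
       V i @ enc_gates (?c reg_size) (point_gates p (?c reg_threshold) (?c reg_separation) d i ?u))"
    proof (rule run_Point)
      show "(i + 1) * d \<le> ?u" by (rule id)
      show "?c reg_separation < ?u" "?c reg_threshold < ?u"
        using assms points_start_ge[of u p d i] by (simp_all add: C_def)
      show "between_points ?c" using assms(1) by (simp add: between_points_def C_def)
      show "terms_end p ?u + 2 + i * (2 * d + 2) \<le> ?c reg_size" using uN by (simp add: C_def)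
    qed (use assms in \<open>simp_all add: C_def\<close>)
    moreover have "11 * ?U * (d + 1) * i \<le> 11 * ?U * (d + 1) * k" by (rule mult_le_mono2) (use i in simp)
    ultimately show "run Point (?c, w, V i) (40 * ?U * length (enc_polynomial p) + 11 * ?U * (d + 1) * k + 10 * ?U)
       ((C (Suc i))(reg_count := k - Suc i, 30 := Suc i), w, V (Suc i))"
      by - (rule run_conv, assumption, auto simp: C_def V_def fun_eq_iff points_gates_Suc)
  qed (use assms in \<open>simp_all add: C_def\<close>)
  then show ?thesis
    by (rule run_conv[OF run_pre]) (use assms in \<open>auto simp: C_def V_def fun_eq_iff points_gates_def\<close>)
qed

text \<open>\<open>Eval_int\<close> always delivers its variable in \<open>reg_mon\<close>, so each
  numerator is saved in \<open>reg_a\<close> while the denominator is read.\<close>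

definition Params :: prog where
  "Params = (Eval_int ;; Copy reg_mon reg_a ;; Eval_int ;; Gate gate_mult reg_a reg_mon reg_threshold ;;
     Eval_int ;; Copy reg_mon reg_a ;; Eval_int ;; Gate gate_mult reg_a reg_mon reg_fresh ;;
     Gate gate_mult reg_separation reg_fresh reg_fresh ;; Inc reg_fresh ;; Clear reg_mon ;; Clear reg_a)"

lemma run_Params:
  assumes "clean c" "c reg_pow = 0" "c reg_mon = 0" "c reg_a = 0" "c reg_fresh = u" "c reg_threshold < u" "c reg_separation < u"
    "params_end \<theta> \<delta> u \<le> c reg_size" "w 0 = enc_fraction \<theta> @ enc_fraction \<delta> @ rest"
  shows "run Params (c, w, v) (20 * unit_cost (c reg_size) * (length (enc_fraction \<theta>) + length (enc_fraction \<delta>)))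
    (c(reg_fresh := params_end \<theta> \<delta> u),
     w(0 := rest, 1 := rev (enc_fraction \<theta> @ enc_fraction \<delta>) @ w 1),
     v @ enc_gates (c reg_size) (params_gates \<theta> \<delta> (c reg_threshold) (c reg_separation) u))"
proof -
  let ?U = "unit_cost (c reg_size)"
  have U: "100 \<le> ?U" using unit_cost_ge[of "c reg_size"] by simp
  obtain m1 m2 m3 m4 where f: "\<theta> = (m1, m2)" "\<delta> = (m3, m4)" by (cases \<theta>; cases \<delta>)
  define a where "a = int_end m1 u"
  define b where "b = int_end m2 (Suc a)"
  define a' where "a' = int_end m3 (Suc b)"
  define b' where "b' = int_end m4 (Suc a')"
  note defs = a_def[symmetric] b_def[symmetric] a'_def[symmetric] b'_def[symmetric]
  have less: "u < a" "a < b" "b < a'" "a' < b'"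
    using int_end_ge[of u m1] int_end_ge[of "Suc a" m2] int_end_ge[of "Suc b" m3]
      int_end_ge[of "Suc a'" m4] by (simp_all add: defs)
  have N: "params_end \<theta> \<delta> u = b' + 2" "b' + 2 \<le> c reg_size" using assms(8) by (simp_all add: params_end_def f defs)
  have cost: "\<exists>k. length (enc_int m1) = Suc k" by (simp add: length_enc_int)
  then obtain k where k: "length (enc_int m1) = Suc k" by blast
  have w0: "w 0 = enc_int m1 @ enc_int m2 @ enc_int m3 @ enc_int m4 @ rest" using assms(9) f by simp
  show ?thesis
    unfolding Params_def
    apply (rule run_conv)
    apply (rule run_Seq, rule run_Eval_int[where g = u and i = m1 and rest = "enc_int m2 @ enc_int m3 @ enc_int m4 @ rest"],
      (use assms(1-7) w0 less N in \<open>simp_all add: defs\<close>)[6])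
    apply (rule run_Seq, rule run_Copy_unit, (use assms(1-7) less N in \<open>simp_all add: defs\<close>)[6])
    apply (rule run_Seq, rule run_Eval_int[where g = "Suc a" and i = m2 and rest = "enc_int m3 @ enc_int m4 @ rest"],
      (use assms(1-7) w0 less N in \<open>simp_all add: defs\<close>)[6])
    apply (rule run_Seq, rule run_Gate, (use assms(1-7) less N in \<open>simp_all add: defs\<close>)[8])
    apply (rule run_Seq, rule run_Eval_int[where g = "Suc b" and i = m3 and rest = "enc_int m4 @ rest"],
      (use assms(1-7) w0 less N in \<open>simp_all add: defs\<close>)[6])
    apply (rule run_Seq, rule run_Copy_unit, (use assms(1-7) less N in \<open>simp_all add: defs\<close>)[6])
    apply (rule run_Seq, rule run_Eval_int[where g = "Suc a'" and i = m4 and rest = rest],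
      (use assms(1-7) w0 less N in \<open>simp_all add: defs\<close>)[6])
    apply (rule run_intros | use assms(1-7) less N in \<open>simp add: defs; fail\<close>)+
    using U assms(1-7) N k
    by (auto simp: fun_eq_iff algebra_simps params_gates_def Let_def f defs
      enc_gates_Cons[of _ _ "_ @ _"] enc_gates_Cons[of _ _ "[_]"])
qed


definition cmrc_to_etr :: "cmrc_instance \<Rightarrow> nat \<times> qf_formula" where
  "cmrc_to_etr I = (let L = length (encode CMRC I); n = 12 * L ^ 3 in
     (n, GeZero (gates_terms n (cmrc_gates (L ^ 2) I))))"

text \<open>The literal bits are the tag of \<open>GeZero\<close>. Word \<open>1\<close> is cleared
  after the dimension has been read, so that after the first evaluation it records exactly the
  objective, which is then stored in word \<open>3\<close> for later points.\<close>

definition Cmrc_to_etr :: prog where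
  "Cmrc_to_etr = (Prologue ;; Outs [False, True, False] ;; Read_unary reg_dim ;; Clear_word 1 ;;
     New reg_threshold ;; New reg_separation ;; Eval_polynomial ;; Clear reg_sum ;; Move_word 1 3 ;; Params ;;
     Read_unary reg_count ;; Clear_word 1 ;; Points ;; Outs [False])"

section \<open>Size and time of the reduction from clustering\<close>

lemma points_start_le:
  "i \<le> k \<Longrightarrow> points_start p d u i \<le> u + i * (2 * length (enc_polynomial p) + k * (2 * d + 2))"
proof (induction i)
  case (Suc i)
  have "i * (2 * d + 2) \<le> k * (2 * d + 2)" by (rule mult_le_mono1) (use Suc.prems in simp)
  moreover have "1 \<le> length (enc_polynomial p)" by (simp add: enc_polynomial_eq)
  ultimately show ?case
    using Suc terms_end_le[of p "points_start p d u i"] by (simp add: algebra_simps)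
qed simp

lemma params_end_le: "params_end \<theta> \<delta> u \<le> u + length (enc_fraction \<theta>) + length (enc_fraction \<delta>) + 1"
proof -
  obtain m1 m2 m3 m4 where f: "\<theta> = (m1, m2)" "\<delta> = (m3, m4)" by (cases \<theta>; cases \<delta>)
  let ?a = "Suc (int_end m1 u)"
  let ?b = "Suc (int_end m2 ?a)"
  let ?c = "Suc (int_end m3 ?b)"
  from int_end_le[of m1 u] int_end_le[of m2 ?a] int_end_le[of m3 ?b] int_end_le[of m4 ?c]
  show ?thesis by (simp add: params_end_def f)
qed

lemma length_enc_cmrc:
  "length (encode CMRC I) = (dimension I + 1) + length (enc_polynomial (objective I)) +
     length (enc_fraction (threshold I)) + length (enc_fraction (separation I)) + (num_points I + 1)"
  by (simp add: CMRC_def enc_cmrc_def)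

text \<open>The dominant contribution is \<open>k * k * (d + 1)\<close>, from the pairwise
  distances. It is at most \<open>L\<^sup>3\<close> because the number of points and the dimension
  are encoded in unary and therefore are below \<open>L\<close>.\<close>

lemma cmrc_size:
  assumes "length (encode CMRC I) = L"
  shows "cmrc_end (L ^ 2) I \<le> 12 * L ^ 3" "num_points I * dimension I \<le> L ^ 2" "dimension I \<le> L ^ 2" "L \<ge> 1"
proof -
  let ?p = "length (enc_polynomial (objective I))" and ?d = "dimension I" and ?k = "num_points I"
  let ?\<theta> = "length (enc_fraction (threshold I))" and ?\<delta> = "length (enc_fraction (separation I))"
  have L: "L = (?d + 1) + ?p + ?\<theta> + ?\<delta> + (?k + 1)" using assms length_enc_cmrc by simp
  then show "L \<ge> 1" by simp
  have "?k * ?d \<le> L * L" "?d * 1 \<le> L * L" by (rule mult_le_mono; use L in simp)+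
  then show "num_points I * dimension I \<le> L ^ 2" "dimension I \<le> L ^ 2" by (simp_all add: power2_eq_square)
  have sq: "L * 1 \<le> L * L" "1 * 1 \<le> L * L" by (rule mult_le_mono; use L in simp)+
  have cu: "L * L * 1 \<le> L * L * L" by (rule mult_le_mono; use L in simp)
  have "?k * ?p \<le> L * L" "?k * ?k * (?d + 1) \<le> L * L * L"
    by (intro mult_le_mono; use L in simp)+
  moreover have "cmrc_end (L ^ 2) I \<le> L ^ 2 + 2 + 2 * ?p + ?\<theta> + ?\<delta> + 1 + ?k * (2 * ?p + ?k * (2 * ?d + 2))"
    using points_start_le[of ?k ?k "objective I" ?d
        "params_end (threshold I) (separation I) (Suc (terms_end (objective I) (L ^ 2 + 2)))"]
      params_end_le[of "threshold I" "separation I" "Suc (terms_end (objective I) (L ^ 2 + 2))"]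
      terms_end_le[of "objective I" "L ^ 2 + 2"] unfolding cmrc_end_def by linarith
  moreover have "?k * (2 * ?p + ?k * (2 * ?d + 2)) = 2 * (?k * ?p) + 2 * (?k * ?k * (?d + 1))"
    by (simp add: algebra_simps)
  moreover have "?p + ?\<theta> + ?\<delta> \<le> L" using L by simp
  ultimately show "cmrc_end (L ^ 2) I \<le> 12 * L ^ 3"
    using sq cu unfolding power2_eq_square power3_eq_cube by linarith
qed

text \<open>The sum of the costs of all parts of \<open>Cmrc_to_etr\<close>, as a bare inequality
  between numbers. Every product in it is compared with \<open>X\<close>, one unit for each of
  \<open>(L + 1)\<^sup>3\<close> operations, after which the claim is linear.\<close>

lemma cmrc_cost:
  fixes U L p d k f :: nat
  assumes "d + 1 \<le> L" "p \<le> L" "k + 1 \<le> L" "f \<le> L" "100 \<le> U"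
  shows "1000 * (L + 1) ^ 3 + (3 + (7 * (d + 1) + (2 * (d + 1) + 1 + (U + 2 + (U + 2 + (20 * U * p + (U + (5 * p + 1 + (20 * U * f +
     (7 * (k + 1) + (2 * (f + (k + 1)) + 1 + (k * (40 * U * p + 11 * U * (d + 1) * k + 10 * U + 8) + 2 + 1))))))))))))
     \<le> 2000 * U * (L + 1) ^ 3"
proof -
  define M where "M = L + 1"
  define X where "X = U * (M * M * M)"
  have M: "1 \<le> M" "d + 1 \<le> M" "p \<le> M" "k + 1 \<le> M" "f \<le> M" using assms by (auto simp: M_def)
  \<comment> \<open>The factors 1 pad every product to three factors, each at most \<open>M\<close>,
    so that one monotonicity argument covers all of them.\<close>
  have "U * (p * 1 * 1) \<le> X" "U * (f * 1 * 1) \<le> X" "U * (k * p * 1) \<le> X" "U * ((d + 1) * k * k) \<le> X" "U * (k * 1 * 1) \<le> X"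
    "100 * (M * M * M) \<le> X" "U * (1 * 1 * 1) \<le> X" "100 * (M * 1 * 1) \<le> X"
    unfolding X_def by (intro mult_le_mono; use M assms in simp)+
  moreover have "k * (40 * U * p + 11 * U * (d + 1) * k + 10 * U + 8) =
      40 * (U * (k * p)) + 11 * (U * ((d + 1) * k * k)) + 10 * (U * k) + 8 * k"
    "20 * U * p = 20 * (U * p)" "20 * U * f = 20 * (U * f)" "2000 * U * (L + 1) ^ 3 = 2000 * X" "1000 * (L + 1) ^ 3 = 1000 * (M * M * M)"
    by (simp_all add: algebra_simps X_def M_def power3_eq_cube)
  ultimately show ?thesis using M by simp
qed

lemma run_Cmrc_to_etr:
  assumes "cmrc_valid I"
  shows "\<exists>c w. run Cmrc_to_etr (\<lambda>_. 0, (\<lambda>_. [])(0 := encode CMRC I), [])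
    (poly time_poly (length (encode CMRC I))) (c, w, encode ETR (cmrc_to_etr I))"
proof -
  define L where "L = length (encode CMRC I)"
  define N where "N = 12 * L ^ 3"
  let ?p = "objective I" and ?d = "dimension I" and ?k = "num_points I" and ?\<theta> = "threshold I" and ?\<delta> = "separation I"
  let ?f = "L ^ 2"
  let ?s = "terms_end ?p (?f + 2)"
  let ?e = "params_end ?\<theta> ?\<delta> (Suc ?s)"
  let ?U = "unit_cost N"
  note size = cmrc_size[OF L_def[symmetric], folded N_def]
  have p: "polynomial_in ?d ?p" using assms by (simp add: cmrc_valid_def)
  have fs: "?f + 2 \<le> ?s" by (rule terms_end_ge)
  have es: "Suc ?s \<le> ?e" using params_gates_below(2)[of ?f "Suc ?s" "?f + 1"] fs by simp
  have eN: "?e \<le> N" "points_start ?p ?d ?e ?k \<le> N"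
    using size(1) points_start_ge[of ?e ?p ?d ?k] by (simp_all add: cmrc_end_def)
  have enc: "encode CMRC I = enc_unary ?d @ enc_polynomial ?p @ enc_fraction ?\<theta> @ enc_fraction ?\<delta> @ enc_unary ?k"
    by (simp add: CMRC_def enc_cmrc_def)
  have c0: "start L reg_size = N" "start L reg_fresh = ?f" "clean (start L)"
    by (auto simp: start_def N_def clean_def)
  have c: "start L i = 0" if "i \<notin> {5, 6, 17, 18, 19}" for i using that by (simp add: start_def)
  have zero: "start L 7 = 0" "start L 8 = 0" "start L 9 = 0" "start L 10 = 0" "start L 11 = 0" "start L 13 = 0" "start L 14 = 0"
    "start L 23 = 0" "start L 24 = 0" "start L 25 = 0" "start L 26 = 0" "start L 27 = 0"
    "start L 28 = 0" "start L 29 = 0" "start L 30 = 0" "start L 31 = 0" "start L 32 = 0" by (rule c, simp)+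
  have len: "?d + 1 \<le> L" "length (enc_polynomial ?p) \<le> L" "?k + 1 \<le> L" "length (enc_fraction ?\<theta>) + length (enc_fraction ?\<delta>) \<le> L"
    using length_enc_cmrc[of I] by (auto simp: L_def)
  have U: "100 \<le> ?U" using unit_cost_ge[of N] by simp
  let ?v = "enc_unary N @ [False, True, False] @ enc_gates N (cmrc_gates ?f I) @ [False]"
  have "\<exists>c' w'. run Cmrc_to_etr (\<lambda>_. 0, (\<lambda>_. [])(0 := encode CMRC I), []) (2000 * ?U * (L + 1) ^ 3) (c', w', ?v)"
    unfolding Cmrc_to_etr_def
    apply (intro exI)
    apply (rule run_conv)
    apply (rule run_Seq, rule run_Prologue, rule L_def[symmetric])
    apply (rule run_Seq, rule run_Outs)
    apply (rule run_Seq, rule run_Read_unary[where n = ?d and rest = "enc_polynomial ?p @ enc_fraction ?\<theta> @ enc_fraction ?\<delta> @ enc_unary ?k"],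
      simp add: enc)
    apply (rule run_Seq, rule run_Clear_word)
    apply (rule run_intros | use c0 zero fs es eN in \<open>simp; fail\<close>)+
    apply (rule run_Eval_polynomial[where u = "?f + 2" and p = ?p and rest = "enc_fraction ?\<theta> @ enc_fraction ?\<delta> @ enc_unary ?k", OF _ _ p],
      (use c0 zero fs es eN size in simp_all)[9])
    apply (rule run_Seq, rule run_Clear_unit, use c0 zero fs es eN in simp)
    apply (rule run_Seq, rule run_Move_word, simp)
    apply (rule run_Seq, rule run_Params[where \<theta> = ?\<theta> and \<delta> = ?\<delta> and u = "Suc ?s" and rest = "enc_unary ?k"],
      (use c0 zero fs es eN in simp_all)[9])
    apply (rule run_Seq, rule run_Read_unary[where n = ?k and rest = "[]"], simp)
    apply (rule run_Seq, rule run_Clear_word)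
    apply (rule run_Seq, rule run_Points[where k = ?k and d = ?d and u = ?e and p = ?p],
      (use c0 zero fs es eN p size in \<open>simp_all add: between_points_def\<close>)[15])
    apply (rule run_Outs)
    using cmrc_cost[OF len U] c0 zero
    apply (simp add: L_def[symmetric])
    using c0 zero by (simp add: N_def[symmetric] cmrc_gates_def Let_def)
  moreover have "?v = encode ETR (cmrc_to_etr I)"
    by (simp add: ETR_def cmrc_to_etr_def Let_def L_def[symmetric] N_def[symmetric] enc_polynomial_eq enc_gates_def)
  ultimately show ?thesis unfolding poly_time_poly L_def[symmetric] N_def[symmetric] by simp
qed

theorem in_ER_CMRC: "in_ER CMRC"
  unfolding in_ER_def
proof (rule poly_reducibleI[where f = cmrc_to_etr and P = Cmrc_to_etr and p = time_poly])
  fix I assume "I \<in> instances CMRC"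
  then have I: "cmrc_valid I" by (simp add: CMRC_def)
  define L where "L = length (encode CMRC I)"
  define N where "N = 12 * L ^ 3"
  note size = cmrc_size[OF L_def[symmetric], folded N_def]
  note below = gates_below_mono[OF cmrc_gates_below[OF I size(2,3)] size(1)]
  have eq: "cmrc_to_etr I = (N, GeZero (gates_terms N (cmrc_gates (L ^ 2) I)))"
    by (simp add: cmrc_to_etr_def Let_def L_def N_def)
  show "cmrc_to_etr I \<in> instances ETR"
    by (simp add: eq ETR_def polynomial_in_gates_terms)
  show "yes CMRC I \<longleftrightarrow> yes ETR (cmrc_to_etr I)"
    using cmrc_gates_sat[OF I size(2,3)] eval_gates_terms(2)[OF below] by (simp add: eq ETR_def CMRC_def)
  show "\<exists>c w. run Cmrc_to_etr (\<lambda>_. 0, (\<lambda>_. [])(0 := encode CMRC I), [])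
        (poly time_poly (length (encode CMRC I))) (c, w, encode ETR (cmrc_to_etr I))"
    by (rule run_Cmrc_to_etr[OF I])
qed

theorem theorem3p2: "ER_hard CMRC \<and> ER_complete CMRC"
  by (simp add: ER_complete_def ER_hard_CMRC in_ER_CMRC)

end
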